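(* Let $m\ge 1$, let $B$ be the unit ball in $\mathbb{R}^2$, and let $A: B\times\mathbb{R}^{m\times 2}\to\mathbb{R}^{m\times 2}$, $(x,F)\mapsto A(x,F)$. Let $u\in W^{1,2}(B,\mathbb{R}^m)$ be a one-homogeneous solution (in the distributional sense) of the system $$\frac{\partial}{\partial x_q}A_{pq}(x,\nabla u)=0,\qquad 1\le p\le m,$$ where $A$ satisfies: (i) $A(x,F)$ is $C^1$ in the gradient argument $F$ and uniformly elliptic, i.e. there is $\nu>0$, independent of $x$ and $F$, such that $$\frac{\partial A_{pq}(x,F)}{\partial F_{rs}}a_pb_qa_rb_s\ \ge\ \nu|a|^2|b|^2\quad\text{for all } a\in\mathbb{R}^m,\ b\in\mathbb{R}^2;$$ (ii) $|x|\,\partial_{x_i}A(x,F)$ is continuous on $(B\setminus\{0\})\times\mathbb{R}^{m\times 2}$ for $i=1,2$; (iii) with $R=|x|$, $\lim_{R\to 0}R\,\partial_{x_i}A(x,\nabla u)=0$ for $i=1,2$. Then $u$ is linear.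
   Context: Repeated indices are summed. $\mathbb{R}^{m\times 2}$ is the space of real $m\times 2$ matrices with inner product $X\cdot Y=\mathrm{tr}(X^TY)$. A map $u$ is (positively) one-homogeneous if $u(\lambda x)=\lambda u(x)$ for all $\lambda\ge0$; equivalently $u(x)=|x|\,g(x/|x|)$ for some $g:\mathbb{S}^1\to\mathbb{R}^m$. For such $u$, $\nabla u$ depends only on the polar angle $\theta$ of $x$: $\nabla u=g\otimes e_R+g'\otimes e_\theta$, with $e_R=(\cos\theta,\sin\theta)$, $e_\theta=(-\sin\theta,\cos\theta)$. That $u$ solves the system in the distributional sense means $\int_B A(x,\nabla u)\cdot\nabla\varphi\,dx=0$ for all $\varphi\in C^1_c(B,\mathbb{R}^m)$. *)

theory Defs
  imports "HOL-Analysis.Analysis"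
begin

text \<open>
  An \<open>m \<times> n\<close> matrix is an element of \<open>real^'n^'m\<close>; the inner product of this type is
  \<open>X \<bullet> Y = tr (X\<^sup>T Y)\<close>, the sum of the products of the entries.
\<close>

definition C1_on :: "'a::real_normed_vector set \<Rightarrow> ('a \<Rightarrow> 'b::real_normed_vector) \<Rightarrow> bool" where
  "C1_on S f \<longleftrightarrow>
     (\<exists>f' :: 'a \<Rightarrow> 'a \<Rightarrow>\<^sub>L 'b. continuous_on S f' \<and>
        (\<forall>x\<in>S. (f has_derivative blinfun_apply (f' x)) (at x)))"

text \<open>
  \<open>C\<^sup>1\<^sub>c(\<Omega>)\<close>, each function being extended by zero to the whole space.
\<close>

definition C1c :: "'a::real_normed_vector set \<Rightarrow> ('a \<Rightarrow> 'b::real_normed_vector) set" where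
  "C1c \<Omega> = {\<phi>. C1_on UNIV \<phi> \<and> compact (closure {x. \<phi> x \<noteq> 0}) \<and> closure {x. \<phi> x \<noteq> 0} \<subseteq> \<Omega>}"

definition L2 :: "'a::euclidean_space set \<Rightarrow> ('a \<Rightarrow> 'b::euclidean_space) set" where
  "L2 \<Omega> = {f. f \<in> borel_measurable (lebesgue_on \<Omega>) \<and>
               integrable (lebesgue_on \<Omega>) (\<lambda>x. (norm (f x))\<^sup>2)}"

definition L1_loc :: "'a::euclidean_space set \<Rightarrow> ('a \<Rightarrow> 'b::euclidean_space) set" where
  "L1_loc \<Omega> = {f. \<forall>K. compact K \<and> K \<subseteq> \<Omega> \<longrightarrow> integrable (lebesgue_on K) f}"

text \<open>
  The entry \<open>G x $ p $ q\<close> is the weak partial derivative of \<open>u\<^sub>p\<close> with respect to \<open>x\<^sub>q\<close>; a weak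
  gradient is determined only up to a null set.
\<close>

definition weak_gradient ::
  "(real^'n) set \<Rightarrow> (real^'n \<Rightarrow> real^'m) \<Rightarrow> (real^'n \<Rightarrow> real^'n^'m) \<Rightarrow> bool" where
  "weak_gradient \<Omega> u G \<longleftrightarrow>
     u \<in> L1_loc \<Omega> \<and> G \<in> L1_loc \<Omega> \<and>
     (\<forall>\<phi> \<in> C1c \<Omega>. \<forall>p q.
        integral\<^sup>L (lebesgue_on \<Omega>) (\<lambda>x. u x $ p * frechet_derivative \<phi> (at x) (axis q 1)) =
        - integral\<^sup>L (lebesgue_on \<Omega>) (\<lambda>x. G x $ p $ q * (\<phi> x :: real)))"

definition W12 :: "(real^'n) set \<Rightarrow> (real^'n \<Rightarrow> real^'m) set" where
  "W12 \<Omega> = {u. u \<in> L2 \<Omega> \<and> (\<exists>G \<in> L2 \<Omega>. weak_gradient \<Omega> u G)}"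

definition one_homogeneous_on :: "'a::real_vector set \<Rightarrow> ('a \<Rightarrow> 'b::real_vector) \<Rightarrow> bool" where
  "one_homogeneous_on \<Omega> u \<longleftrightarrow>
     (\<forall>x\<in>\<Omega>. \<forall>c\<ge>0. c *\<^sub>R x \<in> \<Omega> \<longrightarrow> u (c *\<^sub>R x) = c *\<^sub>R u x)"

text \<open>
  \<open>div \<sigma> = 0\<close> in the sense of distributions, row by row, for a matrix field \<open>\<sigma>\<close>.
  Integrability is required explicitly because the Bochner integral of a non-integrable function
  is \<open>0\<close> by convention.
\<close>

definition distributionally_div_free :: "(real^'n) set \<Rightarrow> (real^'n \<Rightarrow> real^'n^'m) \<Rightarrow> bool" where
  "distributionally_div_free \<Omega> \<sigma> \<longleftrightarrow>
     (\<forall>\<phi> \<in> C1c \<Omega>.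
        integrable (lebesgue_on \<Omega>) (\<lambda>x. \<sigma> x \<bullet> jacobian \<phi> (at x)) \<and>
        integral\<^sup>L (lebesgue_on \<Omega>) (\<lambda>x. \<sigma> x \<bullet> jacobian \<phi> (at x)) = 0)"

text \<open>\<open>\<partial>A\<^sub>p\<^sub>q/\<partial>F\<^sub>r\<^sub>s\<close> at \<open>F\<close>, for \<open>A = A(x, \<cdot>)\<close> with \<open>x\<close> frozen.\<close>

definition matrix_partial ::
  "(real^'n^'m \<Rightarrow> real^'n^'m) \<Rightarrow> real^'n^'m \<Rightarrow> 'm \<Rightarrow> 'n \<Rightarrow> 'm \<Rightarrow> 'n \<Rightarrow> real" where
  "matrix_partial A F p q r s = frechet_derivative A (at F) (axis r (axis s 1)) $ p $ q"

definition uniformly_elliptic_on ::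
  "(real^'n) set \<Rightarrow> (real^'n \<Rightarrow> real^'n^'m \<Rightarrow> real^'n^'m) \<Rightarrow> bool" where
  "uniformly_elliptic_on \<Omega> A \<longleftrightarrow>
     (\<exists>\<nu>>0. \<forall>x\<in>\<Omega>. \<forall>F. \<forall>(a::real^'m) (b::real^'n).
        (\<Sum>p\<in>UNIV. \<Sum>q\<in>UNIV. \<Sum>r\<in>UNIV. \<Sum>s\<in>UNIV.
           matrix_partial (A x) F p q r s * a $ p * b $ q * a $ r * b $ s)
        \<ge> \<nu> * (norm a)\<^sup>2 * (norm b)\<^sup>2)"

text \<open>
  \<open>\<partial>f/\<partial>x\<^sub>i\<close> as a one-variable derivative, since total differentiability in \<open>x\<close> is not assumed.
\<close>

definition has_partial_at :: "'n \<Rightarrow> (real^'n \<Rightarrow> 'b::real_normed_vector) \<Rightarrow> real^'n \<Rightarrow> bool" where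
  "has_partial_at i f x \<longleftrightarrow> (\<lambda>t::real. f (x + t *\<^sub>R axis i 1)) differentiable (at 0)"

definition partial :: "'n \<Rightarrow> (real^'n \<Rightarrow> 'b::real_normed_vector) \<Rightarrow> real^'n \<Rightarrow> 'b" where
  "partial i f x = vector_derivative (\<lambda>t::real. f (x + t *\<^sub>R axis i 1)) (at 0)"

end

theory Submission
  imports Defs
begin

text \<open>
  In coordinates \<open>x = r (e + t n)\<close>, \<open>r > 0\<close>, on a cone around a coordinate half-axis, a
  one-homogeneous map is \<open>u = r f(t)\<close>, with \<open>\<nabla>u = f \<otimes> e + f' \<otimes> b\<close>, \<open>b = n - t e\<close>, depending on \<open>t\<close>
  only. Tested with \<open>\<alpha>(r) \<beta>(t) v\<close>, the system says that \<open>\<partial>\<^sub>t (\<sigma> b) = - \<partial>\<^sub>r (r \<sigma> e)\<close> in the weak sense,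
  where \<open>\<sigma> = A(x, \<nabla>u)\<close>.

  Averaging in \<open>r\<close> shows that \<open>t \<mapsto> \<integral> \<alpha>(r) A(x, f \<otimes> e + q \<otimes> b) b dr\<close> is continuous at \<open>q = f'(t)\<close>; by
  ellipticity it is strongly monotone in \<open>q\<close>, so \<open>f'\<close> is continuous. Then the equation holds
  pointwise for every fixed \<open>r\<close>. In its difference quotients the terms \<open>\<sigma> e\<close> cancel, and ellipticity
  bounds the increments of \<open>f'\<close>: \<open>\<nu> |f'(t) - f'(t\<^sub>0)| \<le> (C\<^sub>r(t\<^sub>0) + o(1)) |t - t\<^sub>0|\<close>, where \<open>C\<^sub>r(t\<^sub>0)\<close> consists of
  the derivatives \<open>r \<partial>A/\<partial>x\<^sub>i\<close> at radius \<open>r\<close>. The left-hand side does not depend on \<open>r\<close>, and \<open>C\<^sub>r(t\<^sub>0)\<close> tends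
  to \<open>0\<close> with \<open>r\<close> for almost every \<open>t\<^sub>0\<close>. So \<open>f'\<close> is locally Lipschitz with derivative \<open>0\<close> almost
  everywhere, hence constant, and \<open>u\<close> is linear on the cone. Four overlapping cones cover the
  punctured plane.
\<close>

section \<open>The fundamental lemma of the calculus of variations\<close>

text \<open>The ellipticity is of Legendre-Hadamard type, so \<open>A\<close> is monotone in the
  gradient along rank-one increments only. It suffices because, for given \<open>f(t)\<close>, the
  unknown \<open>f'(t)\<close> enters the gradient through a rank-one matrix with second factor
  \<open>b\<close>, and the equation controls the contraction of the stress with this same
  \<open>b\<close>, which is \<open>r\<close> times the gradient of the slope. The cancellation has
  two sources. As \<open>b' = -e\<close>, the formal \<open>t\<close>-derivative of the gradient is
  the rank-one matrix with factors \<open>f''\<close> and \<open>b\<close>, the terms with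
  \<open>f'\<close> and \<open>e\<close> dropping out; and the term \<open>- \<sigma> e\<close> from
  differentiating \<open>b\<close> in \<open>\<sigma> b\<close> meets the
  \<open>- \<sigma> e\<close> contained in the radial derivative of \<open>r \<sigma> e\<close>.
  Since \<open>f''\<close> is not known to exist, both are carried out with increments. The limit
  hypothesis is available along almost every ray only, without uniformity. It yields a vanishing
  derivative almost everywhere, which a Cantor function has as well; the increment bound at one
  fixed radius, valid at every slope, excludes this.\<close>

lemma AE_zero_if_box_integrals_zero:
  fixes h :: "'a::euclidean_space \<Rightarrow> real"
  assumes h: "integrable lborel h"
    and box: "\<And>a b. (LBINT x. indicator (box a b) x * h x) = 0"
  shows "AE x in lborel. h x = 0"
proof -
  have int [simp]: "integrable lborel (\<lambda>x. indicator A x * h x)" if "A \<in> sets lborel" for A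
    using integrable_mult_indicator[OF that h] by simp
  \<comment> \<open>The whole space is not a box, so its integral is found first, by exhaustion; the
    complement case of the Dynkin induction below needs it.\<close>
  have "((\<lambda>k. \<integral>x. indicator (box (- real k *\<^sub>R One) (real k *\<^sub>R One)) x * h x \<partial>lborel) \<longlonglongrightarrow> (LBINT x. h x))"
  proof (rule integral_dominated_convergence)
    show "AE x in lborel. (\<lambda>k. indicator (box (- real k *\<^sub>R One) (real k *\<^sub>R One)) x * h x) \<longlonglongrightarrow> h x"
    proof (rule AE_I2)
      fix x :: 'a
      obtain K :: nat where K: "real K > norm x" using reals_Archimedean2 by blast
      have "x \<in> box (- real k *\<^sub>R One) (real k *\<^sub>R One)" if "k \<ge> K" for k
        using that K Basis_le_norm[of _ x] by (force simp: mem_box abs_le_iff inner_simps)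
      then have "eventually (\<lambda>k. indicator (box (- real k *\<^sub>R One) (real k *\<^sub>R One)) x * h x = h x) sequentially"
        unfolding eventually_sequentially by (intro exI[of _ K]) auto
      then show "(\<lambda>k. indicator (box (- real k *\<^sub>R One) (real k *\<^sub>R One)) x * h x) \<longlonglongrightarrow> h x"
        by (rule tendsto_eventually)
    qed
    show "integrable lborel (\<lambda>x. \<bar>h x\<bar>)" using h by simp
  qed (use h in \<open>auto simp: indicator_def\<close>)
  then have total: "(LBINT x. h x) = 0"
    using box by (simp add: LIMSEQ_const_iff)
  let ?G = "range (\<lambda>(a, b). box a b :: 'a set)"
  have G: "?G = {box a b |a b. True}" by auto
  have "Int_stable ?G"
  proof (rule Int_stableI)
    fix X Y assume "X \<in> ?G" "Y \<in> ?G"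
    then obtain a b c d where "X = box a b" "Y = box c d" unfolding G by blast
    then have "\<exists>p q. X \<inter> Y = box p q" by (simp only: box_Int_box) blast
    then show "X \<inter> Y \<in> ?G" unfolding G by blast
  qed
  moreover have "?G \<subseteq> Pow UNIV" by simp
  ultimately have "(LBINT x. indicator A x * h x) = 0" if "A \<in> sigma_sets UNIV ?G" for A
    using that
  proof (induct rule: sigma_sets_induct_disjoint)
    case (basic A) then show ?case using box by auto
  next
    case empty then show ?case by simp
  next
    case (compl A)
    have A: "A \<in> sets lborel" using compl(1) by (simp add: borel_eq_box)
    have "(LBINT x. indicator (UNIV - A) x * h x) = (LBINT x. h x - indicator A x * h x)"
      by (intro Bochner_Integration.integral_cong) (auto simp: indicator_def)
    then show ?case using total compl(2) h A by simp
  next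
    case (union A)
    have A: "A i \<in> sets lborel" for i using union(2) by (auto simp: borel_eq_box)
    have "(LBINT x:(\<Union>i. A i). h x) = (\<Sum>i. \<integral>x\<in>A i. h x \<partial>lborel)"
      using A union(1) h
      by (intro lebesgue_integral_countable_add)
         (auto simp: disjoint_family_on_def set_integrable_def intro!: integrable_mult_indicator)
    then show ?case using union(3) by (simp add: set_lebesgue_integral_def)
  qed
  then have "(\<integral>x\<in>A. h x \<partial>lborel) = (\<integral>x\<in>A. 0 \<partial>lborel)" if "A \<in> sets lborel" for A
    using that by (simp add: borel_eq_box set_lebesgue_integral_def)
  then show ?thesis using density_unique_real[OF h, of "\<lambda>_. 0"] by simp
qed

section \<open>Continuously differentiable cutoffs and test functions of one variable\<close>

text \<open>The squared positive part is C^1, and the two squares never vanish together, so this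
  quotient is a C^1 transition from 0 to 1 on the unit interval. More smoothness is not asked of
  test functions.\<close>

definition smoothstep :: "real \<Rightarrow> real" where
  "smoothstep x = (max 0 x)\<^sup>2 / ((max 0 x)\<^sup>2 + (max 0 (1 - x))\<^sup>2)"

definition smoothstep' :: "real \<Rightarrow> real" where
  "smoothstep' x = (2 * max 0 x * ((max 0 x)\<^sup>2 + (max 0 (1 - x))\<^sup>2)
     - (max 0 x)\<^sup>2 * (2 * max 0 x - 2 * max 0 (1 - x))) / ((max 0 x)\<^sup>2 + (max 0 (1 - x))\<^sup>2)\<^sup>2"

lemma DERIV_max_0_squared: "((\<lambda>x::real. (max 0 x)\<^sup>2) has_real_derivative 2 * max 0 x) (at x)"
proof -
  consider "x > 0" | "x < 0" | "x = 0" by linarith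
  then show ?thesis
  proof cases
    case 1
    have "((\<lambda>x::real. x\<^sup>2) has_real_derivative 2 * max 0 x) (at x)"
      using 1 by (auto intro!: derivative_eq_intros)
    then show ?thesis
      by (rule DERIV_cong_ev[THEN iffD1, rotated -1])
         (use 1 in \<open>auto intro!: eventually_mono[OF eventually_gt_at_top[of 0]] eventually_nhds_in_open[of "{0<..}", THEN eventually_mono]\<close>)
  next
    case 2
    have "((\<lambda>x::real. 0) has_real_derivative 2 * max 0 x) (at x)" using 2 by simp
    then show ?thesis
      by (rule DERIV_cong_ev[THEN iffD1, rotated -1])
         (use 2 in \<open>auto intro!: eventually_nhds_in_open[of "{..<0}", THEN eventually_mono]\<close>)
  next
    case 3
    have "((\<lambda>h::real. max 0 h * (max 0 h / h)) \<longlongrightarrow> 0) (at 0)"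
    proof (rule Lim_null_comparison)
      show "((\<lambda>h::real. \<bar>h\<bar>) \<longlongrightarrow> 0) (at 0)" by (rule tendsto_eq_intros refl)+ simp
      show "\<forall>\<^sub>F h::real in at 0. norm (max 0 h * (max 0 h / h)) \<le> \<bar>h\<bar>"
        by (rule always_eventually) (auto simp: max_def)
    qed
    then show ?thesis using 3 by (simp add: DERIV_def power2_eq_square)
  qed
qed

lemma smoothstep_denom_pos: "(max 0 x)\<^sup>2 + (max 0 (1 - x))\<^sup>2 > (0::real)"
proof (cases "x > 0")
  case True then have "(max 0 x)\<^sup>2 > 0" by simp
  then show ?thesis by (meson add_pos_nonneg zero_le_power2)
next
  case False then have "(max 0 (1 - x))\<^sup>2 > 0" by (simp add: max_def)
  then show ?thesis by (meson add_nonneg_pos zero_le_power2)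
qed

lemma DERIV_smoothstep: "(smoothstep has_real_derivative smoothstep' x) (at x)"
proof -
  have 1: "((\<lambda>x::real. (max 0 (1 - x))\<^sup>2) has_real_derivative - 2 * max 0 (1 - x)) (at x)"
    using DERIV_chain2[OF DERIV_max_0_squared, of "\<lambda>x. 1 - x" "-1" x]
    by (simp add: DERIV_minus[OF DERIV_ident, THEN DERIV_add[OF DERIV_const[of 1]], simplified])
  show ?thesis
    unfolding smoothstep_def[abs_def] smoothstep'_def
    by (rule derivative_eq_intros DERIV_max_0_squared 1 refl)+
       (use smoothstep_denom_pos[of x] in \<open>auto simp: power2_eq_square\<close>)
qed

lemma continuous_smoothstep': "continuous_on UNIV smoothstep'"
  unfolding smoothstep'_def[abs_def]
  by (intro continuous_intros) (use smoothstep_denom_pos in \<open>simp add: less_imp_neq[symmetric]\<close>)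

lemma smoothstep_nonpos: "x \<le> 0 \<Longrightarrow> smoothstep x = 0"
  and smoothstep'_nonpos: "x \<le> 0 \<Longrightarrow> smoothstep' x = 0"
  and smoothstep_ge_1: "x \<ge> 1 \<Longrightarrow> smoothstep x = 1"
  by (auto simp: smoothstep_def smoothstep'_def max_def)

lemma smoothstep_bounds: "0 \<le> smoothstep x" "smoothstep x \<le> 1"
  using smoothstep_denom_pos[of x] by (auto simp: smoothstep_def divide_simps)

text \<open>Carrying the derivative along avoids \<^const>\<open>deriv\<close> in all later computations.\<close>
definition test_fun :: "real \<Rightarrow> real \<Rightarrow> (real \<Rightarrow> real) \<Rightarrow> (real \<Rightarrow> real) \<Rightarrow> bool" where
  "test_fun a b \<beta> \<beta>' \<longleftrightarrow>
     (\<forall>x. (\<beta> has_real_derivative \<beta>' x) (at x)) \<and> continuous_on UNIV \<beta>' \<and>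
     (\<exists>c d. a < c \<and> d < b \<and> (\<forall>x. x \<notin> {c..d} \<longrightarrow> \<beta> x = 0 \<and> \<beta>' x = 0))"

lemma test_funD:
  assumes "test_fun a b \<beta> \<beta>'"
  shows "(\<beta> has_real_derivative \<beta>' x) (at x)" "continuous_on A \<beta>'" "continuous_on A \<beta>"
    "x \<notin> {a<..<b} \<Longrightarrow> \<beta> x = 0" "x \<notin> {a<..<b} \<Longrightarrow> \<beta>' x = 0"
    "\<beta> \<in> borel_measurable borel" "\<beta>' \<in> borel_measurable borel"
proof -
  have 1: "continuous_on UNIV \<beta>"
    using assms unfolding test_fun_def by (meson DERIV_isCont continuous_at_imp_continuous_on)
  show "continuous_on A \<beta>" using 1 continuous_on_subset by blast
  show "continuous_on A \<beta>'" using assms continuous_on_subset unfolding test_fun_def by blast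
  show "\<beta> \<in> borel_measurable borel" "\<beta>' \<in> borel_measurable borel"
    using 1 assms by (auto simp: test_fun_def intro: borel_measurable_continuous_onI)
qed (use assms in \<open>auto simp: test_fun_def\<close>)

lemma test_fun_supportE:
  assumes "test_fun a b \<beta> \<beta>'"
  obtains c d where "a < c" "d < b" "\<And>x. x \<notin> {c..d} \<Longrightarrow> \<beta> x = 0" "\<And>x. x \<notin> {c..d} \<Longrightarrow> \<beta>' x = 0"
  using assms unfolding test_fun_def by blast

lemma test_fun_bounded:
  assumes "test_fun a b \<beta> \<beta>'"
  obtains B where "B > 0" "\<And>x. \<bar>\<beta> x\<bar> \<le> B" "\<And>x. \<bar>\<beta>' x\<bar> \<le> B"
proof -
  obtain c d where cd: "\<And>x. x \<notin> {c..d} \<Longrightarrow> \<beta> x = 0" "\<And>x. x \<notin> {c..d} \<Longrightarrow> \<beta>' x = 0"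
    using assms by (rule test_fun_supportE) blast
  have "bounded (\<beta> ` {c..d})" "bounded (\<beta>' ` {c..d})"
    using test_funD[OF assms] by (auto intro!: compact_imp_bounded compact_continuous_image)
  then obtain B1 B2 where "\<forall>y\<in>\<beta> ` {c..d}. norm y \<le> B1" "\<forall>y\<in>\<beta>' ` {c..d}. norm y \<le> B2"
    unfolding bounded_iff by blast
  then have "\<And>x. x \<in> {c..d} \<Longrightarrow> \<bar>\<beta> x\<bar> \<le> B1" "\<And>x. x \<in> {c..d} \<Longrightarrow> \<bar>\<beta>' x\<bar> \<le> B2"
    by auto
  then have "\<bar>\<beta> x\<bar> \<le> \<bar>B1\<bar> + \<bar>B2\<bar> + 1" "\<bar>\<beta>' x\<bar> \<le> \<bar>B1\<bar> + \<bar>B2\<bar> + 1" for x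
    using cd[of x] by (cases "x \<in> {c..d}"; fastforce)+
  then show ?thesis by (intro that[of "\<bar>B1\<bar> + \<bar>B2\<bar> + 1"]) auto
qed

lemma test_fun_mult:
  assumes "test_fun a b \<beta> \<beta>'" and "\<And>x. (g has_real_derivative g' x) (at x)" "continuous_on UNIV g'"
  shows "test_fun a b (\<lambda>x. g x * \<beta> x) (\<lambda>x. g' x * \<beta> x + g x * \<beta>' x)"
proof -
  have "continuous_on UNIV g"
    using assms(2) by (meson DERIV_isCont continuous_at_imp_continuous_on)
  then show ?thesis
    using assms test_funD[OF assms(1)] unfolding test_fun_def
    by (fastforce intro!: continuous_intros derivative_eq_intros)
qed

text \<open>The shift by 1 keeps the support at distance \<open>1 / k\<close> from both endpoints,
  so a cutoff may use the full interval of a test class. The transitions are complete at distance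
  \<open>2 / k\<close>.\<close>

definition plateau :: "real \<Rightarrow> real \<Rightarrow> real \<Rightarrow> real \<Rightarrow> real" where
  "plateau c d k x = smoothstep (k * (x - c) - 1) * smoothstep (k * (d - x) - 1)"

lemma plateau_bounds: "0 \<le> plateau c d k x" "plateau c d k x \<le> 1"
  using smoothstep_bounds by (auto simp: plateau_def mult_le_one)

lemma plateau_eq_0: "k > 0 \<Longrightarrow> x \<notin> {c<..<d} \<Longrightarrow> plateau c d k x = 0"
  by (auto simp: plateau_def not_less intro!: smoothstep_nonpos)
     (smt (verit) mult_nonneg_nonpos smoothstep_nonpos)+

lemma plateau_eq_1: "k * (x - c) \<ge> 2 \<Longrightarrow> k * (d - x) \<ge> 2 \<Longrightarrow> plateau c d k x = 1"
  by (simp add: plateau_def smoothstep_ge_1)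

lemma test_fun_plateau:
  assumes "k > 0" "a \<le> c" "d \<le> b"
  obtains \<beta>' where "test_fun a b (plateau c d k) \<beta>'"
proof -
  define \<beta>' where "\<beta>' x = smoothstep' (k * (x - c) - 1) * k * smoothstep (k * (d - x) - 1)
      - smoothstep (k * (x - c) - 1) * smoothstep' (k * (d - x) - 1) * k" for x
  have cont: "continuous_on UNIV smoothstep"
    using DERIV_smoothstep by (meson DERIV_isCont continuous_at_imp_continuous_on)
  have "(plateau c d k has_real_derivative \<beta>' x) (at x)" for x
    unfolding plateau_def[abs_def] \<beta>'_def
    by (rule derivative_eq_intros DERIV_chain2[OF DERIV_smoothstep] refl)+ (simp add: algebra_simps)
  moreover have "continuous_on UNIV \<beta>'"
    unfolding \<beta>'_def
    by (intro continuous_intros continuous_on_compose2[OF cont] continuous_on_compose2[OF continuous_smoothstep']) auto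
  moreover have "plateau c d k x = 0 \<and> \<beta>' x = 0" if "x \<notin> {c + 1 / k..d - 1 / k}" for x
  proof -
    have "k * (x - c) - 1 \<le> 0 \<or> k * (d - x) - 1 \<le> 0"
      using that assms(1) by (auto simp: field_simps)
    then show ?thesis by (auto simp: plateau_def \<beta>'_def smoothstep_nonpos smoothstep'_nonpos)
  qed
  moreover have "1 / k > 0" using assms by simp
  then have "a < c + 1 / k" "d - 1 / k < b" using assms by linarith+
  ultimately have "test_fun a b (plateau c d k) \<beta>'"
    unfolding test_fun_def by blast
  then show ?thesis by (rule that)
qed

lemma plateau_tendsto: "(\<lambda>k. plateau c d (real (Suc k)) x) \<longlonglongrightarrow> indicator {c<..<d} x"
proof (cases "x \<in> {c<..<d}")
  case True
  then obtain K :: nat where K: "real K > 2 / (x - c) + 2 / (d - x)" using reals_Archimedean2 by blast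
  have "plateau c d (real (Suc k)) x = 1" if "k \<ge> K" for k
  proof (rule plateau_eq_1)
    have "real (Suc k) > 2 / (x - c)" "real (Suc k) > 2 / (d - x)"
      using that K True
      by (smt (verit, best) divide_nonneg_nonneg of_nat_mono of_nat_Suc greaterThanLessThan_iff)+
    then show "2 \<le> real (Suc k) * (x - c)" "2 \<le> real (Suc k) * (d - x)"
      using True by (auto simp: field_simps)
  qed
  then show ?thesis
    using True by (intro tendsto_eventually) (auto simp: eventually_sequentially)
next
  case False
  then show ?thesis using plateau_eq_0[of "real (Suc _)" x c d] by simp
qed

lemma borel_measurable_plateau [measurable]: "plateau c d k \<in> borel_measurable borel"
proof -
  have "continuous_on UNIV smoothstep"
    using DERIV_smoothstep by (meson DERIV_isCont continuous_at_imp_continuous_on)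
  then have [measurable]: "smoothstep \<in> borel_measurable borel"
    by (rule borel_measurable_continuous_onI)
  show ?thesis unfolding plateau_def[abs_def] by measurable
qed

text \<open>Plateaus converge boundedly to indicators of subintervals, so dominated convergence
  turns vanishing test integrals into vanishing box integrals.\<close>

lemma AE_zero_if_test_integrals_zero:
  assumes h: "set_integrable lborel {a<..<b} h"
    and tests: "\<And>\<beta> \<beta>'. test_fun a b \<beta> \<beta>' \<Longrightarrow> (LBINT x. h x * \<beta> x) = 0"
  shows "AE x\<in>{a<..<b} in lborel. h x = 0"
proof -
  define g where "g x = indicator {a<..<b} x * h x" for x
  have g: "integrable lborel g" using h by (simp add: g_def[abs_def] set_integrable_def)
  have "(LBINT x. indicator (box c d) x * g x) = 0" for c d
  proof -
    \<comment> \<open>Clipping the box to the interval keeps the cutoffs admissible. If nothing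
      remains, the cutoffs are identically zero and the argument is unchanged.\<close>
    define c' d' where "c' = max a c" and "d' = min b d"
    have "((\<lambda>k. \<integral>x. plateau c' d' (real (Suc k)) x * g x \<partial>lborel) \<longlonglongrightarrow> (LBINT x. indicator {c'<..<d'} x * g x))"
    proof (rule integral_dominated_convergence)
      show "integrable lborel (\<lambda>x. \<bar>g x\<bar>)" using g by simp
      show "AE x in lborel. (\<lambda>k. plateau c' d' (real (Suc k)) x * g x) \<longlonglongrightarrow> indicator {c'<..<d'} x * g x"
        by (intro AE_I2 tendsto_mult plateau_tendsto tendsto_const)
      show "AE x in lborel. norm (plateau c' d' (real (Suc k)) x * g x) \<le> \<bar>g x\<bar>" for k
        using plateau_bounds[of c' d' "real (Suc k)"] by (intro AE_I2) (auto simp: abs_mult mult_left_le_one_le)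
      show "(\<lambda>x. plateau c' d' (real (Suc k)) x * g x) \<in> borel_measurable lborel" for k
        using g by (auto intro!: borel_measurable_times simp del: of_nat_Suc)
    qed (use g in simp)
    moreover have "(LBINT x. plateau c' d' (real (Suc k)) x * g x) = 0" for k
    proof -
      obtain \<beta>' where t: "test_fun a b (plateau c' d' (real (Suc k))) \<beta>'"
        using test_fun_plateau[of "real (Suc k)" a c' d' b] by (auto simp: c'_def d'_def)
      have eq: "plateau c' d' (real (Suc k)) x * g x = h x * plateau c' d' (real (Suc k)) x" for x
        using test_funD(4)[OF t, of x] by (auto simp: g_def indicator_def)
      show ?thesis unfolding eq by (rule tests[OF t])
    qed
    ultimately have "(LBINT x. indicator {c'<..<d'} x * g x) = 0"
      by (simp add: LIMSEQ_const_iff)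
    also have "(LBINT x. indicator {c'<..<d'} x * g x) = (LBINT x. indicator (box c d) x * g x)"
      by (intro Bochner_Integration.integral_cong) (auto simp: g_def c'_def d'_def indicator_def)
    finally show ?thesis .
  qed
  from AE_zero_if_box_integrals_zero[OF g this] show ?thesis
    by eventually_elim (auto simp: g_def)
qed

text \<open>Boxes in the plane are products of intervals, so products of cutoffs are enough. This is
  why only separated test functions in radius and slope ever have to be inserted into the weak
  equations.\<close>

lemma AE_zero_if_product_test_integrals_zero:
  fixes h :: "real \<times> real \<Rightarrow> real"
  assumes h: "set_integrable lborel ({a<..<b} \<times> {c<..<d}) h"
    and tests: "\<And>\<alpha> \<alpha>' \<beta> \<beta>'. test_fun a b \<alpha> \<alpha>' \<Longrightarrow> test_fun c d \<beta> \<beta>' \<Longrightarrow>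
        (LBINT z. h z * (\<alpha> (fst z) * \<beta> (snd z))) = 0"
  shows "AE z in lborel. z \<in> {a<..<b} \<times> {c<..<d} \<longrightarrow> h z = 0"
proof -
  define g where "g z = indicator ({a<..<b} \<times> {c<..<d}) z * h z" for z
  have g: "integrable lborel g" using h by (simp add: g_def[abs_def] set_integrable_def)
  have "(LBINT z. indicator (box p q) z * g z) = 0" for p q
  proof -
    define p1 q1 p2 q2 where "p1 = max a (fst p)" and "q1 = min b (fst q)" and "p2 = max c (snd p)" and "q2 = min d (snd q)"
    let ?f = "\<lambda>k z. plateau p1 q1 (real (Suc k)) (fst z) * plateau p2 q2 (real (Suc k)) (snd z)"
    have t: "\<exists>\<alpha>' \<beta>'. test_fun a b (plateau p1 q1 (real (Suc k))) \<alpha>' \<and> test_fun c d (plateau p2 q2 (real (Suc k))) \<beta>'" for k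
      using test_fun_plateau[of "real (Suc k)" a p1 q1 b] test_fun_plateau[of "real (Suc k)" c p2 q2 d]
      by (metis p1_def p2_def q1_def q2_def max.cobounded1 min.cobounded1 of_nat_0_less_iff zero_less_Suc)
    have "((\<lambda>k. \<integral>z. ?f k z * g z \<partial>lborel) \<longlonglongrightarrow> (LBINT z. (indicator {p1<..<q1} (fst z) * indicator {p2<..<q2} (snd z)) * g z))"
    proof (rule integral_dominated_convergence)
      show "integrable lborel (\<lambda>x. \<bar>g x\<bar>)" using g by simp
      show "AE z in lborel. (\<lambda>k. ?f k z * g z) \<longlonglongrightarrow> (indicator {p1<..<q1} (fst z) * indicator {p2<..<q2} (snd z)) * g z"
        by (intro AE_I2 tendsto_mult plateau_tendsto tendsto_const)
      show "AE z in lborel. norm (?f k z * g z) \<le> \<bar>g z\<bar>" for k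
        using plateau_bounds[of p1 q1 "real (Suc k)"] plateau_bounds[of p2 q2 "real (Suc k)"]
        by (intro AE_I2) (auto simp: abs_mult mult_left_le_one_le mult_le_one)
      have [measurable]: "fst \<in> borel_measurable (borel :: (real \<times> real) measure)" "snd \<in> borel_measurable (borel :: (real \<times> real) measure)"
        by (auto intro!: borel_measurable_continuous_onI continuous_intros)
      have [measurable]: "g \<in> borel_measurable borel" using g by auto
      show "(\<lambda>z. ?f k z * g z) \<in> borel_measurable lborel" for k
        by measurable
      show "(\<lambda>z. (indicator {p1<..<q1} (fst z) * indicator {p2<..<q2} (snd z)) * g z) \<in> borel_measurable lborel"
        by measurable
    qed
    moreover have "(LBINT z. ?f k z * g z) = 0" for k
    proof -
      obtain \<alpha>' \<beta>' where t: "test_fun a b (plateau p1 q1 (real (Suc k))) \<alpha>'" "test_fun c d (plateau p2 q2 (real (Suc k))) \<beta>'"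
        using t by blast
      have eq: "?f k z * g z = h z * ?f k z" for z
        using test_funD(4)[OF t(1), of "fst z"] test_funD(4)[OF t(2), of "snd z"]
        by (cases z) (auto simp: g_def indicator_def)
      show ?thesis unfolding eq by (rule tests[OF t])
    qed
    ultimately have "(LBINT z. (indicator {p1<..<q1} (fst z) * indicator {p2<..<q2} (snd z)) * g z) = 0"
      by (simp add: LIMSEQ_const_iff)
    moreover have "(indicator {p1<..<q1} (fst z) * indicator {p2<..<q2} (snd z)) * g z = indicator (box p q) z * g z" for z
      by (cases z; cases p; cases q) (auto simp: g_def p1_def p2_def q1_def q2_def indicator_def mem_box Basis_prod_def)
    ultimately show ?thesis by simp
  qed
  from AE_zero_if_box_integrals_zero[OF g this] show ?thesis
    by eventually_elim (auto simp: g_def)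
qed

section \<open>Primitives of test functions and the du Bois-Reymond lemma\<close>

lemma integral_test_fun_deriv_tail:
  assumes "test_fun a b \<beta> \<beta>'"
  shows "(LBINT x. indicator {s<..} x * \<beta>' x) = - \<beta> s"
proof -
  obtain c d where cd: "\<And>x. x \<notin> {c..d} \<Longrightarrow> \<beta> x = 0" "\<And>x. x \<notin> {c..d} \<Longrightarrow> \<beta>' x = 0"
    using assms by (rule test_fun_supportE) blast
  define M where "M = max s d + 1"
  have "(LBINT x. \<beta>' x * indicator {s..M} x) = \<beta> M - \<beta> s"
    using test_funD[OF assms]
    by (intro integral_FTC_Icc_real) (auto simp: M_def intro: continuous_on_interior[of UNIV])
  also have "\<beta> M = 0" by (rule cd) (auto simp: M_def)
  also have "(LBINT x. \<beta>' x * indicator {s..M} x) = (LBINT x. indicator {s<..} x * \<beta>' x)"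
  proof (rule integral_cong_AE)
    have [measurable]: "\<beta>' \<in> borel_measurable borel" by (rule test_funD[OF assms])
    show "(\<lambda>x. \<beta>' x * indicator {s..M} x) \<in> borel_measurable lborel" "(\<lambda>x. indicator {s<..} x * \<beta>' x) \<in> borel_measurable lborel"
      by auto
    show "AE x in lborel. \<beta>' x * indicator {s..M} x = indicator {s<..} x * \<beta>' x"
      using AE_lborel_singleton[of s]
      by eventually_elim (use cd(2) in \<open>force simp: indicator_def M_def\<close>)
  qed
  finally show ?thesis by simp
qed

text \<open>To the right of the support a primitive normalised on the left equals the total
  integral, so mean zero is exactly what makes it compactly supported.\<close>

lemma test_fun_primitive:
  assumes "test_fun a b \<gamma> \<gamma>'" and zero: "(LBINT x. \<gamma> x) = 0"
  obtains \<beta> where "test_fun a b \<beta> \<gamma>"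
proof -
  obtain c d where cd: "a < c" "d < b" "\<And>x. x \<notin> {c..d} \<Longrightarrow> \<gamma> x = 0"
    using assms(1) by (rule test_fun_supportE) blast
  have ct: "continuous_on UNIV \<gamma>" by (rule test_funD[OF assms(1)])
  have "\<exists>F. \<forall>x::real. ereal x > -\<infinity> \<longrightarrow> ereal x < \<infinity> \<longrightarrow> (F has_vector_derivative \<gamma> x) (at x)"
    using ct by (intro einterval_antiderivative) (auto simp: continuous_on_eq_continuous_at)
  then obtain F where F: "\<And>x. (F has_real_derivative \<gamma> x) (at x)"
    by (auto simp: has_real_derivative_iff_has_vector_derivative)
  define \<beta> where "\<beta> x = F x - F c" for x
  have D: "(\<beta> has_real_derivative \<gamma> x) (at x)" for x
    unfolding \<beta>_def[abs_def] using F by (auto intro!: derivative_eq_intros)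
  have "\<beta> x = 0" if "x < c" for x
  proof -
    have "\<beta> c = \<beta> x"
      by (rule DERIV_isconst_end[OF that])
        (use D DERIV_isCont in \<open>blast intro!: continuous_at_imp_continuous_on\<close>,
         metis D cd(3) atLeastAtMost_iff linorder_not_le)
    then show ?thesis by (simp add: \<beta>_def)
  qed
  moreover have "\<beta> x = 0" if "x > d" for x
  proof -
    define m where "m = min c x - 1"
    have "(LBINT y. \<gamma> y * indicator {m..x} y) = F x - F m"
      using F ct by (intro integral_FTC_Icc_real) (auto simp: m_def intro: continuous_on_interior[of UNIV])
    also have "(LBINT y. \<gamma> y * indicator {m..x} y) = (LBINT y. \<gamma> y)"
      using cd(3) that by (intro Bochner_Integration.integral_cong) (force simp: indicator_def m_def)+
    finally have "F x = F m" using zero by simp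
    moreover have "F m = F c" using \<open>\<And>x. x < c \<Longrightarrow> \<beta> x = 0\<close>[of m] by (simp add: \<beta>_def m_def)
    ultimately show ?thesis by (simp add: \<beta>_def)
  qed
  ultimately have "test_fun a b \<beta> \<gamma>"
    unfolding test_fun_def using D ct cd by (metis atLeastAtMost_iff linorder_not_le)
  then show ?thesis by (rule that)
qed

lemma test_fun_diff:
  assumes "test_fun a b \<beta> \<beta>'" "test_fun a b \<gamma> \<gamma>'"
  shows "test_fun a b (\<lambda>x. \<beta> x - \<gamma> x) (\<lambda>x. \<beta>' x - \<gamma>' x)"
proof -
  obtain c1 d1 where 1: "a < c1" "d1 < b" "\<And>x. x \<notin> {c1..d1} \<Longrightarrow> \<beta> x = 0" "\<And>x. x \<notin> {c1..d1} \<Longrightarrow> \<beta>' x = 0"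
    using assms(1) by (rule test_fun_supportE) blast
  obtain c2 d2 where 2: "a < c2" "d2 < b" "\<And>x. x \<notin> {c2..d2} \<Longrightarrow> \<gamma> x = 0" "\<And>x. x \<notin> {c2..d2} \<Longrightarrow> \<gamma>' x = 0"
    using assms(2) by (rule test_fun_supportE) blast
  have "\<beta> x - \<gamma> x = 0 \<and> \<beta>' x - \<gamma>' x = 0" if "x \<notin> {min c1 c2..max d1 d2}" for x
  proof -
    have "x \<notin> {c1..d1}" "x \<notin> {c2..d2}" using that by auto
    then show ?thesis using 1(3,4) 2(3,4) by simp
  qed
  moreover have "a < min c1 c2" "max d1 d2 < b" using 1 2 by auto
  ultimately show ?thesis
    using test_funD[OF assms(1)] test_funD[OF assms(2)] unfolding test_fun_def
    by (intro conjI allI derivative_intros continuous_intros) blast+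
qed

lemma test_fun_integrable:
  assumes t: "test_fun a b \<beta> \<beta>'" and g: "set_integrable lborel {a<..<b} g"
  shows "integrable lborel (\<lambda>x. g x * \<beta> x)" "integrable lborel (\<lambda>x. g x * \<beta>' x)"
proof -
  obtain B where B: "B > 0" "\<And>x. \<bar>\<beta> x\<bar> \<le> B" "\<And>x. \<bar>\<beta>' x\<bar> \<le> B" using test_fun_bounded[OF t] by metis
  have *: "integrable lborel (\<lambda>x. g x * \<gamma> x)"
    if m: "\<gamma> \<in> borel_measurable borel" and "\<And>x. \<bar>\<gamma> x\<bar> \<le> B" "\<And>x. x \<notin> {a<..<b} \<Longrightarrow> \<gamma> x = 0" for \<gamma>
  proof (rule Bochner_Integration.integrable_bound)
    show "integrable lborel (\<lambda>x. B * (indicator {a<..<b} x * g x))"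
      using g by (simp add: set_integrable_def)
    have eq: "g x * \<gamma> x = (indicator {a<..<b} x * g x) * \<gamma> x" for x
      using that(3)[of x] by (auto simp: indicator_def)
    have "(\<lambda>x. indicator {a<..<b} x * g x) \<in> borel_measurable borel"
      using borel_measurable_integrable[OF g[unfolded set_integrable_def]] by simp
    then show "(\<lambda>x. g x * \<gamma> x) \<in> borel_measurable lborel"
      unfolding eq using m by simp
    show "AE x in lborel. norm (g x * \<gamma> x) \<le> norm (B * (indicator {a<..<b} x * g x))"
      unfolding eq using that(2) B(1)
      by (intro AE_I2) (auto simp: abs_mult indicator_def mult.commute intro!: mult_right_mono)
  qed
  show "integrable lborel (\<lambda>x. g x * \<beta> x)" "integrable lborel (\<lambda>x. g x * \<beta>' x)"
    using test_funD[OF t] B by (auto intro!: *)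
qed

text \<open>The weight allows normalisation against the Jacobian \<open>r\<close> of the ray
  coordinates as well as against Lebesgue measure.\<close>

lemma test_fun_normalized:
  assumes "a < b" and w: "continuous_on UNIV w" "\<And>x. x \<in> {a<..<b} \<Longrightarrow> w x > (0::real)"
  obtains \<beta> \<beta>' where "test_fun a b \<beta> \<beta>'" "\<And>x. \<beta> x \<ge> 0" "(LBINT x. w x * \<beta> x) = 1"
proof -
  \<comment> \<open>With this \<open>k\<close> the transitions end at distance \<open>2 / k\<close>,
    a quarter of the interval, so the plateau is 1 on the middle half and the weighted integral
    cannot vanish.\<close>
  define k where "k = 8 / (b - a)"
  have k: "k > 0" using assms by (simp add: k_def)
  obtain \<beta>' where t: "test_fun a b (plateau a b k) \<beta>'"
    by (rule test_fun_plateau[of k a a b b]) (use k in auto)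
  define I where "I = (LBINT x. w x * plateau a b k x)"
  have "set_integrable lborel {a..b} w"
    using w by (intro borel_integrable_atLeastAtMost') (auto intro: continuous_on_subset)
  then have "set_integrable lborel {a<..<b} w"
    by (rule set_integrable_subset) auto
  from test_fun_integrable(1)[OF t this] have int: "integrable lborel (\<lambda>x. w x * plateau a b k x)" .
  have nonneg: "w x * plateau a b k x \<ge> 0" for x
    using plateau_bounds[of a b k x] plateau_eq_0[OF k, of x a b] w(2)[of x]
    by (cases "x \<in> {a<..<b}") auto
  have "I \<noteq> 0"
  proof
    assume "I = 0"
    then have "AE x in lborel. w x * plateau a b k x = 0"
      using int nonneg unfolding I_def by (subst (asm) integral_nonneg_eq_0_iff_AE) auto
    then have "AE x in lborel. x \<notin> {a + (b - a) / 4<..<b - (b - a) / 4}"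
    proof eventually_elim
      case (elim x)
      show ?case
      proof
        assume x: "x \<in> {a + (b - a) / 4<..<b - (b - a) / 4}"
        then have "plateau a b k x = 1"
          using \<open>a < b\<close> by (intro plateau_eq_1) (auto simp: k_def field_simps)
        moreover have "x \<in> {a<..<b}" using x \<open>a < b\<close> by (auto simp: field_simps)
        ultimately show False using elim w(2)[of x] by simp
      qed
    qed
    then have "emeasure lborel {a + (b - a) / 4<..<b - (b - a) / 4} = 0"
      using AE_iff_measurable[of "{a + (b - a) / 4<..<b - (b - a) / 4}" lborel
          "\<lambda>x. x \<notin> {a + (b - a) / 4<..<b - (b - a) / 4}"]
      by (auto simp: greaterThanLessThan_def greaterThan_def lessThan_def Int_def)
    then show False using \<open>a < b\<close> by (simp add: field_simps)
  qed
  moreover have "I \<ge> 0" unfolding I_def by (rule Bochner_Integration.integral_nonneg) (rule nonneg)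
  ultimately have "I > 0" by simp
  have "test_fun a b (\<lambda>x. 1 / I * plateau a b k x) (\<lambda>x. 1 / I * \<beta>' x)"
    using test_fun_mult[OF t, of "\<lambda>_. 1 / I" "\<lambda>_. 0"] by simp
  moreover have "(LBINT x. w x * (1 / I * plateau a b k x)) = 1"
    using \<open>I > 0\<close> by (simp add: mult.left_commute[of _ "1 / I"] I_def[symmetric] del: times_divide_eq_left) simp
  ultimately show ?thesis
    using \<open>I > 0\<close> plateau_bounds(1) by (intro that) auto
qed

lemma integrable_pair_mult:
  fixes f g :: "real \<Rightarrow> real"
  assumes "integrable lborel f" "integrable lborel g"
  shows "integrable (lborel \<Otimes>\<^sub>M lborel) (\<lambda>(x, y). f x * g y)"
proof (rule lborel_pair.Fubini_integrable)
  have [measurable]: "f \<in> borel_measurable borel" "g \<in> borel_measurable borel"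
    using assms by auto
  show "(\<lambda>(x, y). f x * g y) \<in> borel_measurable (lborel \<Otimes>\<^sub>M lborel)" by measurable
  show "integrable lborel (\<lambda>x. \<integral>y. norm (case (x, y) of (x, y) \<Rightarrow> f x * g y) \<partial>lborel)"
    using assms by (simp add: abs_mult)
  show "AE x in lborel. integrable lborel (\<lambda>y. case (x, y) of (x, y) \<Rightarrow> f x * g y)"
    using assms by simp
qed

text \<open>Subtracting a primitive of \<open>p\<close> reduces the claim to \<open>p = 0\<close>.
  The difference \<open>h\<close> then annihilates derivatives of test functions, that is, test
  functions of mean zero. Any test function becomes one of these on subtracting a multiple of a
  fixed normalised one, and the multiple accounts for the constant.\<close>

lemma du_bois_reymond:
  assumes "a < b"
    and f: "set_integrable lborel {a<..<b} f" and p: "set_integrable lborel {a<..<b} p"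
    and tests: "\<And>\<beta> \<beta>'. test_fun a b \<beta> \<beta>' \<Longrightarrow> (LBINT x. f x * \<beta>' x) = - (LBINT x. p x * \<beta> x)"
  shows "\<exists>c. AE x\<in>{a<..<b} in lborel. f x = c + (LBINT s:{a<..<x}. p s)"
proof -
  define q where "q x = indicator {a<..<b} x * p x" for x
  have q: "integrable lborel q" using p by (simp add: q_def[abs_def] set_integrable_def)
  then have [measurable]: "q \<in> borel_measurable borel" by auto
  have qi: "integrable lborel (\<lambda>s. indicator A s * q s)" if "A \<in> sets borel" for A
    using integrable_mult_indicator[of A lborel q] that q by simp
  define P where "P x = (LBINT s. indicator {..<x} s * q s)" for x
  have "(\<lambda>(x, s). if s < x then q s else 0) \<in> borel_measurable (lborel \<Otimes>\<^sub>M lborel)"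
    by measurable
  moreover have "(\<lambda>(x, s). indicator {..<x} s * q s) = (\<lambda>(x, s). if s < x then q s else 0)"
    by (auto simp: indicator_def)
  ultimately have Pm [measurable]: "P \<in> borel_measurable borel"
    unfolding P_def[abs_def] using lborel.borel_measurable_lebesgue_integral[of "\<lambda>x s. indicator {..<x} s * q s" lborel] by simp
  have Pb: "\<bar>P x\<bar> \<le> (LBINT s. \<bar>q s\<bar>)" for x
  proof -
    have "\<bar>P x\<bar> \<le> (LBINT s. \<bar>indicator {..<x} s * q s\<bar>)"
      unfolding P_def by (rule integral_abs_bound)
    also have "\<dots> \<le> (LBINT s. \<bar>q s\<bar>)"
      using q integrable_abs[OF qi[of "{..<x}"]] by (intro integral_mono) (auto simp: indicator_def)
    finally show ?thesis .
  qed
  have Pint: "integrable lborel (\<lambda>x. indicator {a<..<b} x * P x)"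
  proof (rule Bochner_Integration.integrable_bound)
    show "integrable lborel (\<lambda>x. indicator {a<..<b} x * (LBINT s. \<bar>q s\<bar>))"
      using \<open>a < b\<close> by (intro integrable_mult_left) simp
    show "AE x in lborel. norm (indicator {a<..<b} x * P x) \<le> norm (indicator {a<..<b} x * (LBINT s. \<bar>q s\<bar>))"
      using Pb by (intro AE_I2) (auto simp: indicator_def)
  qed simp
  \<comment> \<open>Integration by parts against a merely integrable \<open>p\<close>: Fubini on the
    set \<open>s < x\<close>, with the fundamental theorem applied to the test function
    only.\<close>
  have parts: "(LBINT x. P x * \<beta>' x) = - (LBINT x. p x * \<beta> x)" if t: "test_fun a b \<beta> \<beta>'" for \<beta> \<beta>'
  proof -
    have [measurable]: "\<beta> \<in> borel_measurable borel" "\<beta>' \<in> borel_measurable borel"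
      using test_funD[OF t] by auto
    have "set_integrable lborel {a<..<b} (\<lambda>_. 1::real)"
      using \<open>a < b\<close> by (simp add: set_integrable_def)
    from test_fun_integrable(2)[OF t this] have b': "integrable lborel \<beta>'" by simp
    have "integrable (lborel \<Otimes>\<^sub>M lborel) (\<lambda>(x, s). \<beta>' x * q s)"
      using b' q by (rule integrable_pair_mult)
    then have int: "integrable (lborel \<Otimes>\<^sub>M lborel) (\<lambda>(x, s). indicator {..<x} s * q s * \<beta>' x)"
    proof (rule Bochner_Integration.integrable_bound)
      have "(\<lambda>(x, s). if s < x then q s * \<beta>' x else 0) \<in> borel_measurable (lborel \<Otimes>\<^sub>M lborel)"
        by measurable
      moreover have "(\<lambda>(x, s). indicator {..<x} s * q s * \<beta>' x) = (\<lambda>(x, s). if s < x then q s * \<beta>' x else 0)"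
        by (auto simp: indicator_def)
      ultimately show "(\<lambda>(x, s). indicator {..<x} s * q s * \<beta>' x) \<in> borel_measurable (lborel \<Otimes>\<^sub>M lborel)"
        by simp
    qed (auto simp: indicator_def abs_mult intro!: AE_I2)
    have "(LBINT x. P x * \<beta>' x) = (LBINT x. (LBINT s. indicator {..<x} s * q s * \<beta>' x))"
      unfolding P_def using qi by simp
    also have "\<dots> = (LBINT s. (LBINT x. indicator {..<x} s * q s * \<beta>' x))"
      using lborel_pair.Fubini_integral[OF int] by simp
    also have "\<dots> = (LBINT s. - (p s * \<beta> s))"
    proof (rule Bochner_Integration.integral_cong[OF refl])
      fix s
      have "(LBINT x. indicator {..<x} s * q s * \<beta>' x) = (LBINT x. q s * (indicator {s<..} x * \<beta>' x))"
        by (intro Bochner_Integration.integral_cong) (auto simp: indicator_def)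
      also have "\<dots> = - (q s * \<beta> s)"
        using integral_test_fun_deriv_tail[OF t, of s] by simp
      also have "\<dots> = - (p s * \<beta> s)"
        using test_funD(4)[OF t, of s] by (auto simp: q_def indicator_def)
      finally show "(LBINT x. indicator {..<x} s * q s * \<beta>' x) = - (p s * \<beta> s)" .
    qed
    finally show ?thesis by simp
  qed
  define h where "h x = f x - P x" for x
  have hi: "set_integrable lborel {a<..<b} h"
    unfolding h_def using f Pint by (intro set_integral_diff) (auto simp: set_integrable_def)
  have h0: "(LBINT x. h x * \<gamma> x) = 0" if \<gamma>: "test_fun a b \<gamma> \<gamma>'" "(LBINT x. \<gamma> x) = 0" for \<gamma> \<gamma>'
  proof -
    obtain \<beta> where \<beta>: "test_fun a b \<beta> \<gamma>" using test_fun_primitive[OF \<gamma>] .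
    have "set_integrable lborel {a<..<b} P" using Pint by (simp add: set_integrable_def)
    then show ?thesis
      using test_fun_integrable(1)[OF \<gamma>(1)] f parts[OF \<beta>] tests[OF \<beta>] by (simp add: h_def left_diff_distrib)
  qed
  obtain \<gamma>0 \<gamma>0' where \<gamma>0: "test_fun a b \<gamma>0 \<gamma>0'" "(LBINT x. \<gamma>0 x) = 1"
  proof (rule test_fun_normalized[OF \<open>a < b\<close>])
    show "continuous_on UNIV (\<lambda>x::real. 1::real)" by simp
  qed simp_all
  define c where "c = (LBINT x. h x * \<gamma>0 x)"
  have one: "set_integrable lborel {a<..<b} (\<lambda>_. k::real)" for k
    using \<open>a < b\<close> by (simp add: set_integrable_def)
  have "AE x\<in>{a<..<b} in lborel. h x - c = 0"
  proof (rule AE_zero_if_test_integrals_zero)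
    show "set_integrable lborel {a<..<b} (\<lambda>x. h x - c)" using hi one by (rule set_integral_diff)
    fix \<gamma> \<gamma>' assume \<gamma>: "test_fun a b \<gamma> \<gamma>'"
    define m where "m = (LBINT x. \<gamma> x)"
    have i: "integrable lborel \<gamma>" "integrable lborel \<gamma>0"
      using test_fun_integrable(1)[OF \<gamma> one[of 1]] test_fun_integrable(1)[OF \<gamma>0(1) one[of 1]] by auto
    have "test_fun a b (\<lambda>x. \<gamma> x - m * \<gamma>0 x) (\<lambda>x. \<gamma>' x - m * \<gamma>0' x)"
      using test_fun_diff[OF \<gamma> test_fun_mult[OF \<gamma>0(1), of "\<lambda>_. m" "\<lambda>_. 0"]] by simp
    then have "(LBINT x. h x * (\<gamma> x - m * \<gamma>0 x)) = 0"
      by (rule h0) (use i \<gamma>0(2) in \<open>simp add: m_def\<close>)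
    moreover have "integrable lborel (\<lambda>x. h x * \<gamma> x)" "integrable lborel (\<lambda>x. h x * \<gamma>0 x)"
      using test_fun_integrable(1)[OF \<gamma> hi] test_fun_integrable(1)[OF \<gamma>0(1) hi] .
    ultimately have "(LBINT x. h x * \<gamma> x) - m * c = 0"
      by (simp add: right_diff_distrib c_def mult.left_commute[of _ m])
    then show "(LBINT x. (h x - c) * \<gamma> x) = 0"
      using i \<open>integrable lborel (\<lambda>x. h x * \<gamma> x)\<close> by (simp add: left_diff_distrib m_def)
  qed
  then show ?thesis
  proof (intro exI[of _ c], eventually_elim)
    case (elim x)
    have "P x = (LBINT s:{a<..<x}. p s)" if "x \<in> {a<..<b}"
      unfolding P_def set_lebesgue_integral_def using that
      by (intro Bochner_Integration.integral_cong) (auto simp: q_def indicator_def)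
    then show ?case using elim by (auto simp: h_def)
  qed
qed

section \<open>Functions whose derivative vanishes almost everywhere\<close>

text \<open>
  Both the exceptional set, on which \<open>f\<close> is locally Lipschitz, and its complement, by Sard, have
  negligible image; an interval that is negligible is a point.
\<close>
lemma constant_if_locally_Lipschitz_AE_deriv_zero:
  fixes f :: "real \<Rightarrow> real"
  assumes lip: "\<And>x. x \<in> {a<..<b} \<Longrightarrow> \<exists>B d. d > 0 \<and> (\<forall>y. \<bar>y - x\<bar> < d \<longrightarrow> \<bar>f y - f x\<bar> \<le> B * \<bar>y - x\<bar>)"
    and deriv: "AE x\<in>{a<..<b} in lborel. (f has_real_derivative 0) (at x)"
    and x: "x \<in> {a<..<b}" and y: "y \<in> {a<..<b}"
  shows "f x = f y"
proof (rule ccontr)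
  assume ne: "f x \<noteq> f y"
  \<comment> \<open>Sard's lemma concerns maps between spaces of vectors, hence the detour through
    \<open>real^1\<close>.\<close>
  define F :: "real^1 \<Rightarrow> real^1" where "F v = vec (f (v $ 1))" for v
  define N where "N = {x \<in> {a<..<b}. \<not> (f has_real_derivative 0) (at x)}"
  have "AE x in lebesgue. x \<notin> N"
    using AE_completion[OF deriv] by eventually_elim (auto simp: N_def)
  then have N: "negligible N"
    by (simp add: eventually_ae_filter_negligible) (metis mem_Collect_eq negligible_subset subsetI)
  have vl: "norm (vec p - vec q :: real^1) = \<bar>p - q\<bar>" for p q :: real
    by (simp add: norm_vec_def L2_set_def)
  have N1: "negligible (vec ` N :: (real^1) set)"
    by (rule negligible_locally_Lipschitz_image[OF _ N])
       (simp, intro exI[of _ UNIV] exI[of _ "1::real"], simp add: vl)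
  have im1: "negligible (F ` vec ` N)"
  proof (rule negligible_locally_Lipschitz_image[OF _ N1])
    fix v :: "real^1" assume "v \<in> vec ` N"
    then have v: "v $ 1 \<in> {a<..<b}" by (auto simp: N_def)
    then obtain B d where Bd: "d > 0" "\<And>y. \<bar>y - v $ 1\<bar> < d \<Longrightarrow> \<bar>f y - f (v $ 1)\<bar> \<le> B * \<bar>y - v $ 1\<bar>"
      using lip by blast
    have "norm (F w - F v) \<le> B * norm (w - v)" if "w \<in> ball v d" for w
    proof -
      have "norm (w - v) = \<bar>w $ 1 - v $ 1\<bar>" by (simp add: norm_vec_def L2_set_def)
      then show ?thesis using Bd(2)[of "w $ 1"] that by (simp add: F_def vl dist_norm norm_minus_commute)
    qed
    then show "\<exists>T B. open T \<and> v \<in> T \<and> (\<forall>y\<in>vec ` N \<inter> T. norm (F y - F v) \<le> B * norm (y - v))"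
      using Bd(1) by (intro exI[of _ "ball v d"] exI[of _ B]) auto
  qed simp
  have im2: "negligible (F ` vec ` ({a<..<b} - N))"
  proof (rule baby_Sard[where f' = "\<lambda>_ _. 0"])
    fix v :: "real^1" assume "v \<in> vec ` ({a<..<b} - N)"
    then have "(f has_real_derivative 0) (at (v $ 1))" by (auto simp: N_def)
    then have "(f has_derivative (\<lambda>_. 0)) (at (v $ 1))" by (simp add: has_field_derivative_def lambda_zero)
    then have "((\<lambda>v. f (v $ 1)) has_derivative (\<lambda>_. 0)) (at v)"
      using has_derivative_compose[of "\<lambda>v::real^1. v $ 1" "\<lambda>v. v $ 1" v UNIV f "\<lambda>_. 0"]
      by (auto intro: bounded_linear_imp_has_derivative bounded_linear_vec_nth)
    then have "(F has_derivative (\<lambda>_. 0)) (at v)"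
      unfolding F_def[abs_def] has_derivative_componentwise_within[of "\<lambda>v. vec (f (v $ 1))"] by (auto simp: Basis_vec_def inner_axis)
    then show "(F has_derivative (\<lambda>_. 0)) (at v within vec ` ({a<..<b} - N))"
      by (rule has_derivative_at_withinI)
    show "rank (matrix (\<lambda>_::real^1. 0::real^1)) < CARD(1)"
      by (simp add: rank_eq_0 matrix_def vec_eq_iff)
  qed simp
  have "isCont f z" if z: "z \<in> {a<..<b}" for z
  proof -
    obtain B d where Bd: "d > 0" "\<And>y. \<bar>y - z\<bar> < d \<Longrightarrow> \<bar>f y - f z\<bar> \<le> B * \<bar>y - z\<bar>"
      using lip[OF z] by blast
    have "((\<lambda>y. f y - f z) \<longlongrightarrow> 0) (at z)"
    proof (rule Lim_null_comparison)
      show "\<forall>\<^sub>F y in at z. norm (f y - f z) \<le> B * \<bar>y - z\<bar>"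
        using Bd unfolding eventually_at by (auto simp: dist_real_def)
      show "((\<lambda>y. B * \<bar>y - z\<bar>) \<longlongrightarrow> 0) (at z)"
        by (rule tendsto_eq_intros refl)+ simp
    qed
    then show ?thesis by (simp add: isCont_def LIM_zero_iff)
  qed
  then have cont: "continuous_on {a<..<b} f" by (intro continuous_at_imp_continuous_on) blast
  have sub: "box (vec (min (f x) (f y))) (vec (max (f x) (f y)) :: real^1) \<subseteq> F ` vec ` N \<union> F ` vec ` ({a<..<b} - N)"
  proof
    fix v :: "real^1" assume "v \<in> box (vec (min (f x) (f y))) (vec (max (f x) (f y)))"
    then have "v $ 1 \<in> {min (f x) (f y)<..<max (f x) (f y)}" by (auto simp: mem_box_cart)
    moreover have "connected (f ` {a<..<b})" using cont by (intro connected_continuous_image) auto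
    ultimately have "v $ 1 \<in> f ` {a<..<b}"
      using x y unfolding connected_iff_interval by (auto simp: min_def max_def split: if_splits)
    then obtain z where z: "z \<in> {a<..<b}" "v $ 1 = f z" by auto
    have "v = F (vec z)" using z by (simp add: F_def vec_eq_iff)
    then show "v \<in> F ` vec ` N \<union> F ` vec ` ({a<..<b} - N)" using z(1) by (cases "z \<in> N") blast+
  qed
  moreover have "negligible (F ` vec ` N \<union> F ` vec ` ({a<..<b} - N))" using im1 im2 by (rule negligible_Un)
  ultimately have "negligible (box (vec (min (f x) (f y))) (vec (max (f x) (f y)) :: real^1))"
    using negligible_subset by blast
  moreover have "vec ((f x + f y) / 2) \<in> box (vec (min (f x) (f y))) (vec (max (f x) (f y)) :: real^1)"
    using ne by (auto simp: mem_box_cart)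
  ultimately show False using open_not_negligible[OF open_box] by blast
qed

section \<open>Projective coordinates on a cone\<close>

text \<open>The sign of \<open>e\<close> selects one half of a coordinate axis. The cones are
  symmetric in \<open>n\<close>, so one orientation of \<open>n\<close> serves both halves.\<close>

locale coordinate_frame =
  fixes e n :: "real^2"
  assumes frame: "\<exists>i j. i \<noteq> j \<and> (e = axis i 1 \<or> e = - axis i 1) \<and> n = axis j 1"
begin

lemma inner_frame: "e \<bullet> e = 1" "n \<bullet> n = 1" "e \<bullet> n = 0" "n \<bullet> e = 0"
  using frame by (auto simp: inner_axis_axis)

lemma frame_expansion: "x = (x \<bullet> e) *\<^sub>R e + (x \<bullet> n) *\<^sub>R n"
proof -
  obtain i j where ij: "i \<noteq> j" "e = axis i 1 \<or> e = - axis i 1" "n = axis j 1" using frame by blast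
  have UN: "k = i \<or> k = j" for k :: 2
    using ij(1) exhaust_2[of i] exhaust_2[of j] exhaust_2[of k] by auto
  have c: "axis i (1::real) $ i = 1" "axis i (1::real) $ j = 0" "axis j (1::real) $ i = 0" "axis j (1::real) $ j = 1"
    using ij(1) by (auto simp: axis_def)
  have "(x \<bullet> e) * e $ i = x $ i" "(x \<bullet> e) * e $ j = 0"
    using ij(2) c by (auto simp: inner_axis)
  moreover have "(x \<bullet> n) * n $ i = 0" "(x \<bullet> n) * n $ j = x $ j"
    unfolding ij(3) using c by (auto simp: inner_axis)
  ultimately have "x $ k = ((x \<bullet> e) *\<^sub>R e + (x \<bullet> n) *\<^sub>R n) $ k" for k
    using UN[of k] by (elim disjE) simp_all
  then show ?thesis by (simp add: vec_eq_iff)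
qed

text \<open>
  Projective instead of polar coordinates: a one-homogeneous function takes the form \<open>r f(t)\<close>,
  and no trigonometric functions occur.
\<close>
definition ray :: "real \<Rightarrow> real \<Rightarrow> real^2" where
  "ray r t = r *\<^sub>R (e + t *\<^sub>R n)"

text \<open>The slope \<open>t = (x \<bullet> n) / (x \<bullet> e)\<close> has gradient
  \<open>conormal t / r\<close> with \<open>r = x \<bullet> e\<close>. This vector therefore
  accompanies every \<open>t\<close>-derivative, both of the profile of \<open>u\<close> and of test
  functions, and it is orthogonal to the ray.\<close>

definition conormal :: "real \<Rightarrow> real^2" where
  "conormal t = n - t *\<^sub>R e"

lemma inner_ray: "ray r t \<bullet> e = r" "ray r t \<bullet> n = r * t"
  by (simp_all add: ray_def inner_add_left inner_frame)

lemma ray_coords: "x \<bullet> e \<noteq> 0 \<Longrightarrow> ray (x \<bullet> e) ((x \<bullet> n) / (x \<bullet> e)) = x"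
  using frame_expansion[of x] by (simp add: ray_def scaleR_add_right)

lemma norm_frame_sum: "(norm (a *\<^sub>R e + b *\<^sub>R n))\<^sup>2 = a\<^sup>2 + b\<^sup>2"
  unfolding power2_norm_eq_inner
  by (simp add: inner_add_left inner_add_right inner_frame power2_eq_square)

lemma norm_ray: "norm (ray r t) = \<bar>r\<bar> * sqrt (1 + t\<^sup>2)"
proof -
  have "(norm (e + t *\<^sub>R n))\<^sup>2 = 1 + t\<^sup>2" using norm_frame_sum[of 1 t] by simp
  then have "norm (e + t *\<^sub>R n) = sqrt (1 + t\<^sup>2)" by (metis norm_ge_zero real_sqrt_unique)
  then show ?thesis by (simp add: ray_def)
qed

lemma norm_conormal: "(norm (conormal t))\<^sup>2 = 1 + t\<^sup>2"
  using norm_frame_sum[of "- t" 1] by (simp add: conormal_def)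

text \<open>The radial bound \<open>1/4\<close> comes from here: slopes up to 3 stretch a ray by at
  most \<open>sqrt (1 + 3\<^sup>2)\<close>, which is below 4.\<close>

lemma ray_in_ball:
  assumes "\<bar>r\<bar> < 1/4" "\<bar>t\<bar> \<le> 3"
  shows "ray r t \<in> ball 0 1"
proof -
  have "t\<^sup>2 \<le> 3\<^sup>2" using assms(2) by (metis abs_le_square_iff abs_numeral)
  then have "sqrt (1 + t\<^sup>2) \<le> sqrt 16" by (intro real_sqrt_le_mono) simp
  then have "sqrt (1 + t\<^sup>2) \<le> 4" by simp
  then have "\<bar>r\<bar> * sqrt (1 + t\<^sup>2) \<le> \<bar>r\<bar> * 4" by (intro mult_left_mono) auto
  then have "\<bar>r\<bar> * sqrt (1 + t\<^sup>2) < 1" using assms(1) by linarith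
  then show ?thesis by (simp add: norm_ray)
qed

lemma ray_nonzero: "r \<noteq> 0 \<Longrightarrow> ray r t \<noteq> 0"
  using inner_ray(1)[of r t] by auto

lemma continuous_on_ray [continuous_intros]:
  "continuous_on S f \<Longrightarrow> continuous_on S g \<Longrightarrow> continuous_on S (\<lambda>x. ray (f x) (g x))"
  unfolding ray_def by (intro continuous_intros)

lemma continuous_on_conormal [continuous_intros]:
  "continuous_on S g \<Longrightarrow> continuous_on S (\<lambda>x. conormal (g x))"
  unfolding conormal_def by (intro continuous_intros)

lemma measurable_ray [measurable]:
  assumes [measurable]: "f \<in> borel_measurable M" "g \<in> borel_measurable M"
  shows "(\<lambda>x. ray (f x) (g x)) \<in> borel_measurable M"
  unfolding ray_def by measurable

lemma measurable_conormal [measurable]: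
  assumes [measurable]: "g \<in> borel_measurable M"
  shows "(\<lambda>x. conormal (g x)) \<in> borel_measurable M"
  unfolding conormal_def by measurable

section \<open>Change of variables to ray coordinates\<close>

lemma distr_frame: "distr (lborel \<Otimes>\<^sub>M lborel) borel (\<lambda>(r, s). r *\<^sub>R e + s *\<^sub>R n) = lborel"
proof (rule lborel_eqI[symmetric])
  fix l u :: "real^2"
  assume lu: "\<And>b. b \<in> Basis \<Longrightarrow> l \<bullet> b \<le> u \<bullet> b"
  obtain i j where ij: "i \<noteq> j" "e = axis i 1 \<or> e = - axis i 1" "n = axis j 1" using frame by blast
  have UN: "k = i \<or> k = j" for k :: 2
    using ij(1) exhaust_2[of i] exhaust_2[of j] exhaust_2[of k] by auto
  have all2: "(\<forall>k. Q k) \<longleftrightarrow> Q i \<and> Q j" for Q :: "2 \<Rightarrow> bool" using UN by metis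
  have e_comps: "axis i (1::real) $ i = 1" "axis i (1::real) $ j = 0" "axis j (1::real) $ i = 0" "axis j (1::real) $ j = 1"
    using ij(1) by (auto simp: axis_def)
  have le: "l $ k \<le> u $ k" for k
    using lu[of "axis k 1"] by (simp add: inner_axis)
  \<comment> \<open>When \<open>e\<close> is a negative axis vector, the coordinate along it runs
    through the reflected interval.\<close>
  define I where "I = (if e = axis i 1 then {l $ i<..<u $ i} else {- u $ i<..<- l $ i})"
  have "axis i (1::real) \<noteq> - axis i 1" by (auto simp: vec_eq_iff axis_def)
  then have "(\<lambda>(r, s). r *\<^sub>R e + s *\<^sub>R n) -` box l u \<inter> space (lborel \<Otimes>\<^sub>M lborel) = I \<times> {l $ j<..<u $ j}"
    using ij(2) unfolding mem_box_cart vimage_def all2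
    by (elim disjE) (auto simp: ij(3) e_comps space_pair_measure I_def)
  then have "emeasure (distr (lborel \<Otimes>\<^sub>M lborel) borel (\<lambda>(r, s). r *\<^sub>R e + s *\<^sub>R n)) (box l u)
     = emeasure (lborel \<Otimes>\<^sub>M lborel) (I \<times> {l $ j<..<u $ j})"
    by (subst emeasure_distr) auto
  also have "\<dots> = emeasure lborel I * emeasure lborel {l $ j<..<u $ j}"
    by (rule lborel.emeasure_pair_measure_Times) (auto simp: I_def)
  also have "\<dots> = ennreal ((u $ i - l $ i) * (u $ j - l $ j))"
    using le[of i] le[of j] by (auto simp: I_def ennreal_mult)
  also have "(u $ i - l $ i) * (u $ j - l $ j) = (\<Prod>b\<in>Basis. (u - l) \<bullet> b)"
  proof -
    have B: "(Basis :: (real^2) set) = {axis i 1, axis j 1}"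
    proof -
      have "(UNIV :: 2 set) = {i, j}" using UN by auto
      then show ?thesis by (auto simp: Basis_vec_def)
    qed
    have ne: "axis i (1::real) \<noteq> axis j 1" using ij(1) by (simp add: axis_eq_axis)
    have "(\<Prod>b\<in>Basis. (u - l) \<bullet> b) = (u - l) \<bullet> axis i 1 * ((u - l) \<bullet> axis j 1)"
      unfolding B using ne by simp
    then show ?thesis by (simp add: inner_axis)
  qed
  finally show "emeasure (distr (lborel \<Otimes>\<^sub>M lborel) borel (\<lambda>(r, s). r *\<^sub>R e + s *\<^sub>R n)) (box l u)
    = ennreal (\<Prod>b\<in>Basis. (u - l) \<bullet> b)" .
qed simp

text \<open>For fixed \<open>r > 0\<close> the substitution \<open>s = r * t\<close> in the second
  coordinate produces the Jacobian \<open>r\<close>. Only the open half-plane in direction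
  \<open>e\<close> is covered by rays with positive \<open>r\<close>.\<close>

lemma nn_integral_ray:
  assumes [measurable]: "f \<in> borel_measurable borel"
  shows "(\<integral>\<^sup>+x. indicator {x. x \<bullet> e > 0} x * f x \<partial>lborel) =
    (\<integral>\<^sup>+(r, t). ennreal (r * indicator {0<..} r) * f (ray r t) \<partial>(lborel \<Otimes>\<^sub>M lborel))"
proof -
  have [measurable]: "{x. 0 < x \<bullet> e} \<in> sets borel"
    by (intro borel_open open_Collect_less continuous_intros)
  have "(\<integral>\<^sup>+x. indicator {x. x \<bullet> e > 0} x * f x \<partial>lborel) =
      (\<integral>\<^sup>+z. (case z of (r, s) \<Rightarrow> indicator {0<..} r * f (r *\<^sub>R e + s *\<^sub>R n)) \<partial>(lborel \<Otimes>\<^sub>M lborel))"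
    by (subst distr_frame[symmetric], subst nn_integral_distr)
       (auto intro!: nn_integral_cong simp: inner_add_left inner_frame indicator_def)
  also have "\<dots> = (\<integral>\<^sup>+r. (\<integral>\<^sup>+s. indicator {0<..} r * f (r *\<^sub>R e + s *\<^sub>R n) \<partial>lborel) \<partial>lborel)"
    by (subst lborel.nn_integral_fst[symmetric]) auto
  also have "\<dots> = (\<integral>\<^sup>+r. (\<integral>\<^sup>+t. ennreal (r * indicator {0<..} r) * f (ray r t) \<partial>lborel) \<partial>lborel)"
  proof (rule nn_integral_cong)
    fix r :: real
    show "(\<integral>\<^sup>+s. indicator {0<..} r * f (r *\<^sub>R e + s *\<^sub>R n) \<partial>lborel) =
        (\<integral>\<^sup>+t. ennreal (r * indicator {0<..} r) * f (ray r t) \<partial>lborel)"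
    proof (cases "r > 0")
      case True
      then show ?thesis
        by (subst nn_integral_real_affine[of _ r 0])
           (auto simp: ray_def scaleR_add_right nn_integral_cmult)
    qed simp
  qed
  also have "\<dots> = (\<integral>\<^sup>+(r, t). ennreal (r * indicator {0<..} r) * f (ray r t) \<partial>(lborel \<Otimes>\<^sub>M lborel))"
    by (subst lborel.nn_integral_fst[symmetric]) (auto simp: case_prod_unfold)
  finally show ?thesis .
qed

text \<open>Stated as an identity of image measures, the change of variables transfers
  integrability, integrals and null sets alike.\<close>

lemma distr_ray:
  "distr (density (lborel \<Otimes>\<^sub>M lborel) (\<lambda>z. ennreal (fst z * indicator {0<..} (fst z)))) borel (\<lambda>z. ray (fst z) (snd z))
    = density lborel (\<lambda>x. ennreal (indicator {x. x \<bullet> e > 0} x))" (is "?L = ?R")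
proof (rule measure_eqI)
  show "sets ?L = sets ?R" by simp
  fix A assume "A \<in> sets ?L"
  then have [measurable]: "A \<in> sets borel" by simp
  have [measurable]: "{x. 0 < x \<bullet> e} \<in> sets borel"
    by (intro borel_open open_Collect_less continuous_intros)
  have "(\<lambda>z. ray (fst z) (snd z)) \<in> borel_measurable (borel \<Otimes>\<^sub>M borel)" by measurable
  then have [measurable]: "(\<lambda>z. ray (fst z) (snd z)) -` A \<in> sets (borel \<Otimes>\<^sub>M borel)"
    using measurable_sets[of "\<lambda>z. ray (fst z) (snd z)" "borel \<Otimes>\<^sub>M borel" borel A] by (simp add: space_pair_measure)
  have "emeasure ?L A = (\<integral>\<^sup>+(r, t). ennreal (r * indicator {0<..} r) * indicator A (ray r t) \<partial>(lborel \<Otimes>\<^sub>M lborel))"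
    by (subst emeasure_distr; (subst emeasure_density)?)
       (auto intro!: nn_integral_cong simp: case_prod_unfold indicator_def space_pair_measure)
  also have "\<dots> = (\<integral>\<^sup>+x. indicator {x. x \<bullet> e > 0} x * indicator A x \<partial>lborel)"
    by (rule nn_integral_ray[symmetric]) simp
  also have "\<dots> = emeasure ?R A"
    by (subst emeasure_density) (auto intro!: nn_integral_cong simp: indicator_def)
  finally show "emeasure ?L A = emeasure ?R A" .
qed

lemma integral_ray:
  fixes f :: "real^2 \<Rightarrow> real"
  assumes [measurable]: "f \<in> borel_measurable borel"
    and supp: "\<And>x. \<not> x \<bullet> e > 0 \<Longrightarrow> f x = 0"
  shows "integrable lborel f \<longleftrightarrow> integrable lborel (\<lambda>z. indicator {0<..} (fst z) * (fst z * f (ray (fst z) (snd z))))"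
    and "(LBINT x. f x) = (LBINT z. indicator {0<..} (fst z) * (fst z * f (ray (fst z) (snd z))))"
proof -
  have [measurable]: "{x. 0 < x \<bullet> e} \<in> sets borel"
    by (intro borel_open open_Collect_less continuous_intros)
  let ?d = "\<lambda>z :: real \<times> real. fst z * indicator {0<..} (fst z)"
  have eq: "indicator {x. x \<bullet> e > 0} x *\<^sub>R f x = f x" for x using supp by (auto simp: indicator_def)
  have eq2: "indicator {0<..} (fst z) * (fst z * f (ray (fst z) (snd z))) = ?d z *\<^sub>R f (ray (fst z) (snd z))" for z
    by simp
  let ?R = "density lborel (\<lambda>x. ennreal (indicator {x. x \<bullet> e > 0} x))"
  have R: "integrable ?R f \<longleftrightarrow> integrable lborel f"
    using integrable_density[of f lborel "indicator {x. x \<bullet> e > 0}"] by (simp add: eq del: real_scaleR_def)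
  have R': "integral\<^sup>L ?R f = integral\<^sup>L lborel f"
    using integral_density[of f lborel "indicator {x. x \<bullet> e > 0}"] by (simp add: eq del: real_scaleR_def)
  let ?D = "density (lborel \<Otimes>\<^sub>M lborel) (\<lambda>z. ennreal (?d z))"
  have D: "integrable ?D (\<lambda>z. f (ray (fst z) (snd z))) \<longleftrightarrow>
        integrable (lborel \<Otimes>\<^sub>M lborel) (\<lambda>z. ?d z *\<^sub>R f (ray (fst z) (snd z)))"
    by (rule integrable_density; (intro AE_I2)?; measurable?; simp add: indicator_def)
  have D': "integral\<^sup>L ?D (\<lambda>z. f (ray (fst z) (snd z))) =
        integral\<^sup>L (lborel \<Otimes>\<^sub>M lborel) (\<lambda>z. ?d z *\<^sub>R f (ray (fst z) (snd z)))"
    by (rule integral_density; (intro AE_I2)?; measurable?; simp add: indicator_def)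
  have E: "integrable ?R f \<longleftrightarrow> integrable ?D (\<lambda>z. f (ray (fst z) (snd z)))"
    unfolding distr_ray[symmetric] by (rule integrable_distr_eq) auto
  have E': "integral\<^sup>L ?R f = integral\<^sup>L ?D (\<lambda>z. f (ray (fst z) (snd z)))"
    unfolding distr_ray[symmetric] by (rule integral_distr) auto
  show "integrable lborel f \<longleftrightarrow> integrable lborel (\<lambda>z. indicator {0<..} (fst z) * (fst z * f (ray (fst z) (snd z))))"
    using R E D unfolding lborel_prod eq2 by blast
  show "(LBINT x. f x) = (LBINT z. indicator {0<..} (fst z) * (fst z * f (ray (fst z) (snd z))))"
    unfolding eq2 lborel_prod[symmetric, where ?'a=real and ?'b=real] R'[symmetric] E' D' ..
qed

lemma AE_ray:
  assumes "AE x in lborel. x \<bullet> e > 0 \<longrightarrow> P x"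
  shows "AE z in lborel. fst z > 0 \<longrightarrow> P (ray (fst z) (snd z))"
proof -
  have [measurable]: "{x. 0 < x \<bullet> e} \<in> sets borel"
    by (intro borel_open open_Collect_less continuous_intros)
  have "AE x in density lborel (\<lambda>x. ennreal (indicator {x. x \<bullet> e > 0} x)). P x"
    using assms by (subst AE_density) (auto simp: indicator_def)
  then have "AE z in density (lborel \<Otimes>\<^sub>M lborel) (\<lambda>z. ennreal (fst z * indicator {0<..} (fst z))). P (ray (fst z) (snd z))"
    unfolding distr_ray[symmetric] by (rule AE_distrD[rotated]) simp
  then have "AE z in lborel \<Otimes>\<^sub>M lborel. 0 < ennreal (fst z * indicator {0<..} (fst z)) \<longrightarrow> P (ray (fst z) (snd z))"
    by (subst (asm) AE_density) auto
  then have "AE z in lborel \<Otimes>\<^sub>M lborel. fst z > 0 \<longrightarrow> P (ray (fst z) (snd z))"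
    by eventually_elim (auto simp: indicator_def)
  then show ?thesis by (simp only: lborel_prod)
qed

text \<open>Opposite in direction to \<open>AE_ray\<close>: a null set of slopes sweeps out a null
  set of points. It finally carries the formula for the profile back to \<open>u\<close>.\<close>

lemma AE_slope:
  assumes "AE t in lborel. P t"
  shows "AE x in lborel. x \<bullet> e > 0 \<longrightarrow> P ((x \<bullet> n) / (x \<bullet> e))"
proof -
  have [measurable]: "{x. 0 < x \<bullet> e} \<in> sets borel"
    by (intro borel_open open_Collect_less continuous_intros)
  obtain N where N: "N \<in> null_sets lborel" "{t. \<not> P t} \<subseteq> N"
    using assms by (auto elim!: AE_E simp: null_sets_def)
  then have [measurable]: "N \<in> sets borel" by auto
  have "UNIV \<times> N \<in> null_sets (lborel \<Otimes>\<^sub>M lborel)"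
    using N(1) by (simp add: null_sets_def lborel.emeasure_pair_measure_Times)
  then have "AE z in lborel \<Otimes>\<^sub>M lborel. snd z \<notin> N"
    by (rule AE_not_in[THEN eventually_mono]) auto
  then have "AE z in density (lborel \<Otimes>\<^sub>M lborel) (\<lambda>z. ennreal (fst z * indicator {0<..} (fst z))).
      (ray (fst z) (snd z) \<bullet> n) / (ray (fst z) (snd z) \<bullet> e) \<notin> N"
    by (subst AE_density) (auto simp: inner_ray indicator_def)
  then have "AE x in density lborel (\<lambda>x. ennreal (indicator {x. x \<bullet> e > 0} x)). (x \<bullet> n) / (x \<bullet> e) \<notin> N"
    unfolding distr_ray[symmetric] by (subst AE_distr_iff) auto
  then have "AE x in lborel. x \<bullet> e > 0 \<longrightarrow> (x \<bullet> n) / (x \<bullet> e) \<notin> N"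
    by (subst (asm) AE_density) (auto simp: indicator_def)
  then show ?thesis by eventually_elim (use N(2) in auto)
qed

end

section \<open>Borel representatives and the coordinate sector\<close>

text \<open>The problem is posed for the completed measure, while Fubini and the change of variables
  act on Borel functions. The domain \<open>T\<close> is separate from \<open>S\<close> because the
  weak equations integrate over the ball and the test functions live in the sector.\<close>

lemma borel_representative:
  fixes w :: "'a::euclidean_space \<Rightarrow> real"
  assumes w: "integrable (lebesgue_on S) w" and S: "S \<in> sets borel"
  obtains w' where "w' \<in> borel_measurable borel" "integrable lborel w'" "\<And>x. x \<notin> S \<Longrightarrow> w' x = 0"
    "AE x in lborel. x \<in> S \<longrightarrow> w' x = w x"
    "\<And>g T. g \<in> borel_measurable borel \<Longrightarrow> (\<And>x. x \<notin> S \<Longrightarrow> g x = 0) \<Longrightarrow> S \<subseteq> T \<Longrightarrow> T \<in> sets borel \<Longrightarrow>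
       (\<integral>x. w x * g x \<partial>(lebesgue_on T)) = (LBINT x. w' x * g x)"
proof -
  have [measurable]: "S \<in> sets borel" "S \<in> sets lebesgue" using S by auto
  have iw: "integrable lebesgue (\<lambda>x. indicator S x * w x)"
    using w integrable_restrict_space[of S lebesgue w] by simp
  then have mw: "(\<lambda>x. indicator S x * w x) \<in> borel_measurable lebesgue" by auto
  then obtain w0 where w0 [measurable]: "w0 \<in> borel_measurable lborel" "AE x in lborel. indicator S x * w x = w0 x"
    using completion_ex_borel_measurable_real by blast
  define w' where "w' x = indicator S x * w0 x" for x
  have [measurable]: "w' \<in> borel_measurable borel" unfolding w'_def[abs_def] using w0(1) by simp
  have ae: "AE x in lborel. indicator S x * w x = w' x"
    using w0(2) by eventually_elim (auto simp: w'_def indicator_def split: if_splits)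
  have ae': "AE x in lebesgue. indicator S x * w x = w' x" using ae by (rule AE_completion)
  have m': "w' \<in> borel_measurable lebesgue" by (simp add: measurable_completion)
  show ?thesis
  proof (rule that[of w'])
    have "integrable lebesgue w'"
      using iw integrable_cong_AE[OF mw m' ae'] by simp
    then show "integrable lborel w'" by (simp add: integrable_completion)
    show "AE x in lborel. x \<in> S \<longrightarrow> w' x = w x"
      using ae by eventually_elim auto
    fix g :: "'a \<Rightarrow> real" and T assume g: "g \<in> borel_measurable borel" "\<And>x. x \<notin> S \<Longrightarrow> g x = 0" and T: "S \<subseteq> T" "T \<in> sets borel"
    have gl: "g \<in> borel_measurable lebesgue" using g(1) by (simp add: measurable_completion)
    have "(\<integral>x. w x * g x \<partial>(lebesgue_on T)) = (\<integral>x. indicator T x *\<^sub>R (w x * g x) \<partial>lebesgue)"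
      using T by (intro integral_restrict_space) auto
    also have "\<dots> = (\<integral>x. (indicator S x * w x) * g x \<partial>lebesgue)"
      using g(2) T(1) by (intro Bochner_Integration.integral_cong) (auto simp: indicator_def)
    also have "\<dots> = (\<integral>x. w' x * g x \<partial>lebesgue)"
      using ae' by (intro integral_cong_AE borel_measurable_times[OF mw gl] borel_measurable_times[OF m' gl]) auto
    also have "\<dots> = (LBINT x. w' x * g x)"
      using g(1) by (intro integral_completion) simp
    finally show "(\<integral>x. w x * g x \<partial>(lebesgue_on T)) = (LBINT x. w' x * g x)" .
  qed (auto simp: w'_def)
qed

text \<open>Slopes beyond 1 make neighbouring cones overlap; the result is proved for slopes below
  2, and the margin up to 3 is where cutoffs in \<open>t\<close> are placed. The height
  \<open>1/4\<close> keeps the rays inside the unit ball.\<close>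

abbreviation coord_rect :: "(real \<times> real) set" where
  "coord_rect \<equiv> {0<..<1/4} \<times> {-3<..<3}"

context coordinate_frame
begin

definition sector :: "(real^2) set" where
  "sector = {x. 0 < x \<bullet> e \<and> x \<bullet> e < 1/4 \<and> \<bar>x \<bullet> n\<bar> < 3 * (x \<bullet> e)}"

text \<open>The closure of the sector, apex included. Its compactness gives integrability on the
  sector from local integrability in the ball, and compact supports for the test functions.\<close>

definition wedge :: "(real^2) set" where
  "wedge = {x. 0 \<le> x \<bullet> e \<and> x \<bullet> e \<le> 1/4 \<and> \<bar>x \<bullet> n\<bar> \<le> 3 * (x \<bullet> e)}"

lemma open_sector: "open sector"
proof -
  have "sector = {x. 0 < x \<bullet> e} \<inter> {x. x \<bullet> e < 1/4} \<inter> {x. \<bar>x \<bullet> n\<bar> < 3 * (x \<bullet> e)}"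
    by (auto simp: sector_def)
  then show ?thesis by (auto intro!: open_Int open_Collect_less continuous_intros)
qed

lemma sector_subset_wedge: "sector \<subseteq> wedge"
  by (auto simp: sector_def wedge_def)

text \<open>\<open>7/2\<close> is a rational bound for \<open>sqrt (1 + 3\<^sup>2)\<close> that is
  still below 4, so height \<open>1/4\<close> stays strictly inside the ball.\<close>

lemma norm_le_if_in_wedge: "x \<in> wedge \<Longrightarrow> norm x \<le> 7/2 * (x \<bullet> e)"
proof -
  assume x: "x \<in> wedge"
  have "(norm x)\<^sup>2 = (x \<bullet> e)\<^sup>2 + (x \<bullet> n)\<^sup>2"
    using norm_frame_sum[of "x \<bullet> e" "x \<bullet> n"] frame_expansion[of x] by simp
  moreover have "(x \<bullet> n)\<^sup>2 \<le> (3 * (x \<bullet> e))\<^sup>2"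
    using x by (intro abs_le_square_iff[THEN iffD1]) (auto simp: wedge_def)
  ultimately have "(norm x)\<^sup>2 \<le> (7/2 * (x \<bullet> e))\<^sup>2"
  proof -
    assume "(norm x)\<^sup>2 = (x \<bullet> e)\<^sup>2 + (x \<bullet> n)\<^sup>2" "(x \<bullet> n)\<^sup>2 \<le> (3 * (x \<bullet> e))\<^sup>2"
    moreover have "(3 * (x \<bullet> e))\<^sup>2 = 9 * (x \<bullet> e)\<^sup>2" "(7/2 * (x \<bullet> e))\<^sup>2 = 49/4 * (x \<bullet> e)\<^sup>2"
      by (simp_all add: power_mult_distrib power_divide)
    ultimately show "(norm x)\<^sup>2 \<le> (7/2 * (x \<bullet> e))\<^sup>2" using zero_le_power2[of "x \<bullet> e"] by linarith
  qed
  then show ?thesis using x by (auto simp: wedge_def intro: power2_le_imp_le)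
qed

lemma wedge_eq: "wedge = {x. 0 \<le> x \<bullet> e} \<inter> {x. x \<bullet> e \<le> 1/4} \<inter> {x. \<bar>x \<bullet> n\<bar> \<le> 3 * (x \<bullet> e)}"
  by (auto simp: wedge_def)

lemma closed_wedge: "closed wedge"
  unfolding wedge_eq by (intro closed_Int closed_Collect_le continuous_intros)

lemma compact_wedge: "compact wedge"
proof -
  have "bounded wedge"
    unfolding bounded_iff using norm_le_if_in_wedge by (intro exI[of _ 1]) (force simp: wedge_def)
  then show ?thesis using closed_wedge by (simp add: compact_eq_bounded_closed)
qed

lemma sector_ray: "ray r t \<in> sector \<longleftrightarrow> r > 0 \<and> (r, t) \<in> coord_rect"
proof -
  have "\<bar>r * t\<bar> < 3 * r \<longleftrightarrow> \<bar>t\<bar> < 3" if "r > 0"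
    using that by (simp add: abs_mult)
  then show ?thesis by (auto simp: sector_def inner_ray)
qed

lemma sector_subset_ball: "sector \<subseteq> ball 0 1"
proof
  fix x assume x: "x \<in> sector"
  then show "x \<in> ball 0 1"
    using norm_le_if_in_wedge[of x] sector_subset_wedge by (auto simp: sector_def)
qed

lemma AE_coord_rect_if_AE_sector:
  assumes "AE x\<in>sector in lborel. P x"
  shows "AE z\<in>coord_rect in lborel. P (ray (fst z) (snd z))"
proof -
  have "AE x in lborel. x \<bullet> e > 0 \<longrightarrow> (x \<in> sector \<longrightarrow> P x)" using assms by eventually_elim auto
  from AE_ray[OF this] show ?thesis by eventually_elim (auto simp: sector_ray)
qed

text \<open>The factor \<open>fst z\<close> is the Jacobian. The lemma is applied to the components
  of \<open>u\<close> and \<open>Du\<close> and to the tested stress, each of which is known only up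
  to null sets.\<close>

lemma coord_representative:
  fixes w :: "real^2 \<Rightarrow> real"
  assumes w: "integrable (lebesgue_on sector) w"
  obtains W where "W \<in> borel_measurable borel"
    "set_integrable lborel coord_rect (\<lambda>z. fst z * W z)"
    "AE z\<in>coord_rect in lborel. w (ray (fst z) (snd z)) = W z"
    "\<And>g. g \<in> borel_measurable borel \<Longrightarrow> (\<And>x. x \<notin> sector \<Longrightarrow> g x = 0) \<Longrightarrow>
       (\<integral>x. w x * g x \<partial>(lebesgue_on (ball 0 1))) = (LBINT z:coord_rect. fst z * W z * g (ray (fst z) (snd z)))"
proof -
  obtain w' where w': "w' \<in> borel_measurable borel" "integrable lborel w'" "\<And>x. x \<notin> sector \<Longrightarrow> w' x = 0"
    "AE x\<in>sector in lborel. w' x = w x"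
    "\<And>g T. g \<in> borel_measurable borel \<Longrightarrow> (\<And>x. x \<notin> sector \<Longrightarrow> g x = 0) \<Longrightarrow> sector \<subseteq> T \<Longrightarrow> T \<in> sets borel \<Longrightarrow>
       (\<integral>x. w x * g x \<partial>(lebesgue_on T)) = (LBINT x. w' x * g x)"
    apply (rule borel_representative[OF w borel_open[OF open_sector]])
    subgoal premises prems by (rule prems(1); fact prems)
    done
  have [measurable]: "w' \<in> borel_measurable borel" by fact
  define W where "W z = w' (ray (fst z) (snd z))" for z
  have [measurable]: "(\<lambda>z::real\<times>real. ray (fst z) (snd z)) \<in> borel_measurable borel"
    by (intro borel_measurable_continuous_onI continuous_intros)
  have ind: "indicator {0<..} (fst z) * (fst z * (w' (ray (fst z) (snd z)) * g)) = indicator coord_rect z * (fst z * W z * g)" for z and g :: real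
    using w'(3)[of "ray (fst z) (snd z)"] by (cases z) (auto simp: W_def sector_ray indicator_def)
  show ?thesis
  proof (rule that[of W])
    show "W \<in> borel_measurable borel" unfolding W_def[abs_def] by measurable
    have "integrable lborel (\<lambda>z. indicator {0<..} (fst z) * (fst z * w' (ray (fst z) (snd z))))"
      using w'(2) integral_ray(1)[of w'] w'(3) by (auto simp: sector_def)
    then show "set_integrable lborel coord_rect (\<lambda>z. fst z * W z)"
      using ind[where g = 1] unfolding mult_1_right set_integrable_def real_scaleR_def by (simp only:)
    show "AE z\<in>coord_rect in lborel. w (ray (fst z) (snd z)) = W z"
      using AE_coord_rect_if_AE_sector[OF w'(4)] by eventually_elim (auto simp: W_def)
    fix g :: "real^2 \<Rightarrow> real" assume g [measurable]: "g \<in> borel_measurable borel" "\<And>x. x \<notin> sector \<Longrightarrow> g x = 0"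
    have "(\<integral>x. w x * g x \<partial>(lebesgue_on (ball 0 1))) = (LBINT x. w' x * g x)"
      by (rule w'(5)[OF g sector_subset_ball]) auto
    also have "\<dots> = (LBINT z. indicator {0<..} (fst z) * (fst z * (w' (ray (fst z) (snd z)) * g (ray (fst z) (snd z)))))"
      by (rule integral_ray(2)) (use w'(3) in \<open>auto simp: sector_def\<close>)
    also have "\<dots> = (LBINT z:coord_rect. fst z * W z * g (ray (fst z) (snd z)))"
      unfolding ind by (simp add: set_lebesgue_integral_def)
    finally show "(\<integral>x. w x * g x \<partial>(lebesgue_on (ball 0 1))) = (LBINT z:coord_rect. fst z * W z * g (ray (fst z) (snd z)))" .
  qed
qed

section \<open>Separated test functions on the cone\<close>

definition cone_test :: "(real \<Rightarrow> real) \<Rightarrow> (real \<Rightarrow> real) \<Rightarrow> real^2 \<Rightarrow> real" where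
  "cone_test \<alpha> \<beta> x = \<alpha> (x \<bullet> e) * \<beta> ((x \<bullet> n) / (x \<bullet> e))"

text \<open>The \<open>e\<close>-component of the gradient of \<open>cone_test\<close>, as
  \<open>cone_test_n\<close> is its \<open>n\<close>-component; the terms with \<beta>' come from
  the gradient \<open>(n - t e) / r\<close> of the slope.\<close>

definition cone_test_e :: "(real \<Rightarrow> real) \<Rightarrow> (real \<Rightarrow> real) \<Rightarrow> (real \<Rightarrow> real) \<Rightarrow> (real \<Rightarrow> real) \<Rightarrow> real^2 \<Rightarrow> real" where
  "cone_test_e \<alpha> \<alpha>' \<beta> \<beta>' x = \<alpha>' (x \<bullet> e) * \<beta> ((x \<bullet> n) / (x \<bullet> e))
     - \<alpha> (x \<bullet> e) * \<beta>' ((x \<bullet> n) / (x \<bullet> e)) * ((x \<bullet> n) / (x \<bullet> e)) / (x \<bullet> e)"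

definition cone_test_n :: "(real \<Rightarrow> real) \<Rightarrow> (real \<Rightarrow> real) \<Rightarrow> real^2 \<Rightarrow> real" where
  "cone_test_n \<alpha> \<beta>' x = \<alpha> (x \<bullet> e) * \<beta>' ((x \<bullet> n) / (x \<bullet> e)) / (x \<bullet> e)"

lemma cone_test_ray:
  assumes "r > 0"
  shows "cone_test \<alpha> \<beta> (ray r t) = \<alpha> r * \<beta> t"
    "cone_test_e \<alpha> \<alpha>' \<beta> \<beta>' (ray r t) = \<alpha>' r * \<beta> t - \<alpha> r * \<beta>' t * t / r"
    "cone_test_n \<alpha> \<beta>' (ray r t) = \<alpha> r * \<beta>' t / r"
  using assms by (simp_all add: cone_test_def cone_test_e_def cone_test_n_def inner_ray)

context
  fixes \<alpha> \<alpha>' \<beta> \<beta>'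
  assumes \<alpha>: "test_fun 0 (1/4) \<alpha> \<alpha>'" and \<beta>: "test_fun (-3) 3 \<beta> \<beta>'"
begin

lemma cone_test_outside_sector:
  assumes "x \<notin> sector"
  shows "cone_test \<alpha> \<beta> x = 0" "cone_test_e \<alpha> \<alpha>' \<beta> \<beta>' x = 0" "cone_test_n \<alpha> \<beta>' x = 0"
proof -
  have "(\<alpha> (x \<bullet> e) = 0 \<and> \<alpha>' (x \<bullet> e) = 0) \<or> (\<beta> ((x \<bullet> n) / (x \<bullet> e)) = 0 \<and> \<beta>' ((x \<bullet> n) / (x \<bullet> e)) = 0)"
  proof (cases "x \<bullet> e \<in> {0<..<1/4}")
    case True
    then have "\<not> \<bar>x \<bullet> n\<bar> < 3 * (x \<bullet> e)" using assms by (auto simp: sector_def)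
    then have "(x \<bullet> n) / (x \<bullet> e) \<notin> {-3<..<3}" using True by (auto simp: field_simps)
    then show ?thesis using test_funD(4,5)[OF \<beta>] by simp
  qed (use test_funD(4,5)[OF \<alpha>] in simp)
  then show "cone_test \<alpha> \<beta> x = 0" "cone_test_e \<alpha> \<alpha>' \<beta> \<beta>' x = 0" "cone_test_n \<alpha> \<beta>' x = 0"
    by (auto simp: cone_test_def cone_test_e_def cone_test_n_def)
qed

text \<open>The half-plane on which everything vanishes contains the line
  \<open>x \<bullet> e = 0\<close>, so the value of the quotients there, where the divisor is zero,
  does not matter.\<close>

lemma vanishing_near_vertex:
  obtains c where "c > 0" "\<And>x. x \<bullet> e < c \<Longrightarrow> cone_test \<alpha> \<beta> x = 0 \<and> cone_test_e \<alpha> \<alpha>' \<beta> \<beta>' x = 0 \<and> cone_test_n \<alpha> \<beta>' x = 0"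
proof -
  obtain c d where "0 < c" "\<And>x. x \<notin> {c..d} \<Longrightarrow> \<alpha> x = 0" "\<And>x. x \<notin> {c..d} \<Longrightarrow> \<alpha>' x = 0"
    using \<alpha> by (rule test_fun_supportE) blast
  then show ?thesis
    by (intro that[of c]) (auto simp: cone_test_def cone_test_e_def cone_test_n_def)
qed

lemma has_derivative_cone_test:
  "(cone_test \<alpha> \<beta> has_derivative (\<lambda>h. cone_test_e \<alpha> \<alpha>' \<beta> \<beta>' x * (h \<bullet> e) + cone_test_n \<alpha> \<beta>' x * (h \<bullet> n))) (at x)"
proof -
  obtain c where c: "c > 0" "\<And>x. x \<bullet> e < c \<Longrightarrow> cone_test \<alpha> \<beta> x = 0 \<and> cone_test_e \<alpha> \<alpha>' \<beta> \<beta>' x = 0 \<and> cone_test_n \<alpha> \<beta>' x = 0"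
    by (rule vanishing_near_vertex) blast
  show ?thesis
  proof (cases "x \<bullet> e < c")
    case True
    have o: "open {x. x \<bullet> e < c}" by (intro open_Collect_less continuous_intros)
    have d: "((\<lambda>x. 0::real) has_derivative (\<lambda>h. cone_test_e \<alpha> \<alpha>' \<beta> \<beta>' x * (h \<bullet> e) + cone_test_n \<alpha> \<beta>' x * (h \<bullet> n))) (at x)"
      using c(2)[OF True] by simp
    show ?thesis
      by (rule has_derivative_transform_within_open[OF d o]) (use True c(2) in auto)
  next
    case False
    then have ne: "x \<bullet> e \<noteq> 0" using c(1) by auto
    have 1: "((\<lambda>x. \<alpha> (x \<bullet> e)) has_derivative (\<lambda>h. \<alpha>' (x \<bullet> e) * (h \<bullet> e))) (at x)"
      using test_funD(1)[OF \<alpha>, of "x \<bullet> e"]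
      by (auto intro!: derivative_eq_intros has_derivative_compose[of "\<lambda>x. x \<bullet> e" "\<lambda>h. h \<bullet> e" x UNIV \<alpha>] simp: has_field_derivative_def)
    have 2: "((\<lambda>x. (x \<bullet> n) / (x \<bullet> e)) has_derivative (\<lambda>h. (h \<bullet> n) / (x \<bullet> e) - (x \<bullet> n) / (x \<bullet> e) * (h \<bullet> e) / (x \<bullet> e))) (at x)"
      using ne by (auto intro!: derivative_eq_intros simp: field_simps)
    have 3: "((\<lambda>x. \<beta> ((x \<bullet> n) / (x \<bullet> e))) has_derivative (\<lambda>h. \<beta>' ((x \<bullet> n) / (x \<bullet> e)) * ((h \<bullet> n) / (x \<bullet> e) - (x \<bullet> n) / (x \<bullet> e) * (h \<bullet> e) / (x \<bullet> e)))) (at x)"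
      using has_derivative_compose[OF 2, of \<beta>] test_funD(1)[OF \<beta>] by (auto simp: has_field_derivative_def)
    show ?thesis
      unfolding cone_test_def[abs_def]
      by (rule has_derivative_eq_rhs[OF has_derivative_mult[OF 1 3]])
         (auto simp: cone_test_e_def cone_test_n_def algebra_simps)
  qed
qed

lemma continuous_cone_test_deriv:
  "continuous_on UNIV (cone_test_e \<alpha> \<alpha>' \<beta> \<beta>')" "continuous_on UNIV (cone_test_n \<alpha> \<beta>')"
proof -
  obtain c where c: "c > 0" "\<And>x. x \<bullet> e < c \<Longrightarrow> cone_test \<alpha> \<beta> x = 0 \<and> cone_test_e \<alpha> \<alpha>' \<beta> \<beta>' x = 0 \<and> cone_test_n \<alpha> \<beta>' x = 0"
    by (rule vanishing_near_vertex) blast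
  \<comment> \<open>Two overlapping open half-planes: on one the functions vanish, on the other the
    divisor is positive and the formulas are continuous.\<close>
  have U: "{x::real^2. x \<bullet> e < c} \<union> {x. x \<bullet> e > 0} = UNIV" using c(1) by (auto simp: linorder_not_less intro: less_le_trans)
  have op: "open {x. x \<bullet> e < c}" "open {x. x \<bullet> e > 0}" by (intro open_Collect_less continuous_intros)+
  have z: "continuous_on {x. x \<bullet> e < c} (cone_test_e \<alpha> \<alpha>' \<beta> \<beta>')" "continuous_on {x. x \<bullet> e < c} (cone_test_n \<alpha> \<beta>')"
    by (rule continuous_on_eq[of _ "\<lambda>_. 0"], auto simp: c(2))+
  note [continuous_intros] = continuous_on_compose2[OF test_funD(3)[OF \<alpha>, of UNIV]] continuous_on_compose2[OF test_funD(2)[OF \<alpha>, of UNIV]]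
     continuous_on_compose2[OF test_funD(3)[OF \<beta>, of UNIV]] continuous_on_compose2[OF test_funD(2)[OF \<beta>, of UNIV]]
  have p: "continuous_on {x. x \<bullet> e > 0} (cone_test_e \<alpha> \<alpha>' \<beta> \<beta>')" "continuous_on {x. x \<bullet> e > 0} (cone_test_n \<alpha> \<beta>')"
    unfolding cone_test_e_def[abs_def] cone_test_n_def[abs_def]
    by (intro continuous_intros; auto)+
  show "continuous_on UNIV (cone_test_e \<alpha> \<alpha>' \<beta> \<beta>')" "continuous_on UNIV (cone_test_n \<alpha> \<beta>')"
    using continuous_on_open_Un[OF op] z p U by metis+
qed

lemma has_derivative_cone_test_scaleR:
  fixes v :: "'b::real_normed_vector"
  shows "((\<lambda>x. cone_test \<alpha> \<beta> x *\<^sub>R v) has_derivative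
    (\<lambda>h. (cone_test_e \<alpha> \<alpha>' \<beta> \<beta>' x * (h \<bullet> e) + cone_test_n \<alpha> \<beta>' x * (h \<bullet> n)) *\<^sub>R v)) (at x)"
  by (rule has_derivative_scaleR_left[OF has_derivative_cone_test])

lemma cone_test_in_C1c:
  fixes v :: "'b::real_normed_vector"
  shows "(\<lambda>x. cone_test \<alpha> \<beta> x *\<^sub>R v) \<in> C1c (ball 0 1)"
proof -
  let ?Be = "Blinfun (\<lambda>h::real^2. (h \<bullet> e) *\<^sub>R v)" and ?Bn = "Blinfun (\<lambda>h::real^2. (h \<bullet> n) *\<^sub>R v)"
  have bl: "bounded_linear (\<lambda>h::real^2. (h \<bullet> a) *\<^sub>R v)" for a
    by (intro bounded_linear_scaleR_const bounded_linear_inner_left)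
  define D where "D x = cone_test_e \<alpha> \<alpha>' \<beta> \<beta>' x *\<^sub>R ?Be + cone_test_n \<alpha> \<beta>' x *\<^sub>R ?Bn" for x
  have "blinfun_apply (D x) = (\<lambda>h. (cone_test_e \<alpha> \<alpha>' \<beta> \<beta>' x * (h \<bullet> e) + cone_test_n \<alpha> \<beta>' x * (h \<bullet> n)) *\<^sub>R v)" for x
    by (rule ext) (simp add: D_def blinfun.bilinear_simps bounded_linear_Blinfun_apply[OF bl] scaleR_left_distrib)
  moreover have "continuous_on UNIV D" unfolding D_def by (intro continuous_intros continuous_cone_test_deriv)
  ultimately have C1: "C1_on UNIV (\<lambda>x. cone_test \<alpha> \<beta> x *\<^sub>R v)"
    unfolding C1_on_def using has_derivative_cone_test_scaleR[of v] by (intro exI[of _ D]) simp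
  obtain a b where ab: "0 < a" "b < 1/4" "\<And>x. x \<notin> {a..b} \<Longrightarrow> \<alpha> x = 0"
    using \<alpha> by (rule test_fun_supportE) blast
  have "{x. cone_test \<alpha> \<beta> x *\<^sub>R v \<noteq> 0} \<subseteq> wedge \<inter> {x. x \<bullet> e \<le> b}"
  proof
    fix x assume x: "x \<in> {x. cone_test \<alpha> \<beta> x *\<^sub>R v \<noteq> 0}"
    then have "x \<in> sector" using cone_test_outside_sector(1)[of x] by auto
    moreover have "\<alpha> (x \<bullet> e) \<noteq> 0" using x by (auto simp: cone_test_def)
    ultimately show "x \<in> wedge \<inter> {x. x \<bullet> e \<le> b}" using ab(3) sector_subset_wedge by force
  qed
  moreover have cl: "closed (wedge \<inter> {x. x \<bullet> e \<le> b})"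
    by (intro closed_Int closed_wedge closed_Collect_le continuous_intros)
  ultimately have sub: "closure {x. cone_test \<alpha> \<beta> x *\<^sub>R v \<noteq> 0} \<subseteq> wedge \<inter> {x. x \<bullet> e \<le> b}"
    by (rule closure_minimal)
  moreover have "wedge \<inter> {x. x \<bullet> e \<le> b} \<subseteq> ball 0 1"
    using norm_le_if_in_wedge ab(2) by fastforce
  moreover have "compact (closure {x. cone_test \<alpha> \<beta> x *\<^sub>R v \<noteq> 0})"
  proof -
    have "closure {x. cone_test \<alpha> \<beta> x *\<^sub>R v \<noteq> 0} = wedge \<inter> closure {x. cone_test \<alpha> \<beta> x *\<^sub>R v \<noteq> 0}"
      using sub by blast
    also have "compact \<dots>" by (rule compact_Int_closed[OF compact_wedge closed_closure])
    finally show ?thesis .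
  qed
  ultimately show ?thesis using C1 unfolding C1c_def by blast
qed

lemma frechet_derivative_cone_test:
  "frechet_derivative (cone_test \<alpha> \<beta>) (at x) h = cone_test_e \<alpha> \<alpha>' \<beta> \<beta>' x * (h \<bullet> e) + cone_test_n \<alpha> \<beta>' x * (h \<bullet> n)"
  using frechet_derivative_at[OF has_derivative_cone_test, of x] by metis

lemma inner_jacobian_cone_test:
  fixes M :: "real^2^'m" and v :: "real^'m"
  shows "M \<bullet> jacobian (\<lambda>x. cone_test \<alpha> \<beta> x *\<^sub>R v) (at x) =
    cone_test_e \<alpha> \<alpha>' \<beta> \<beta>' x * (v \<bullet> (M *v e)) + cone_test_n \<alpha> \<beta>' x * (v \<bullet> (M *v n))"
proof -
  let ?d = "\<lambda>h. (cone_test_e \<alpha> \<alpha>' \<beta> \<beta>' x * (h \<bullet> e) + cone_test_n \<alpha> \<beta>' x * (h \<bullet> n)) *\<^sub>R v"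
  have "jacobian (\<lambda>x. cone_test \<alpha> \<beta> x *\<^sub>R v) (at x) = matrix ?d"
    unfolding jacobian_def frechet_derivative_at[OF has_derivative_cone_test_scaleR, symmetric] ..
  moreover have "matrix ?d $ p $ q = v $ p * (cone_test_e \<alpha> \<alpha>' \<beta> \<beta>' x * e $ q + cone_test_n \<alpha> \<beta>' x * n $ q)" for p q
    by (simp add: matrix_def inner_axis' mult.commute)
  ultimately show ?thesis
    by (simp add: inner_vec_def matrix_vector_mult_def sum_distrib_left sum.distrib algebra_simps)
qed

end

end

section \<open>Regularity and monotonicity of the stress\<close>

definition outer :: "real^'m \<Rightarrow> real^'n \<Rightarrow> real^'n^'m" where
  "outer a b = (\<chi> p q. a $ p * b $ q)"

lemma outer_mult_vec: "outer a b *v c = (b \<bullet> c) *\<^sub>R a"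
  by (simp add: outer_def vec_eq_iff matrix_vector_mult_def inner_vec_def sum_distrib_left sum_distrib_right mult_ac)

lemma bounded_bilinear_outer: "bounded_bilinear (outer :: real^'m \<Rightarrow> real^'n \<Rightarrow> real^'n^'m)"
proof -
  have "bilinear (outer :: real^'m \<Rightarrow> real^'n \<Rightarrow> real^'n^'m)"
    by (auto simp: bilinear_def linear_iff outer_def vec_eq_iff algebra_simps)
  then show ?thesis by (simp add: bilinear_conv_bounded_bilinear)
qed

lemmas continuous_on_outer [continuous_intros] = bounded_bilinear.continuous_on[OF bounded_bilinear_outer]

lemma outer_expansion:
  "outer a b = (\<Sum>r\<in>UNIV. \<Sum>s\<in>UNIV. (a $ r * b $ s) *\<^sub>R axis r (axis s 1))"
proof -
  have "(\<Sum>r\<in>UNIV. \<Sum>s\<in>UNIV. (a $ r * b $ s) *\<^sub>R axis r (axis s 1)) $ p $ q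
      = (\<Sum>r\<in>UNIV. if r = p then (\<Sum>s\<in>UNIV. if s = q then a $ r * b $ s else 0) else 0)" for p q
    unfolding sum_component by (intro sum.cong refl) (auto simp: axis_def if_distrib[where f = "\<lambda>x. _ * x"] cong: if_cong)
  then show ?thesis by (simp add: outer_def vec_eq_iff)
qed

lemma bounded_bilinear_matrix_vector: "bounded_bilinear ((*v) :: real^'n^'m \<Rightarrow> real^'n \<Rightarrow> real^'m)"
proof -
  have "bilinear ((*v) :: real^'n^'m \<Rightarrow> real^'n \<Rightarrow> real^'m)"
    by (auto simp: bilinear_def linear_iff matrix_vector_mult_def vec_eq_iff algebra_simps sum.distrib sum_distrib_left)
  then show ?thesis by (simp add: bilinear_conv_bounded_bilinear)
qed

lemmas continuous_on_matrix_vector [continuous_intros] = bounded_bilinear.continuous_on[OF bounded_bilinear_matrix_vector]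

section \<open>Increments of the coefficients in both arguments\<close>

locale regular_elliptic =
  fixes A :: "real^2 \<Rightarrow> real^2^'m \<Rightarrow> real^2^'m"
  assumes C1_in_F: "\<And>x. x \<in> ball 0 1 \<Longrightarrow> C1_on UNIV (A x)"
    and elliptic: "uniformly_elliptic_on (ball 0 1) A"
    and partial_exists: "\<And>i x F. x \<in> ball 0 1 - {0} \<Longrightarrow> has_partial_at i (\<lambda>y. A y F) x"
    and partial_continuous:
      "\<And>i. continuous_on ((ball 0 1 - {0}) \<times> UNIV) (\<lambda>(x, F). norm x *\<^sub>R partial i (\<lambda>y. A y F) x)"
begin

lemma has_derivative_in_F:
  "x \<in> ball 0 1 \<Longrightarrow> (A x has_derivative frechet_derivative (A x) (at F)) (at F)"
  using C1_in_F[of x] unfolding C1_on_def by (metis UNIV_I frechet_derivative_at)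

text \<open>Along the segment \<open>F + s *\<^sub>R outer a b\<close> the derivative of the tested
  stress is the ellipticity form at \<open>(a, b)\<close>, so the mean value theorem passes the
  bound on to finite increments. No smallness of \<open>a\<close> is involved, but the increment has
  to be of rank one.\<close>

lemma strong_monotonicity:
  obtains \<nu> where "\<nu> > 0" "\<And>x F a b. x \<in> ball 0 1 \<Longrightarrow>
    \<nu> * (norm a)\<^sup>2 * (norm b)\<^sup>2 \<le> ((A x (F + outer a b) - A x F) *v b) \<bullet> a"
proof -
  obtain \<nu> where \<nu>: "\<nu> > 0" "\<And>x F (a::real^'m) (b::real^2). x \<in> ball 0 1 \<Longrightarrow>
      (\<Sum>p\<in>UNIV. \<Sum>q\<in>UNIV. \<Sum>r\<in>UNIV. \<Sum>s\<in>UNIV. matrix_partial (A x) F p q r s * a $ p * b $ q * a $ r * b $ s)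
        \<ge> \<nu> * (norm a)\<^sup>2 * (norm b)\<^sup>2"
    using elliptic unfolding uniformly_elliptic_on_def by blast
  have "\<nu> * (norm a)\<^sup>2 * (norm b)\<^sup>2 \<le> ((A x (F + outer a b) - A x F) *v b) \<bullet> a" if x: "x \<in> ball 0 1" for x F a b
  proof -
    let ?D = "\<lambda>F. frechet_derivative (A x) (at F)"
    define \<phi> where "\<phi> s = (A x (F + s *\<^sub>R outer a b) *v b) \<bullet> a" for s
    have D: "(\<phi> has_real_derivative (?D (F + s *\<^sub>R outer a b) (outer a b) *v b) \<bullet> a) (at s)" for s
    proof -
      have "((\<lambda>s. F + s *\<^sub>R outer a b) has_derivative (\<lambda>h. h *\<^sub>R outer a b)) (at s)"
        by (auto intro!: derivative_eq_intros)
      from has_derivative_compose[OF this has_derivative_in_F[OF x]]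
      have "((\<lambda>s. A x (F + s *\<^sub>R outer a b)) has_derivative (\<lambda>h. ?D (F + s *\<^sub>R outer a b) (h *\<^sub>R outer a b))) (at s)" .
      then have "(\<phi> has_derivative (\<lambda>h. (?D (F + s *\<^sub>R outer a b) (h *\<^sub>R outer a b) *v b) \<bullet> a)) (at s)"
        unfolding \<phi>_def[abs_def]
        by (intro has_derivative_inner_left bounded_linear.has_derivative[OF bounded_bilinear.bounded_linear_left[OF bounded_bilinear_matrix_vector]])
      moreover have "linear (?D (F + s *\<^sub>R outer a b))"
        using has_derivative_in_F[OF x] has_derivative_linear by blast
      ultimately show ?thesis
        by (auto simp: has_field_derivative_def linear_cmul scaleR_matrix_vector_assoc[symmetric] mult.commute
            elim!: has_derivative_eq_rhs)
    qed
    have pos: "(?D G (outer a b) *v b) \<bullet> a \<ge> \<nu> * (norm a)\<^sup>2 * (norm b)\<^sup>2" for G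
    proof -
      have lin: "linear (?D G)" using has_derivative_in_F[OF x] has_derivative_linear by blast
      have "(?D G (outer a b)) $ p $ q = (\<Sum>r\<in>UNIV. \<Sum>s\<in>UNIV. a $ r * b $ s * matrix_partial (A x) G p q r s)" for p q
        by (simp add: outer_expansion linear_sum[OF lin] linear_cmul[OF lin] matrix_partial_def)
      then have "(?D G (outer a b) *v b) \<bullet> a = (\<Sum>p\<in>UNIV. \<Sum>q\<in>UNIV. \<Sum>r\<in>UNIV. \<Sum>s\<in>UNIV. matrix_partial (A x) G p q r s * a $ p * b $ q * a $ r * b $ s)"
        by (simp add: inner_vec_def matrix_vector_mult_def sum_distrib_left sum_distrib_right mult_ac)
      then show ?thesis using \<nu>(2)[OF x, where F = G] by simp
    qed
    obtain s where "\<phi> 1 - \<phi> 0 = (1 - 0) * ((?D (F + s *\<^sub>R outer a b) (outer a b) *v b) \<bullet> a)"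
      using MVT2[of 0 1 \<phi>, OF _ D] by auto
    then have "\<phi> 1 - \<phi> 0 \<ge> \<nu> * (norm a)\<^sup>2 * (norm b)\<^sup>2" using pos by simp
    then show ?thesis by (simp add: \<phi>_def matrix_vector_mult_diff_rdistrib inner_diff_left)
  qed
  with \<nu>(1) show ?thesis by (rule that)
qed

text \<open>The candidate for the total derivative in \<open>x\<close>, assembled from the partial
  derivatives; \<open>has_derivative_in_x\<close> confirms it away from the origin.\<close>

definition dA :: "real^2 \<Rightarrow> real^2^'m \<Rightarrow> real^2 \<Rightarrow> real^2^'m" where
  "dA x F h = (\<Sum>i\<in>UNIV. h $ i *\<^sub>R partial i (\<lambda>y. A y F) x)"

lemma continuous_partial:
  "continuous_on ((ball 0 1 - {0}) \<times> UNIV) (\<lambda>(x, F). partial i (\<lambda>y. A y F) x)"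
proof -
  have "continuous_on ((ball 0 1 - {0}) \<times> UNIV) (\<lambda>z. inverse (norm (fst z)) *\<^sub>R (case z of (x, F) \<Rightarrow> norm x *\<^sub>R partial i (\<lambda>y. A y F) x))"
    by (intro continuous_intros partial_continuous) auto
  then show ?thesis
  proof (rule continuous_on_eq)
    fix z :: "(real^2) \<times> (real^2^'m)" assume "z \<in> (ball 0 1 - {0}) \<times> UNIV"
    then have "norm (fst z) \<noteq> 0" by auto
    then show "inverse (norm (fst z)) *\<^sub>R (case z of (x, F) \<Rightarrow> norm x *\<^sub>R partial i (\<lambda>y. A y F) x) = (case z of (x, F) \<Rightarrow> partial i (\<lambda>y. A y F) x)"
      by (simp add: case_prod_unfold)
  qed
qed

lemma continuous_dA:
  assumes "continuous_on S x" "continuous_on S F" "continuous_on S h" "\<And>s. s \<in> S \<Longrightarrow> x s \<in> ball 0 1 - {0}"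
  shows "continuous_on S (\<lambda>s. dA (x s) (F s) (h s))"
proof -
  have "(\<lambda>s. (x s, F s)) ` S \<subseteq> (ball 0 1 - {0}) \<times> UNIV" using assms(4) by auto
  from continuous_on_compose2[OF continuous_partial continuous_on_Pair[OF assms(1,2)] this]
  have "continuous_on S (\<lambda>s. partial i (\<lambda>y. A y (F s)) (x s))" for i by simp
  then show ?thesis unfolding dA_def using assms(3) by (intro continuous_intros)
qed

text \<open>The mean value inequality, applied after subtracting the expected linear part
  \<open>t *\<^sub>R c\<close>, so that only the oscillation of the partial derivative
  remains.\<close>

lemma partial_increment:
  assumes seg: "\<And>s. s \<in> {0..1} \<Longrightarrow> x + (s * t) *\<^sub>R axis i 1 \<in> ball 0 1 - {0}"
    and bd: "\<And>s. s \<in> {0..1} \<Longrightarrow> norm (partial i (\<lambda>y. A y F) (x + (s * t) *\<^sub>R axis i 1) - c) \<le> \<epsilon>"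
  shows "norm (A (x + t *\<^sub>R axis i 1) F - A x F - t *\<^sub>R c) \<le> \<epsilon> * \<bar>t\<bar>"
proof -
  define g where "g s = A (x + (s * t) *\<^sub>R axis i 1) F - (s * t) *\<^sub>R c" for s
  have "(g has_vector_derivative t *\<^sub>R (partial i (\<lambda>y. A y F) (x + (s * t) *\<^sub>R axis i 1) - c)) (at s within {0..1})" if s: "s \<in> {0..1}" for s
  proof -
    let ?h = "\<lambda>\<tau>. A (x + (s * t) *\<^sub>R axis i 1 + \<tau> *\<^sub>R axis i 1) F"
    have "(?h has_vector_derivative partial i (\<lambda>y. A y F) (x + (s * t) *\<^sub>R axis i 1)) (at ((s - s) * t))"
      using partial_exists[OF seg[OF s], of i F] by (simp add: has_partial_at_def partial_def vector_derivative_works)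
    moreover have "((\<lambda>\<sigma>. (\<sigma> - s) * t) has_real_derivative t) (at s)" by (auto intro!: derivative_eq_intros)
    ultimately have "((?h \<circ> (\<lambda>\<sigma>. (\<sigma> - s) * t)) has_vector_derivative t *\<^sub>R partial i (\<lambda>y. A y F) (x + (s * t) *\<^sub>R axis i 1)) (at s)"
      by (intro vector_diff_chain_at) (auto simp: has_real_derivative_iff_has_vector_derivative)
    moreover have "?h \<circ> (\<lambda>\<sigma>. (\<sigma> - s) * t) = (\<lambda>\<sigma>. A (x + (\<sigma> * t) *\<^sub>R axis i 1) F)"
      by (auto simp: fun_eq_iff algebra_simps simp flip: scaleR_add_left)
    moreover have "((\<lambda>\<sigma>. (\<sigma> * t) *\<^sub>R c) has_vector_derivative t *\<^sub>R c) (at s)"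
      by (auto intro!: derivative_eq_intros simp: has_real_derivative_iff_has_vector_derivative[symmetric])
    ultimately have "(g has_vector_derivative t *\<^sub>R partial i (\<lambda>y. A y F) (x + (s * t) *\<^sub>R axis i 1) - t *\<^sub>R c) (at s)"
      unfolding g_def[abs_def] by (auto intro: has_vector_derivative_diff)
    then show ?thesis by (auto simp: scaleR_diff_right intro: has_vector_derivative_at_within)
  qed
  moreover have "onorm (\<lambda>h. h *\<^sub>R (t *\<^sub>R w)) \<le> \<epsilon> * \<bar>t\<bar>" if w: "norm w \<le> \<epsilon>" for w :: "real^2^'m"
  proof (rule onorm_bound)
    show "0 \<le> \<epsilon> * \<bar>t\<bar>" using order_trans[OF norm_ge_zero w] by simp
    show "norm (h *\<^sub>R (t *\<^sub>R w)) \<le> \<epsilon> * \<bar>t\<bar> * norm h" for h :: real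
      using mult_right_mono[OF w, of "\<bar>t\<bar> * \<bar>h\<bar>"] by (simp add: mult_ac abs_mult)
  qed
  ultimately have "norm (g 1 - g 0) \<le> (\<epsilon> * \<bar>t\<bar>) * norm (1 - 0 :: real)"
    using bd
    by (intro differentiable_bound[of "{0..1}" g "\<lambda>s h. h *\<^sub>R (t *\<^sub>R (partial i (\<lambda>y. A y F) (x + (s * t) *\<^sub>R axis i 1) - c))"])
       (auto simp only: has_vector_derivative_def convex_real_interval zero_le_one atLeastAtMost_iff order_refl)
  then show ?thesis by (simp add: g_def diff_diff_eq add.commute)
qed

text \<open>Joint continuity of the partial derivatives makes the remainder uniform for
  \<open>F\<close> near \<open>F0\<close>. This uniformity is the point: along the solution the
  gradient argument moves together with \<open>x\<close>.\<close>

lemma increment_in_x: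
  assumes x0: "x0 \<in> ball 0 1 - {0}" and "\<epsilon> > 0"
  obtains \<delta> where "\<delta> > 0" "ball x0 \<delta> \<subseteq> ball 0 1 - {0}" "\<And>x F. norm (x - x0) < \<delta> \<Longrightarrow> norm (F - F0) < \<delta> \<Longrightarrow>
     norm (A x F - A x0 F - dA x0 F0 (x - x0)) \<le> \<epsilon> * norm (x - x0)"
proof -
  have op: "open ((ball 0 1 - {0::real^2}) \<times> (UNIV :: (real^2^'m) set))" by (auto intro!: open_Times open_delete)
  let ?P = "\<lambda>i (x, F). partial i (\<lambda>y. A y F) x"
  have "\<exists>\<delta>>0. \<forall>x F. norm (x - x0) < \<delta> \<longrightarrow> norm (F - F0) < \<delta> \<longrightarrow>
        x \<in> ball 0 1 - {0} \<and> norm (?P i (x, F) - ?P i (x0, F0)) \<le> \<epsilon> / 2" for i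
  proof -
    have "isCont (?P i) (x0, F0)"
      using continuous_partial[of i] op x0 by (simp add: continuous_on_eq_continuous_at)
    then obtain d1 where d1: "d1 > 0" "\<And>z. dist z (x0, F0) < d1 \<Longrightarrow> dist (?P i z) (?P i (x0, F0)) < \<epsilon> / 2"
      unfolding continuous_at_eps_delta using \<open>\<epsilon> > 0\<close> by (metis half_gt_zero)
    have "open (ball 0 1 - {0::real^2})" by (auto intro: open_delete)
    then obtain d2 where d2: "d2 > 0" "ball x0 d2 \<subseteq> ball 0 1 - {0}" using x0 open_contains_ball by blast
    have "x \<in> ball 0 1 - {0} \<and> norm (?P i (x, F) - ?P i (x0, F0)) \<le> \<epsilon> / 2"
      if "norm (x - x0) < min d2 (d1 / 2)" "norm (F - F0) < min d2 (d1 / 2)" for x F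
    proof -
      have "x \<in> ball x0 d2" using that by (auto simp: dist_norm norm_minus_commute)
      have "dist (x, F) (x0, F0) \<le> dist x x0 + dist F F0"
        unfolding dist_Pair_Pair by (rule sqrt_sum_squares_le_sum) auto
      then have "dist (x, F) (x0, F0) < d1" using that by (simp add: dist_norm)
      then have "norm (?P i (x, F) - ?P i (x0, F0)) < \<epsilon> / 2" using d1(2) by (simp only: dist_norm)
      moreover have "x \<in> ball 0 1 - {0}" using \<open>x \<in> ball x0 d2\<close> d2(2) by blast
      ultimately show ?thesis by simp
    qed
    then show ?thesis using d1 d2 by (intro exI[of _ "min d2 (d1 / 2)"]) auto
  qed
  then obtain \<delta> where \<delta>: "\<And>i. \<delta> i > 0" "\<And>i x F. norm (x - x0) < \<delta> i \<Longrightarrow> norm (F - F0) < \<delta> i \<Longrightarrow>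
        x \<in> ball 0 1 - {0} \<and> norm (?P i (x, F) - ?P i (x0, F0)) \<le> \<epsilon> / 2"
    by metis
  define d where "d = min (\<delta> 1) (\<delta> 2)"
  show ?thesis
  proof (rule that[of d])
    show "d > 0" using \<delta>(1) by (simp add: d_def)
    show "ball x0 d \<subseteq> ball 0 1 - {0}"
    proof
      fix x assume "x \<in> ball x0 d"
      then have "norm (x - x0) < \<delta> 1" by (simp add: d_def dist_norm norm_minus_commute)
      then show "x \<in> ball 0 1 - {0}" using \<delta>(2)[of x 1 F0] \<delta>(1) by simp
    qed
    fix x F assume x: "norm (x - x0) < d" and F: "norm (F - F0) < d"
    define h where "h = x - x0"
    \<comment> \<open>The corner of the path from \<open>x0\<close> to \<open>x\<close> made of two
      axis-parallel segments.\<close>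
    define y where "y = x0 + h $ 1 *\<^sub>R axis 1 1"
    have hd: "h = h $ 1 *\<^sub>R axis 1 1 + h $ 2 *\<^sub>R axis 2 1"
      by (simp add: vec_eq_iff forall_2 axis_def)
    \<comment> \<open>Every point of that path is no farther from \<open>x0\<close> than
      \<open>x\<close>, so the ball on which the partial derivatives are controlled contains the
      path.\<close>
    have hs: "norm ((s * h $ 1) *\<^sub>R (axis 1 1 :: real^2) + (s' * h $ 2) *\<^sub>R axis 2 1) \<le> norm h" if "s \<in> {0..1}" "s' \<in> {0..1}" for s s' and h :: "real^2"
    proof -
      have "\<bar>s * h $ 1\<bar> \<le> \<bar>h $ 1\<bar>" "\<bar>s' * h $ 2\<bar> \<le> \<bar>h $ 2\<bar>"
        using that by (auto simp: abs_mult mult_left_le_one_le)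
      then have "norm (((s * h $ 1) *\<^sub>R (axis 1 1 :: real^2) + (s' * h $ 2) *\<^sub>R axis 2 1) $ i) \<le> norm (h $ i)" for i :: 2
        using exhaust_2[of i] by (auto simp: axis_def)
      then show ?thesis by (rule norm_le_componentwise_cart)
    qed
    have 1: "norm (A y F - A x0 F - h $ 1 *\<^sub>R ?P 1 (x0, F0)) \<le> \<epsilon> / 2 * \<bar>h $ 1\<bar>"
      unfolding y_def
    proof (rule partial_increment)
      fix s :: real assume "s \<in> {0..1}"
      then have "norm (x0 + (s * h $ 1) *\<^sub>R axis 1 1 - x0) < \<delta> 1"
        using hs[of s 0 h] x by (simp add: d_def h_def)
      then show "x0 + (s * h $ 1) *\<^sub>R axis 1 1 \<in> ball 0 1 - {0}"
         "norm (partial 1 (\<lambda>y. A y F) (x0 + (s * h $ 1) *\<^sub>R axis 1 1) - ?P 1 (x0, F0)) \<le> \<epsilon> / 2"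
        using \<delta>(2)[of _ 1 F] F by (auto simp: d_def)
    qed
    have 2: "norm (A (y + h $ 2 *\<^sub>R axis 2 1) F - A y F - h $ 2 *\<^sub>R ?P 2 (x0, F0)) \<le> \<epsilon> / 2 * \<bar>h $ 2\<bar>"
    proof (rule partial_increment)
      fix s :: real assume "s \<in> {0..1}"
      then have "norm (y + (s * h $ 2) *\<^sub>R axis 2 1 - x0) < \<delta> 2"
        using hs[of 1 s h] x by (simp add: d_def h_def y_def add.assoc)
      then show "y + (s * h $ 2) *\<^sub>R axis 2 1 \<in> ball 0 1 - {0}"
         "norm (partial 2 (\<lambda>y. A y F) (y + (s * h $ 2) *\<^sub>R axis 2 1) - ?P 2 (x0, F0)) \<le> \<epsilon> / 2"
        using \<delta>(2)[of _ 2 F] F by (auto simp: d_def)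
    qed
    have "y + h $ 2 *\<^sub>R axis 2 1 = x0 + h" by (metis hd add.assoc y_def)
    then have "y + h $ 2 *\<^sub>R axis 2 1 = x" by (simp add: h_def)
    then have "A x F - A x0 F - dA x0 F0 (x - x0) = (A y F - A x0 F - h $ 1 *\<^sub>R ?P 1 (x0, F0)) + (A (y + h $ 2 *\<^sub>R axis 2 1) F - A y F - h $ 2 *\<^sub>R ?P 2 (x0, F0))"
      by (simp add: dA_def sum_2 h_def)
    then have "norm (A x F - A x0 F - dA x0 F0 (x - x0)) \<le> \<epsilon> / 2 * \<bar>h $ 1\<bar> + \<epsilon> / 2 * \<bar>h $ 2\<bar>"
      using 1 2 norm_triangle_mono by metis
    also have "\<dots> \<le> \<epsilon> / 2 * norm h + \<epsilon> / 2 * norm h"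
      using \<open>\<epsilon> > 0\<close> by (intro add_mono mult_left_mono component_le_norm_cart) auto
    finally show "norm (A x F - A x0 F - dA x0 F0 (x - x0)) \<le> \<epsilon> * norm (x - x0)"
      by (simp add: h_def)
  qed
qed

lemma linear_dA: "linear (dA x F)"
  unfolding dA_def by (auto simp: linear_iff scaleR_add_left sum.distrib scaleR_sum_right)

lemma has_derivative_in_x:
  assumes "x0 \<in> ball 0 1 - {0}"
  shows "((\<lambda>x. A x F) has_derivative dA x0 F) (at x0)"
  unfolding has_derivative_at_alt
proof (intro conjI allI impI)
  show "bounded_linear (dA x0 F)" using linear_dA linear_conv_bounded_linear by blast
  fix \<epsilon> :: real assume "\<epsilon> > 0"
  from increment_in_x[OF assms this, of F]
  show "\<exists>d>0. \<forall>y. norm (y - x0) < d \<longrightarrow> norm (A y F - A x0 F - dA x0 F (y - x0)) \<le> \<epsilon> * norm (y - x0)"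
    by (metis diff_self norm_zero)
qed

text \<open>Joint continuity follows from the uniform increment in \<open>x\<close> together with
  continuity of \<open>A x0\<close> in the gradient at the single point \<open>x0\<close>.\<close>

lemma isCont_A:
  assumes x0: "x0 \<in> ball 0 1 - {0}"
  shows "isCont (\<lambda>(x, F). A x F) (x0, F0)"
proof -
  obtain \<delta> where \<delta>: "\<delta> > 0" "\<And>x F. norm (x - x0) < \<delta> \<Longrightarrow> norm (F - F0) < \<delta> \<Longrightarrow>
     norm (A x F - A x0 F - dA x0 F0 (x - x0)) \<le> 1 * norm (x - x0)"
    using increment_in_x[OF x0 zero_less_one, of F0] by metis
  have ev: "\<forall>\<^sub>F z in at (x0, F0). norm (fst z - x0) < \<delta> \<and> norm (snd z - F0) < \<delta>"
  proof -
    have "((\<lambda>z. fst z - x0) \<longlongrightarrow> 0) (at (x0, F0))" "((\<lambda>z. snd z - F0) \<longlongrightarrow> 0) (at (x0, F0))"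
      by (rule tendsto_eq_intros refl | simp)+
    from this[THEN tendstoD, OF \<delta>(1)] show ?thesis by eventually_elim (simp add: dist_norm)
  qed
  have A0: "isCont (A x0) F0" using has_derivative_in_F[of x0] x0 has_derivative_continuous by blast
  have "((\<lambda>z. A (fst z) (snd z) - A x0 F0) \<longlongrightarrow> 0) (at (x0, F0))"
  proof (rule Lim_null_comparison)
    show "\<forall>\<^sub>F z in at (x0, F0). norm (A (fst z) (snd z) - A x0 F0) \<le>
        norm (fst z - x0) + norm (dA x0 F0 (fst z - x0)) + norm (A x0 (snd z) - A x0 F0)"
      using ev
    proof eventually_elim
      case (elim z)
      have "A (fst z) (snd z) - A x0 F0 = (A (fst z) (snd z) - A x0 (snd z) - dA x0 F0 (fst z - x0)) + dA x0 F0 (fst z - x0) + (A x0 (snd z) - A x0 F0)"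
        by simp
      then show ?case using \<delta>(2)[of "fst z" "snd z"] elim by (smt (verit) norm_triangle_ineq mult_1)
    qed
    have c: "isCont (dA x0 F0) 0" using linear_dA linear_continuous_at linear_conv_bounded_linear by blast
    have f: "((\<lambda>z. fst z - x0) \<longlongrightarrow> 0) (at (x0, F0))" "((\<lambda>z. snd z) \<longlongrightarrow> F0) (at (x0, F0))"
      by (rule tendsto_eq_intros refl | simp)+
    show "((\<lambda>z. norm (fst z - x0) + norm (dA x0 F0 (fst z - x0)) + norm (A x0 (snd z) - A x0 F0)) \<longlongrightarrow> 0) (at (x0, F0))"
      using isCont_tendsto_compose[OF c f(1)] isCont_tendsto_compose[OF A0 f(2)] f(1) linear_0[OF linear_dA]
      by (auto intro!: tendsto_eq_intros)
  qed
  then show ?thesis by (simp add: isCont_def LIM_zero_iff case_prod_unfold)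
qed

lemma continuous_A:
  assumes "continuous_on S x" "continuous_on S F" "\<And>s. s \<in> S \<Longrightarrow> x s \<in> ball 0 1 - {0}"
  shows "continuous_on S (\<lambda>s. A (x s) (F s))"
proof -
  have "continuous_on ((ball 0 1 - {0}) \<times> UNIV) (\<lambda>(x, F). A x F)"
    using isCont_A by (intro continuous_at_imp_continuous_on) auto
  moreover have "(\<lambda>s. (x s, F s)) ` S \<subseteq> (ball 0 1 - {0}) \<times> UNIV" using assms(3) by auto
  ultimately show ?thesis
    using continuous_on_compose2[OF _ continuous_on_Pair[OF assms(1,2)], of _ "\<lambda>(x, F). A x F"] by simp
qed

end

section \<open>The gradient of a one-homogeneous map\<close>

lemma integral_pair_mult:
  fixes f g :: "real \<Rightarrow> real"
  assumes f: "integrable lborel f" and g: "integrable lborel g"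
  shows "integrable lborel (\<lambda>z. f (fst z) * g (snd z))"
    and "(LBINT z. f (fst z) * g (snd z)) = (LBINT x. f x) * (LBINT y. g y)"
proof -
  note i = integrable_pair_mult[OF f g]
  show "integrable lborel (\<lambda>z. f (fst z) * g (snd z))"
    using i by (simp add: lborel_prod case_prod_unfold)
  have "(LBINT x. (LBINT y. f x * g y)) = (\<integral>z. f (fst z) * g (snd z) \<partial>(lborel \<Otimes>\<^sub>M lborel))"
    using lborel_pair.integral_fst'[OF i[unfolded case_prod_unfold]] by simp
  then show "(LBINT z. f (fst z) * g (snd z)) = (LBINT x. f x) * (LBINT y. g y)"
    by (simp add: lborel_prod)
qed

lemma integrable_rect_test:
  fixes h g :: "real \<times> real \<Rightarrow> real"
  assumes h: "set_integrable lborel ({a<..<b} \<times> {c<..<d}) h"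
    and m: "g \<in> borel_measurable borel" and bd: "\<And>z. \<bar>g z\<bar> \<le> B"
  shows "integrable lborel (\<lambda>z. indicator ({a<..<b} \<times> {c<..<d}) z * (h z * g z))"
proof (rule Bochner_Integration.integrable_bound)
  have i: "integrable lborel (\<lambda>z. indicator ({a<..<b} \<times> {c<..<d}) z * h z)"
    using h by (simp add: set_integrable_def)
  then show "integrable lborel (\<lambda>z. B * (indicator ({a<..<b} \<times> {c<..<d}) z * h z))" by simp
  have "(\<lambda>z. (indicator ({a<..<b} \<times> {c<..<d}) z * h z) * g z) \<in> borel_measurable lborel"
    using m by (intro borel_measurable_times[OF borel_measurable_integrable[OF i]]) simp
  then show "(\<lambda>z. indicator ({a<..<b} \<times> {c<..<d}) z * (h z * g z)) \<in> borel_measurable lborel"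
    by (simp add: mult.assoc)
  show "AE z in lborel. norm (indicator ({a<..<b} \<times> {c<..<d}) z * (h z * g z)) \<le> norm (B * (indicator ({a<..<b} \<times> {c<..<d}) z * h z))"
    by (rule AE_I2) (auto simp: indicator_def abs_mult mult.commute[of B] intro!: mult_left_mono order_trans[OF bd])
qed

lemma borel_measurable_fst_real [measurable]: "fst \<in> borel_measurable (borel :: (real \<times> real) measure)"
  and borel_measurable_snd_real [measurable]: "snd \<in> borel_measurable (borel :: (real \<times> real) measure)"
  by (auto intro!: borel_measurable_continuous_onI continuous_intros)

lemma AE_snd:
  fixes P :: "real \<Rightarrow> bool"
  assumes "AE t in lborel. P t"
  shows "AE z in (lborel :: (real \<times> real) measure). P (snd z)"
proof -
  obtain N where N: "N \<in> null_sets lborel" "{t. \<not> P t} \<subseteq> N"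
    using assms by (auto elim!: AE_E simp: null_sets_def)
  have "UNIV \<times> N \<in> null_sets (lborel \<Otimes>\<^sub>M (lborel :: real measure))"
    using N(1) by (auto simp: null_sets_def lborel.emeasure_pair_measure_Times)
  then have "UNIV \<times> N \<in> null_sets (lborel :: (real \<times> real) measure)" by (simp only: lborel_prod)
  then have "AE z in (lborel :: (real \<times> real) measure). z \<notin> UNIV \<times> N" by (rule AE_not_in)
  then show ?thesis by eventually_elim (use N(2) in auto)
qed

lemma AE_exists_in_interval:
  fixes a b :: real
  assumes "AE x in lborel. P x" and "a < b"
  shows "\<exists>x\<in>{a<..<b}. P x"
proof (rule ccontr)
  assume "\<not> ?thesis"
  then have "AE x in lborel. x \<notin> {a<..<b}" using assms(1) by (auto elim!: eventually_mono)
  then have "emeasure lborel {a<..<b} = 0"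
    using AE_iff_measurable[of "{a<..<b}" lborel "\<lambda>x. x \<notin> {a<..<b}"]
    by (auto simp: greaterThanLessThan_def greaterThan_def lessThan_def Int_def)
  then show False using \<open>a < b\<close> by simp
qed

text \<open>Fubini provides one radius at which almost every \<open>t\<close> is good, and the
  condition does not involve the radius.\<close>

lemma AE_snd_D:
  fixes P :: "real \<Rightarrow> bool"
  assumes "AE z in (lborel :: (real \<times> real) measure). fst z \<in> {a<..<b} \<longrightarrow> P (snd z)" and "a < b"
  shows "AE t in lborel. P t"
proof -
  have "AE z in (lborel \<Otimes>\<^sub>M (lborel :: real measure)). fst z \<in> {a<..<b} \<longrightarrow> P (snd z)"
    using assms(1) by (simp only: lborel_prod)
  then have "AE x in (lborel :: real measure). AE y in lborel. fst (x, y) \<in> {a<..<b} \<longrightarrow> P (snd (x, y))"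
    by (rule lborel_pair.AE_pair)
  then have ae: "AE x in (lborel :: real measure). x \<in> {a<..<b} \<longrightarrow> (AE y in lborel. P y)"
    by eventually_elim auto
  from AE_exists_in_interval[OF ae \<open>a < b\<close>] show ?thesis by blast
qed

text \<open>Integration by parts. One factor \<open>r\<close> is the Jacobian, the other the
  homogeneity of \<open>u\<close>.\<close>

lemma integral_test_times_square:
  assumes "test_fun 0 b \<alpha> \<alpha>'"
  shows "(LBINT r. r\<^sup>2 * \<alpha>' r) = - 2 * (LBINT r. r * \<alpha> r)"
proof (cases "b > 0")
  case True
  have "test_fun 0 b (\<lambda>x. x\<^sup>2 * \<alpha> x) (\<lambda>x. 2 * x * \<alpha> x + x\<^sup>2 * \<alpha>' x)"
    by (rule test_fun_mult[OF assms]) (auto intro!: derivative_eq_intros continuous_intros)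
  from integral_test_fun_deriv_tail[OF this, of 0]
  have "(LBINT x. indicator {0<..} x * (2 * x * \<alpha> x + x\<^sup>2 * \<alpha>' x)) = 0" by simp
  also have "(\<lambda>x. indicator {0<..} x * (2 * x * \<alpha> x + x\<^sup>2 * \<alpha>' x)) = (\<lambda>x. 2 * (x * \<alpha> x) + x\<^sup>2 * \<alpha>' x)"
    using test_funD(4,5)[OF assms] by (auto simp: fun_eq_iff indicator_def)
  finally have 1: "(LBINT x. 2 * (x * \<alpha> x) + x\<^sup>2 * \<alpha>' x) = 0" .
  have "set_integrable lborel {0<..<b} (\<lambda>x. x)" "set_integrable lborel {0<..<b} (\<lambda>x. x\<^sup>2)"
    by (rule set_integrable_subset[of _ "{0..b}"], intro borel_integrable_atLeastAtMost' continuous_intros, auto)+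
  from test_fun_integrable(1)[OF assms this(1)] test_fun_integrable(2)[OF assms this(2)] 1
  show ?thesis by simp
next
  case False
  have "\<alpha> x = 0" "\<alpha>' x = 0" for x using test_funD(4,5)[OF assms, of x] False by auto
  then show ?thesis by simp
qed

text \<open>The product form is asked for almost everywhere only, because the homogeneous form of
  \<open>u\<close> is transferred to a Borel version.\<close>

lemma rect_integral_separated:
  fixes a b :: "real \<Rightarrow> real"
  assumes a: "integrable lborel a" "\<And>r. r \<notin> {0<..<1/4} \<Longrightarrow> a r = 0"
    and b: "integrable lborel b" "\<And>t. t \<notin> {-3<..<3} \<Longrightarrow> b t = 0"
    and k: "k \<in> borel_measurable borel" "AE z\<in>coord_rect in lborel. k z = a (fst z) * b (snd z)"
  shows "set_integrable lborel coord_rect k" "(LBINT z:coord_rect. k z) = (LBINT r. a r) * (LBINT t. b t)"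
proof -
  have [measurable]: "coord_rect \<in> sets borel" by (intro borel_open open_Times) auto
  have ae: "AE z in lborel. indicator coord_rect z *\<^sub>R k z = a (fst z) * b (snd z)"
    using k(2)
  proof eventually_elim
    case (elim z)
    then show ?case using a(2)[of "fst z"] b(2)[of "snd z"]
      by (cases "z \<in> coord_rect") (auto simp: mem_Times_iff simp del: greaterThanLessThan_iff)
  qed
  have m: "(\<lambda>z. indicator coord_rect z *\<^sub>R k z) \<in> borel_measurable lborel" using k(1) by simp
  note i = integral_pair_mult[OF a(1) b(1)]
  show "set_integrable lborel coord_rect k"
    unfolding set_integrable_def using integrable_cong_AE[OF m _ ae] i(1) by auto
  show "(LBINT z:coord_rect. k z) = (LBINT r. a r) * (LBINT t. b t)"
    unfolding set_lebesgue_integral_def using integral_cong_AE[OF m _ ae] i by auto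
qed

lemma set_integrable_coord_const: "set_integrable lborel {0<..<1/4::real} (\<lambda>r. r)"
    "set_integrable lborel {0<..<1/4::real} (\<lambda>r. r\<^sup>2)" "set_integrable lborel {-3<..<3::real} (\<lambda>t. 1::real)"
  by (rule set_integrable_subset[of _ "{0..1/4}"], intro borel_integrable_atLeastAtMost' continuous_intros, simp, force)+
     (simp add: set_integrable_def)

text \<open>\<open>U\<close>, \<open>N\<close>, \<open>E\<close> stand for one component of
  \<open>u\<close> and of its derivatives along \<open>n\<close> and \<open>e\<close>. For smooth
  \<open>g\<close> the gradient of \<open>r g(t)\<close> has the components \<open>g'\<close> and
  \<open>g - t g'\<close>. Weakly, \<open>W1\<close> averaged in \<open>r\<close> is the hypothesis
  of the du Bois-Reymond lemma and produces \<open>p\<close> as the derivative of \<open>g\<close>;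
  then \<open>W1\<close> and \<open>W2\<close> with all product tests identify \<open>N\<close> and
  \<open>E\<close>.\<close>

lemma gradient_structure_scalar:
  fixes U N E :: "real \<times> real \<Rightarrow> real" and g :: "real \<Rightarrow> real"
  assumes meas [measurable]: "U \<in> borel_measurable borel" "N \<in> borel_measurable borel" "E \<in> borel_measurable borel"
    and int: "set_integrable lborel coord_rect (\<lambda>z. fst z * U z)" "set_integrable lborel coord_rect (\<lambda>z. fst z * N z)"
      "set_integrable lborel coord_rect (\<lambda>z. fst z * E z)"
    and U: "AE z\<in>coord_rect in lborel. U z = fst z * g (snd z)"
    and W1: "\<And>\<alpha> \<alpha>' \<beta> \<beta>'. test_fun 0 (1/4) \<alpha> \<alpha>' \<Longrightarrow> test_fun (-3) 3 \<beta> \<beta>' \<Longrightarrow>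
      (LBINT z:coord_rect. fst z * U z * (\<alpha> (fst z) * \<beta>' (snd z) / fst z)) =
      - (LBINT z:coord_rect. fst z * N z * (\<alpha> (fst z) * \<beta> (snd z)))"
    and W2: "\<And>\<alpha> \<alpha>' \<beta> \<beta>'. test_fun 0 (1/4) \<alpha> \<alpha>' \<Longrightarrow> test_fun (-3) 3 \<beta> \<beta>' \<Longrightarrow>
      (LBINT z:coord_rect. fst z * U z * (\<alpha>' (fst z) * \<beta> (snd z) - \<alpha> (fst z) * \<beta>' (snd z) * snd z / fst z)) =
      - (LBINT z:coord_rect. fst z * E z * (\<alpha> (fst z) * \<beta> (snd z)))"
  shows "\<exists>c p. p \<in> borel_measurable borel \<and> set_integrable lborel {-3<..<3} p \<and>
    (AE t\<in>{-3<..<3} in lborel. g t = c + (LBINT s:{-3<..<t}. p s)) \<and>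
    (AE z\<in>coord_rect in lborel. N z = p (snd z) \<and> E z = g (snd z) - snd z * p (snd z))"
proof -
  have [measurable]: "coord_rect \<in> sets borel" by (intro borel_open open_Times) auto
  \<comment> \<open>The values of \<open>u\<close> on one segment may fail to be measurable, so
    \<open>g\<close> is not known to be. A good radius \<open>r0\<close> supplies a Borel version
    \<open>g1\<close>.\<close>
  have "AE r in lborel. AE t in lborel. (r, t) \<in> coord_rect \<longrightarrow> U (r, t) = r * g t"
    using lborel_pair.AE_pair[of "\<lambda>z. z \<in> coord_rect \<longrightarrow> U z = fst z * g (snd z)"] U
    by (simp only: lborel_prod fst_conv snd_conv simp_thms)
  then obtain r0 where r0: "r0 \<in> {0<..<1/4::real}" "AE t in lborel. (r0, t) \<in> coord_rect \<longrightarrow> U (r0, t) = r0 * g t"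
    using AE_exists_in_interval[of _ 0 "1/4"] by force
  define g1 where "g1 t = U (r0, t) / r0" for t
  have [measurable]: "g1 \<in> borel_measurable borel" unfolding g1_def[abs_def]
    by (intro borel_measurable_divide measurable_compose[OF _ meas(1)] borel_measurable_continuous_onI continuous_intros)
  have g1: "AE t\<in>{-3<..<3} in lborel. g t = g1 t"
    using r0(2) by eventually_elim (use r0(1) in \<open>auto simp: g1_def\<close>)
  have U1: "AE z\<in>coord_rect in lborel. U z = fst z * g1 (snd z)"
    using U AE_snd[OF g1] by eventually_elim auto
  have g1_int: "set_integrable lborel {-3<..<3} g1"
  proof -
    let ?k = "\<lambda>z. (indicator {0<..<1/4} (fst z) * (fst z)\<^sup>2) * (indicator {-3<..<3} (snd z) * g1 (snd z))"
    have "integrable lborel (\<lambda>z. indicator coord_rect z *\<^sub>R (fst z * U z))"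
      using int(1) by (simp add: set_integrable_def)
    moreover have "AE z in lborel. indicator coord_rect z *\<^sub>R (fst z * U z) = ?k z"
      using U1 by eventually_elim (auto simp: indicator_def power2_eq_square mem_Times_iff)
    ultimately have "integrable lborel ?k"
      by (subst integrable_cong_AE[symmetric, rotated 2]) auto
    then have "integrable (lborel \<Otimes>\<^sub>M lborel) ?k" by (simp only: lborel_prod)
    from AE_exists_in_interval[OF lborel_pair.AE_integrable_fst'[OF this], of 0 "1/4"]
    obtain r where r: "r \<in> {0<..<1/4::real}" "integrable lborel (\<lambda>t. (indicator {0<..<1/4} r * r\<^sup>2) * (indicator {-3<..<3} t * g1 t))"
      by auto
    from integrable_mult_right[OF r(2), of "1 / r\<^sup>2"] r(1) show ?thesis
      by (simp add: set_integrable_def)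
  qed
  \<comment> \<open>Normalised against the Jacobian: the average in \<open>r\<close> of a function
    of \<open>t\<close> alone gives the function back.\<close>
  obtain \<alpha>0 \<alpha>0' where \<alpha>0: "test_fun 0 (1/4) \<alpha>0 \<alpha>0'" "(LBINT r. r * \<alpha>0 r) = 1"
    by (rule test_fun_normalized[of 0 "1/4" "\<lambda>r. r"]) (auto intro: continuous_intros)
  define p where "p t = (LBINT r. indicator coord_rect (r, t) * (r * N (r, t) * \<alpha>0 r))" for t
  have \<alpha>0_meas [measurable]: "\<alpha>0 \<in> borel_measurable borel" using test_funD[OF \<alpha>0(1)] by auto
  obtain B0 where B0: "\<And>x. \<bar>\<alpha>0 x\<bar> \<le> B0" using test_fun_bounded[OF \<alpha>0(1)] by metis
  have "integrable lborel (\<lambda>z. indicator coord_rect z * (fst z * N z * \<alpha>0 (fst z)))"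
    by (rule integrable_rect_test[OF int(2)]) (use B0 in auto)
  then have iN: "integrable (lborel \<Otimes>\<^sub>M lborel) (\<lambda>(r, t). indicator coord_rect (r, t) * (r * N (r, t) * \<alpha>0 r))"
    by (simp add: lborel_prod case_prod_unfold)
  from lborel_pair.integrable_snd[OF this] have p_i: "integrable lborel p" by (simp add: p_def[abs_def])
  then have p_meas [measurable]: "p \<in> borel_measurable borel" by auto
  have p_int: "set_integrable lborel {-3<..<3} p"
    using integrable_mult_indicator[OF _ p_i] by (simp add: set_integrable_def)
  have p_test: "(LBINT z:coord_rect. fst z * N z * (\<alpha>0 (fst z) * \<beta> (snd z))) = (LBINT t. p t * \<beta> t)"
    if \<beta>: "test_fun (-3) 3 \<beta> \<beta>'" for \<beta> \<beta>'
  proof -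
    have [measurable]: "\<beta> \<in> borel_measurable borel" using test_funD[OF \<beta>] by auto
    obtain B where B: "\<And>x. \<bar>\<beta> x\<bar> \<le> B" using test_fun_bounded[OF \<beta>] by metis
    have B0p: "0 \<le> B0" using B0[of 0] by linarith
    have "integrable lborel (\<lambda>z. indicator coord_rect z * (fst z * N z * (\<alpha>0 (fst z) * \<beta> (snd z))))"
      by (rule integrable_rect_test[OF int(2), of _ "B0 * B"])
         (use B0 B B0p in \<open>auto simp: abs_mult intro!: mult_mono\<close>)
    then have i: "integrable (lborel \<Otimes>\<^sub>M lborel) (\<lambda>(r, t). indicator coord_rect (r, t) * (r * N (r, t) * (\<alpha>0 r * \<beta> t)))"
      by (simp add: lborel_prod case_prod_unfold)
    have "(LBINT z:coord_rect. fst z * N z * (\<alpha>0 (fst z) * \<beta> (snd z)))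
      = integral\<^sup>L (lborel \<Otimes>\<^sub>M lborel) (\<lambda>(r, t). indicator coord_rect (r, t) * (r * N (r, t) * (\<alpha>0 r * \<beta> t)))"
      by (simp add: lborel_prod case_prod_unfold set_lebesgue_integral_def)
    also have "\<dots> = (LBINT t. (LBINT r. indicator coord_rect (r, t) * (r * N (r, t) * (\<alpha>0 r * \<beta> t))))"
      using lborel_pair.integral_snd[OF i] by simp
    also have "\<dots> = (LBINT t. p t * \<beta> t)"
      unfolding p_def by (intro Bochner_Integration.integral_cong refl)
        (simp flip: integral_mult_left_zero add: mult.assoc)
    finally show ?thesis .
  qed
  have sep1: "(LBINT z:coord_rect. fst z * U z * (\<alpha> (fst z) * \<beta>' (snd z) / fst z)) = (LBINT r. r * \<alpha> r) * (LBINT t. g1 t * \<beta>' t)"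
    if \<alpha>: "test_fun 0 (1/4) \<alpha> \<alpha>'" and \<beta>: "test_fun (-3) 3 \<beta> \<beta>'" for \<alpha> \<alpha>' \<beta> \<beta>'
  proof (rule rect_integral_separated)
    have [measurable]: "\<alpha> \<in> borel_measurable borel" "\<beta>' \<in> borel_measurable borel" using test_funD[OF \<alpha>] test_funD[OF \<beta>] by auto
    show "integrable lborel (\<lambda>r. r * \<alpha> r)" "integrable lborel (\<lambda>t. g1 t * \<beta>' t)"
      using test_fun_integrable[OF \<alpha> set_integrable_coord_const(1)] test_fun_integrable[OF \<beta> g1_int] by auto
    show "(\<lambda>z. fst z * U z * (\<alpha> (fst z) * \<beta>' (snd z) / fst z)) \<in> borel_measurable borel" by measurable
    show "AE z\<in>coord_rect in lborel. fst z * U z * (\<alpha> (fst z) * \<beta>' (snd z) / fst z) = (fst z * \<alpha> (fst z)) * (g1 (snd z) * \<beta>' (snd z))"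
      using U1 by eventually_elim auto
  qed (use test_funD(4,5)[OF \<alpha>] test_funD(4,5)[OF \<beta>] in auto)
  have weak_p: "(LBINT t. g1 t * \<beta>' t) = - (LBINT t. p t * \<beta> t)" if \<beta>: "test_fun (-3) 3 \<beta> \<beta>'" for \<beta> \<beta>'
    using W1[OF \<alpha>0(1) \<beta>] sep1[OF \<alpha>0(1) \<beta>] p_test[OF \<beta>] \<alpha>0(2) by simp
  obtain c where c: "AE t\<in>{-3<..<3} in lborel. g1 t = c + (LBINT s:{-3<..<t}. p s)"
    using du_bois_reymond[OF _ g1_int p_int weak_p] by auto
  \<comment> \<open>Used for both derivatives: a field that pairs with all product tests like a
    function of \<open>t\<close> alone is that function.\<close>
  have identify: "AE z\<in>coord_rect in lborel. M z = q (snd z)"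
    if M: "set_integrable lborel coord_rect (\<lambda>z. fst z * M z)" and q [measurable]: "q \<in> borel_measurable borel" "set_integrable lborel {-3<..<3} q"
      and W: "\<And>\<alpha> \<alpha>' \<beta> \<beta>'. test_fun 0 (1/4) \<alpha> \<alpha>' \<Longrightarrow> test_fun (-3) 3 \<beta> \<beta>' \<Longrightarrow>
        (LBINT z:coord_rect. fst z * M z * (\<alpha> (fst z) * \<beta> (snd z))) = (LBINT r. r * \<alpha> r) * (LBINT t. q t * \<beta> t)"
    for M q
  proof -
    have q_int: "set_integrable lborel coord_rect (\<lambda>z. fst z * q (snd z))"
      by (rule rect_integral_separated(1)[of "\<lambda>r. indicator {0<..<1/4} r * r" "\<lambda>t. indicator {-3<..<3} t * q t"])
         (use set_integrable_coord_const(1) q(2) in \<open>auto simp: set_integrable_def\<close>)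
    have "AE z\<in>coord_rect in lborel. fst z * M z - fst z * q (snd z) = 0"
    proof (rule AE_zero_if_product_test_integrals_zero)
      show "set_integrable lborel coord_rect (\<lambda>z. fst z * M z - fst z * q (snd z))"
        using M q_int by (rule set_integral_diff)
      fix \<alpha> \<alpha>' \<beta> \<beta>' assume \<alpha>: "test_fun 0 (1/4) \<alpha> \<alpha>'" and \<beta>: "test_fun (-3) 3 \<beta> \<beta>'"
      have [measurable]: "\<alpha> \<in> borel_measurable borel" "\<beta> \<in> borel_measurable borel" using test_funD[OF \<alpha>] test_funD[OF \<beta>] by auto
      obtain B1 where B1: "B1 > 0" "\<And>x. \<bar>\<alpha> x\<bar> \<le> B1" using test_fun_bounded[OF \<alpha>] by metis
      obtain B2 where B2: "B2 > 0" "\<And>x. \<bar>\<beta> x\<bar> \<le> B2" using test_fun_bounded[OF \<beta>] by metis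
      have M_int: "set_integrable lborel coord_rect (\<lambda>z. fst z * M z * (\<alpha> (fst z) * \<beta> (snd z)))"
        unfolding set_integrable_def real_scaleR_def
        by (rule integrable_rect_test[OF M, of _ "B1 * B2"])
           (use B1 B2 in \<open>auto simp: abs_mult intro!: mult_mono\<close>)
      have 1: "set_integrable lborel coord_rect (\<lambda>z. fst z * q (snd z) * (\<alpha> (fst z) * \<beta> (snd z)))"
         "(LBINT z:coord_rect. fst z * q (snd z) * (\<alpha> (fst z) * \<beta> (snd z))) = (LBINT r. r * \<alpha> r) * (LBINT t. q t * \<beta> t)"
        by (rule rect_integral_separated[of "\<lambda>r. r * \<alpha> r" "\<lambda>t. q t * \<beta> t" "\<lambda>z. fst z * q (snd z) * (\<alpha> (fst z) * \<beta> (snd z))", OF test_fun_integrable(1)[OF \<alpha> set_integrable_coord_const(1)] _ test_fun_integrable(1)[OF \<beta> q(2)]];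
            use test_funD(4)[OF \<alpha>] test_funD(4)[OF \<beta>] in \<open>simp add: mult_ac\<close>)+
      have "(LBINT z. (fst z * M z - fst z * q (snd z)) * (\<alpha> (fst z) * \<beta> (snd z)))
        = (LBINT z:coord_rect. fst z * M z * (\<alpha> (fst z) * \<beta> (snd z)) - fst z * q (snd z) * (\<alpha> (fst z) * \<beta> (snd z)))"
        unfolding set_lebesgue_integral_def
      proof (rule Bochner_Integration.integral_cong[OF refl])
        fix z :: "real \<times> real"
        show "(fst z * M z - fst z * q (snd z)) * (\<alpha> (fst z) * \<beta> (snd z)) = indicat_real coord_rect z *\<^sub>R
          (fst z * M z * (\<alpha> (fst z) * \<beta> (snd z)) - fst z * q (snd z) * (\<alpha> (fst z) * \<beta> (snd z)))"
          using test_funD(4)[OF \<alpha>, of "fst z"] test_funD(4)[OF \<beta>, of "snd z"]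
          by (cases "z \<in> coord_rect") (auto simp: left_diff_distrib mem_Times_iff simp del: greaterThanLessThan_iff)
      qed
      also have "\<dots> = 0" using set_integral_diff(2)[OF M_int 1(1)] 1(2) W[OF \<alpha> \<beta>] by simp
      finally show "(LBINT z. (fst z * M z - fst z * q (snd z)) * (\<alpha> (fst z) * \<beta> (snd z))) = 0" .
    qed
    then show ?thesis by eventually_elim auto
  qed
  have N: "AE z\<in>coord_rect in lborel. N z = p (snd z)"
  proof (rule identify[OF int(2) p_meas p_int])
    fix \<alpha> \<alpha>' \<beta> \<beta>' assume t: "test_fun 0 (1/4) \<alpha> \<alpha>'" "test_fun (-3) 3 \<beta> \<beta>'"
    show "(LBINT z:coord_rect. fst z * N z * (\<alpha> (fst z) * \<beta> (snd z))) = (LBINT r. r * \<alpha> r) * (LBINT t. p t * \<beta> t)"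
      using W1[OF t] sep1[OF t] weak_p[OF t(2)] by simp
  qed
  have E: "AE z\<in>coord_rect in lborel. E z = (\<lambda>t. g1 t - t * p t) (snd z)"
  proof (rule identify[OF int(3)])
    show "(\<lambda>t. g1 t - t * p t) \<in> borel_measurable borel" by measurable
    show "set_integrable lborel {-3<..<3} (\<lambda>t. g1 t - t * p t)"
    proof (rule set_integral_diff(1)[OF g1_int])
      have "integrable lborel (\<lambda>t. 3 * (indicator {-3<..<3} t * p t))" using p_int by (simp add: set_integrable_def)
      then show "set_integrable lborel {-3<..<3} (\<lambda>t. t * p t)"
        unfolding set_integrable_def
        by (rule Bochner_Integration.integrable_bound) (auto simp: indicator_def abs_mult intro!: AE_I2 mult_right_mono)
    qed
    fix \<alpha> \<alpha>' \<beta> \<beta>' assume t: "test_fun 0 (1/4) \<alpha> \<alpha>'" "test_fun (-3) 3 \<beta> \<beta>'"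
    show "(LBINT z:coord_rect. fst z * E z * (\<alpha> (fst z) * \<beta> (snd z))) = (LBINT r. r * \<alpha> r) * (LBINT t. (g1 t - t * p t) * \<beta> t)"
    proof -
      note \<alpha> = t(1) and \<beta> = t(2)
      have [measurable]: "\<alpha> \<in> borel_measurable borel" "\<beta> \<in> borel_measurable borel" "\<alpha>' \<in> borel_measurable borel" "\<beta>' \<in> borel_measurable borel"
        using test_funD[OF \<alpha>] test_funD[OF \<beta>] by auto
      \<comment> \<open>The test function \<open>t \<beta>(t)\<close> absorbs the extra factor
        \<open>t\<close> that accompanies \<beta>' in the \<open>e\<close>-derivative.\<close>
      have t\<beta>: "test_fun (-3) 3 (\<lambda>t. t * \<beta> t) (\<lambda>t. 1 * \<beta> t + t * \<beta>' t)"
        by (rule test_fun_mult[OF \<beta>]) (auto intro!: derivative_eq_intros)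
      have i: "integrable lborel (\<lambda>t. g1 t * \<beta> t)" "integrable lborel (\<lambda>t. p t * (t * \<beta> t))"
        "integrable lborel (\<lambda>t. g1 t * (t * \<beta>' t))"
        using test_fun_integrable(1)[OF \<beta> g1_int] test_fun_integrable(1)[OF t\<beta> p_int]
          Bochner_Integration.integrable_diff[OF test_fun_integrable(2)[OF t\<beta> g1_int] test_fun_integrable(1)[OF \<beta> g1_int]]
        by (simp_all add: algebra_simps)
      have "(LBINT t. g1 t * (1 * \<beta> t + t * \<beta>' t)) = - (LBINT t. p t * (t * \<beta> t))"
        by (rule weak_p[OF t\<beta>])
      then have w: "(LBINT t. g1 t * (t * \<beta>' t)) = - (LBINT t. p t * (t * \<beta> t)) - (LBINT t. g1 t * \<beta> t)"
        using i by (simp add: distrib_left)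
      have 1: "set_integrable lborel coord_rect (\<lambda>z. (fst z)\<^sup>2 * \<alpha>' (fst z) * (g1 (snd z) * \<beta> (snd z)))"
         "(LBINT z:coord_rect. (fst z)\<^sup>2 * \<alpha>' (fst z) * (g1 (snd z) * \<beta> (snd z))) = (LBINT r. r\<^sup>2 * \<alpha>' r) * (LBINT t. g1 t * \<beta> t)"
        by (rule rect_integral_separated[of "\<lambda>r. r\<^sup>2 * \<alpha>' r" "\<lambda>t. g1 t * \<beta> t" "\<lambda>z. (fst z)\<^sup>2 * \<alpha>' (fst z) * (g1 (snd z) * \<beta> (snd z))", OF test_fun_integrable(2)[OF \<alpha> set_integrable_coord_const(2)] _ i(1)];
            use test_funD(5)[OF \<alpha>] test_funD(4)[OF \<beta>] in \<open>simp add: mult_ac\<close>)+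
      have 2: "set_integrable lborel coord_rect (\<lambda>z. fst z * \<alpha> (fst z) * (g1 (snd z) * (snd z * \<beta>' (snd z))))"
         "(LBINT z:coord_rect. fst z * \<alpha> (fst z) * (g1 (snd z) * (snd z * \<beta>' (snd z)))) = (LBINT r. r * \<alpha> r) * (LBINT t. g1 t * (t * \<beta>' t))"
        by (rule rect_integral_separated[of "\<lambda>r. r * \<alpha> r" "\<lambda>t. g1 t * (t * \<beta>' t)" "\<lambda>z. fst z * \<alpha> (fst z) * (g1 (snd z) * (snd z * \<beta>' (snd z)))", OF test_fun_integrable(1)[OF \<alpha> set_integrable_coord_const(1)] _ i(3)];
            use test_funD(4)[OF \<alpha>] test_funD(5)[OF \<beta>] in \<open>simp add: mult_ac\<close>)+
      have "(LBINT z:coord_rect. fst z * U z * (\<alpha>' (fst z) * \<beta> (snd z) - \<alpha> (fst z) * \<beta>' (snd z) * snd z / fst z))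
        = (LBINT z:coord_rect. (fst z)\<^sup>2 * \<alpha>' (fst z) * (g1 (snd z) * \<beta> (snd z)) - fst z * \<alpha> (fst z) * (g1 (snd z) * (snd z * \<beta>' (snd z))))"
      proof (rule set_lebesgue_integral_cong_AE)
        show "AE z\<in>coord_rect in lborel. fst z * U z * (\<alpha>' (fst z) * \<beta> (snd z) - \<alpha> (fst z) * \<beta>' (snd z) * snd z / fst z)
          = (fst z)\<^sup>2 * \<alpha>' (fst z) * (g1 (snd z) * \<beta> (snd z)) - fst z * \<alpha> (fst z) * (g1 (snd z) * (snd z * \<beta>' (snd z)))"
          using U1 by eventually_elim (auto simp: field_simps power2_eq_square)
      qed auto
      also have "\<dots> = (LBINT r. r\<^sup>2 * \<alpha>' r) * (LBINT t. g1 t * \<beta> t) - (LBINT r. r * \<alpha> r) * (LBINT t. g1 t * (t * \<beta>' t))"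
        using set_integral_diff(2)[OF 1(1) 2(1)] 1(2) 2(2) by simp
      also have "\<dots> = - ((LBINT r. r * \<alpha> r) * ((LBINT t. g1 t * \<beta> t) - (LBINT t. p t * (t * \<beta> t))))"
        unfolding integral_test_times_square[OF \<alpha>] w by (simp add: algebra_simps)
      also have "(LBINT t. g1 t * \<beta> t) - (LBINT t. p t * (t * \<beta> t)) = (LBINT t. (g1 t - t * p t) * \<beta> t)"
        using i by (simp add: algebra_simps flip: Bochner_Integration.integral_diff)
      finally show ?thesis using W2[OF \<alpha> \<beta>] by simp
    qed
  qed
  have "AE z\<in>coord_rect in lborel. N z = p (snd z) \<and> E z = g (snd z) - snd z * p (snd z)"
    using N E AE_snd[OF g1] by eventually_elim auto
  moreover have "AE t\<in>{-3<..<3} in lborel. g t = c + (LBINT s:{-3<..<t}. p s)"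
    using c g1 by eventually_elim auto
  ultimately show ?thesis using p_meas p_int by blast
qed

lemma integrable_lebesgue_on_subset_borel:
  fixes f :: "'a::euclidean_space \<Rightarrow> 'b::euclidean_space"
  assumes "integrable (lebesgue_on T) f" "S \<subseteq> T" "S \<in> sets borel" "T \<in> sets borel"
  shows "integrable (lebesgue_on S) f"
proof -
  have iT: "integrable lebesgue (\<lambda>x. indicator T x *\<^sub>R f x)"
    using assms(1,4) integrable_restrict_space[of T lebesgue f] by simp
  have "integrable lebesgue (\<lambda>x. indicator S x *\<^sub>R (indicator T x *\<^sub>R f x))"
    by (rule integrable_mult_indicator[OF _ iT]) (use assms(3) in simp)
  also have "(\<lambda>x. indicator S x *\<^sub>R (indicator T x *\<^sub>R f x)) = (\<lambda>x. indicator S x *\<^sub>R f x)"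
    using assms(2) by (auto simp: indicator_def fun_eq_iff)
  finally show ?thesis
    using assms(3) integrable_restrict_space[of S lebesgue f] by simp
qed

context coordinate_frame
begin

lemma wedge_subset_ball: "wedge \<subseteq> ball 0 1"
  using norm_le_if_in_wedge by (fastforce simp: wedge_def)

lemma integrable_sector_if_L1_loc:
  fixes f :: "real^2 \<Rightarrow> 'b::euclidean_space"
  assumes "f \<in> L1_loc (ball 0 1)"
  shows "integrable (lebesgue_on sector) f"
proof (rule integrable_lebesgue_on_subset_borel[OF _ sector_subset_wedge])
  show "integrable (lebesgue_on wedge) f"
    using assms compact_wedge wedge_subset_ball by (simp add: L1_loc_def)
qed (use open_sector closed_wedge in auto)

text \<open>The function \<open>f\<close> with \<open>u (ray r t) = r f(t)\<close>, read off at
  radius \<open>1/8\<close>, the middle of the radial range; the factor 8 undoes this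
  radius.\<close>

definition profile :: "(real^2 \<Rightarrow> real^'m) \<Rightarrow> real \<Rightarrow> real^'m" where
  "profile u t = 8 *\<^sub>R u (ray (1/8) t)"

lemma one_homogeneous_profile:
  assumes hom: "one_homogeneous_on (ball 0 1) u" and "\<bar>t\<bar> < 3" "r > 0" "ray r t \<in> ball 0 1"
  shows "u (ray r t) = r *\<^sub>R profile u t"
proof -
  have "(8 * r) *\<^sub>R ray (1/8) t = ray r t" by (simp add: ray_def)
  moreover have "ray (1/8) t \<in> ball 0 1" by (rule ray_in_ball) (use assms in auto)
  ultimately show ?thesis
    using hom assms unfolding one_homogeneous_on_def profile_def
    by (metis less_eq_real_def mult.commute mult_nonneg_nonneg scaleR_scaleR zero_le_numeral)
qed

lemma gradient_structure:
  fixes u :: "real^2 \<Rightarrow> real^'m" and Du :: "real^2 \<Rightarrow> real^2^'m"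
  assumes wg: "weak_gradient (ball 0 1) u Du" and hom: "one_homogeneous_on (ball 0 1) u"
  obtains c p where "p \<in> borel_measurable borel" "\<And>k. set_integrable lborel {-3<..<3} (\<lambda>t. p t $ k)"
    "\<And>k. AE t\<in>{-3<..<3} in lborel. profile u t $ k = c $ k + (LBINT s:{-3<..<t}. p s $ k)"
    "AE z\<in>coord_rect in lborel. Du (ray (fst z) (snd z)) *v n = p (snd z) \<and>
       Du (ray (fst z) (snd z)) *v e = profile u (snd z) - snd z *\<^sub>R p (snd z)"
proof -
  have iu: "integrable (lebesgue_on sector) u" and iD: "integrable (lebesgue_on sector) Du"
    using wg by (auto simp: weak_gradient_def intro: integrable_sector_if_L1_loc)
  define P where "P k c p \<longleftrightarrow> p \<in> borel_measurable borel \<and> set_integrable lborel {-3<..<3} p \<and>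
    (AE t\<in>{-3<..<3} in lborel. profile u t $ k = c + (LBINT s:{-3<..<t}. p s)) \<and>
    (AE z\<in>coord_rect in lborel. (Du (ray (fst z) (snd z)) *v n) $ k = p (snd z) \<and>
       (Du (ray (fst z) (snd z)) *v e) $ k = profile u (snd z) $ k - snd z * p (snd z))" for k c p
  have "\<exists>c p. P k c p" for k
  proof -
    have bl: "bounded_linear (\<lambda>M::real^2^'m. (M *v h) $ k)" for h
      by (intro bounded_linear_compose[OF bounded_linear_vec_nth] bounded_bilinear.bounded_linear_left[OF bounded_bilinear_matrix_vector])
    have i: "integrable (lebesgue_on sector) (\<lambda>x. u x $ k)" "integrable (lebesgue_on sector) (\<lambda>x. (Du x *v n) $ k)"
       "integrable (lebesgue_on sector) (\<lambda>x. (Du x *v e) $ k)"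
      using integrable_bounded_linear[OF bounded_linear_vec_nth iu] integrable_bounded_linear[OF bl iD] by auto
    obtain U where U: "U \<in> borel_measurable borel" "set_integrable lborel coord_rect (\<lambda>z. fst z * U z)"
      "AE z\<in>coord_rect in lborel. u (ray (fst z) (snd z)) $ k = U z"
      "\<And>g. g \<in> borel_measurable borel \<Longrightarrow> (\<And>x. x \<notin> sector \<Longrightarrow> g x = 0) \<Longrightarrow>
       (\<integral>x. u x $ k * g x \<partial>(lebesgue_on (ball 0 1))) = (LBINT z:coord_rect. fst z * U z * g (ray (fst z) (snd z)))"
      apply (rule coord_representative[OF i(1)]) subgoal premises prems by (rule prems(1); fact prems) done
    obtain N where N: "N \<in> borel_measurable borel" "set_integrable lborel coord_rect (\<lambda>z. fst z * N z)"
      "AE z\<in>coord_rect in lborel. (Du (ray (fst z) (snd z)) *v n) $ k = N z"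
      "\<And>g. g \<in> borel_measurable borel \<Longrightarrow> (\<And>x. x \<notin> sector \<Longrightarrow> g x = 0) \<Longrightarrow>
       (\<integral>x. (Du x *v n) $ k * g x \<partial>(lebesgue_on (ball 0 1))) = (LBINT z:coord_rect. fst z * N z * g (ray (fst z) (snd z)))"
      apply (rule coord_representative[OF i(2)]) subgoal premises prems by (rule prems(1); fact prems) done
    obtain E where E: "E \<in> borel_measurable borel" "set_integrable lborel coord_rect (\<lambda>z. fst z * E z)"
      "AE z\<in>coord_rect in lborel. (Du (ray (fst z) (snd z)) *v e) $ k = E z"
      "\<And>g. g \<in> borel_measurable borel \<Longrightarrow> (\<And>x. x \<notin> sector \<Longrightarrow> g x = 0) \<Longrightarrow>
       (\<integral>x. (Du x *v e) $ k * g x \<partial>(lebesgue_on (ball 0 1))) = (LBINT z:coord_rect. fst z * E z * g (ray (fst z) (snd z)))"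
      apply (rule coord_representative[OF i(3)]) subgoal premises prems by (rule prems(1); fact prems) done
    have weak: "(\<integral>x. u x $ k * frechet_derivative (cone_test \<alpha> \<beta>) (at x) h \<partial>(lebesgue_on (ball 0 1))) =
        - (\<integral>x. (Du x *v h) $ k * cone_test \<alpha> \<beta> x \<partial>(lebesgue_on (ball 0 1)))"
      if \<alpha>: "test_fun 0 (1/4) \<alpha> \<alpha>'" and \<beta>: "test_fun (-3) 3 \<beta> \<beta>'" and h: "h = e \<or> h = n" for \<alpha> \<alpha>' \<beta> \<beta>' h
    proof -
      have C: "cone_test \<alpha> \<beta> \<in> C1c (ball 0 1)" using cone_test_in_C1c[OF \<alpha> \<beta>, of "1::real"] by simp
      have ax: "(\<integral>x. u x $ k * frechet_derivative (cone_test \<alpha> \<beta>) (at x) (axis q 1) \<partial>(lebesgue_on (ball 0 1))) =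
        - (\<integral>x. (Du x *v axis q 1) $ k * cone_test \<alpha> \<beta> x \<partial>(lebesgue_on (ball 0 1)))" for q
        using wg C by (simp add: weak_gradient_def matrix_vector_mult_basis column_def)
      have lin: "linear (frechet_derivative (cone_test \<alpha> \<beta>) (at x))" for x
        using has_derivative_cone_test[OF \<alpha> \<beta>] linear_frechet_derivative differentiable_def by blast
      \<comment> \<open>Weak derivatives are given along positive axis vectors, whereas
        \<open>e\<close> may be a negative one.\<close>
      have nax: "(\<integral>x. u x $ k * frechet_derivative (cone_test \<alpha> \<beta>) (at x) (- axis q 1) \<partial>(lebesgue_on (ball 0 1))) =
        - (\<integral>x. (Du x *v (- axis q 1)) $ k * cone_test \<alpha> \<beta> x \<partial>(lebesgue_on (ball 0 1)))" for q
        using ax[of q] by (simp add: linear_neg[OF lin] linear_neg[OF matrix_vector_mul_linear])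
      obtain q where "h = axis q 1 \<or> h = - axis q 1" using frame h by blast
      then show ?thesis using ax[of q] nax[of q] by (elim disjE) simp_all
    qed
    have "AE z\<in>coord_rect in lborel. U z = fst z * profile u (snd z) $ k"
      using U(3)
    proof eventually_elim
      case (elim z)
      have "u (ray (fst z) (snd z)) = fst z *\<^sub>R profile u (snd z)" if "z \<in> coord_rect"
        using that by (intro one_homogeneous_profile[OF hom] ray_in_ball) auto
      then show ?case using elim by auto
    qed
    moreover have "(LBINT z:coord_rect. fst z * U z * (\<alpha> (fst z) * \<beta>' (snd z) / fst z)) =
      - (LBINT z:coord_rect. fst z * N z * (\<alpha> (fst z) * \<beta> (snd z)))"
      "(LBINT z:coord_rect. fst z * U z * (\<alpha>' (fst z) * \<beta> (snd z) - \<alpha> (fst z) * \<beta>' (snd z) * snd z / fst z)) =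
      - (LBINT z:coord_rect. fst z * E z * (\<alpha> (fst z) * \<beta> (snd z)))"
      if \<alpha>: "test_fun 0 (1/4) \<alpha> \<alpha>'" and \<beta>: "test_fun (-3) 3 \<beta> \<beta>'" for \<alpha> \<alpha>' \<beta> \<beta>'
    proof -
      have m: "cone_test_n \<alpha> \<beta>' \<in> borel_measurable borel" "cone_test_e \<alpha> \<alpha>' \<beta> \<beta>' \<in> borel_measurable borel" "cone_test \<alpha> \<beta> \<in> borel_measurable borel"
        using continuous_cone_test_deriv[OF \<alpha> \<beta>] has_derivative_cone_test[OF \<alpha> \<beta>]
        by (auto intro!: borel_measurable_continuous_onI continuous_at_imp_continuous_on has_derivative_continuous)
      note z = cone_test_outside_sector[OF \<alpha> \<beta>]
      have cg: "(LBINT z:coord_rect. fst z * W z * g (ray (fst z) (snd z))) = (LBINT z:coord_rect. fst z * W z * g' z)"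
        if "\<And>z. fst z > 0 \<Longrightarrow> g (ray (fst z) (snd z)) = g' z" for g g' and W :: "real \<times> real \<Rightarrow> real"
        unfolding set_lebesgue_integral_def
        using that by (intro Bochner_Integration.integral_cong) (auto simp: indicator_def)
      note fd = frechet_derivative_cone_test[OF \<alpha> \<beta>]
      note EQ = cg[of "cone_test_n \<alpha> \<beta>'" "\<lambda>z. \<alpha> (fst z) * \<beta>' (snd z) / fst z", OF cone_test_ray(3)]
         cg[of "cone_test_e \<alpha> \<alpha>' \<beta> \<beta>'" "\<lambda>z. \<alpha>' (fst z) * \<beta> (snd z) - \<alpha> (fst z) * \<beta>' (snd z) * snd z / fst z", OF cone_test_ray(2)]
         cg[of "cone_test \<alpha> \<beta>" "\<lambda>z. \<alpha> (fst z) * \<beta> (snd z)", OF cone_test_ray(1)]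
      show "(LBINT z:coord_rect. fst z * U z * (\<alpha> (fst z) * \<beta>' (snd z) / fst z)) =
          - (LBINT z:coord_rect. fst z * N z * (\<alpha> (fst z) * \<beta> (snd z)))"
        using weak[OF \<alpha> \<beta>, of n] U(4)[OF m(1) z(3)] N(4)[OF m(3) z(1)] by (simp add: fd inner_frame EQ)
      show "(LBINT z:coord_rect. fst z * U z * (\<alpha>' (fst z) * \<beta> (snd z) - \<alpha> (fst z) * \<beta>' (snd z) * snd z / fst z)) =
          - (LBINT z:coord_rect. fst z * E z * (\<alpha> (fst z) * \<beta> (snd z)))"
        using weak[OF \<alpha> \<beta>, of e] U(4)[OF m(2) z(2)] E(4)[OF m(3) z(1)] by (simp add: fd inner_frame EQ)
    qed
    ultimately obtain c p where cp: "p \<in> borel_measurable borel" "set_integrable lborel {-3<..<3} p"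
      "AE t\<in>{-3<..<3} in lborel. profile u t $ k = c + (LBINT s:{-3<..<t}. p s)"
      "AE z\<in>coord_rect in lborel. N z = p (snd z) \<and> E z = profile u (snd z) $ k - snd z * p (snd z)"
      using gradient_structure_scalar[OF U(1) N(1) E(1) U(2) N(2) E(2), of "\<lambda>t. profile u t $ k"] by blast
    have "AE z\<in>coord_rect in lborel. (Du (ray (fst z) (snd z)) *v n) $ k = p (snd z) \<and>
       (Du (ray (fst z) (snd z)) *v e) $ k = profile u (snd z) $ k - snd z * p (snd z)"
      using cp(4) N(3) E(3) by eventually_elim auto
    with cp(1-3) have "P k c p" unfolding P_def by (intro conjI)
    then show ?thesis by (intro exI)
  qed
  then obtain c p where "\<And>k. P k (c k) (p k)" by metis
  then have cp: "\<And>k. p k \<in> borel_measurable borel" "\<And>k. set_integrable lborel {-3<..<3} (p k)"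
      "\<And>k. AE t\<in>{-3<..<3} in lborel. profile u t $ k = c k + (LBINT s:{-3<..<t}. p k s)"
      "\<And>k. AE z\<in>coord_rect in lborel. (Du (ray (fst z) (snd z)) *v n) $ k = p k (snd z) \<and>
       (Du (ray (fst z) (snd z)) *v e) $ k = profile u (snd z) $ k - snd z * p k (snd z)"
    unfolding P_def by blast+
  show ?thesis
  proof (rule that[of "\<lambda>t. \<chi> k. p k t" "\<chi> k. c k"])
    show "(\<lambda>t. \<chi> k. p k t) \<in> borel_measurable borel"
      using cp(1) by (subst borel_measurable_euclidean_space) (auto simp: Basis_vec_def inner_axis)
    have "AE z in lborel. \<forall>k. z \<in> coord_rect \<longrightarrow> (Du (ray (fst z) (snd z)) *v n) $ k = p k (snd z) \<and>
       (Du (ray (fst z) (snd z)) *v e) $ k = profile u (snd z) $ k - snd z * p k (snd z)"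
      using cp(4) by (subst AE_all_countable) auto
    then show "AE z\<in>coord_rect in lborel. Du (ray (fst z) (snd z)) *v n = (\<chi> k. p k (snd z)) \<and>
       Du (ray (fst z) (snd z)) *v e = profile u (snd z) - snd z *\<^sub>R (\<chi> k. p k (snd z))"
      by eventually_elim (auto simp: vec_eq_iff)
  qed (use cp in auto)
qed

end

section \<open>Continuity of the gradient\<close>

lemma continuous_on_indefinite_LBINT:
  fixes f :: "real \<Rightarrow> real"
  assumes "set_integrable lborel {a<..<b} f"
  shows "continuous_on {a<..<b} (\<lambda>t. \<integral>s\<in>{a<..<t}. f s \<partial>lborel)"
proof -
  have "f integrable_on {a<..<b}" using set_borel_integral_eq_integral(1)[OF assms] .
  then have "f integrable_on {a..b}" using integrable_on_open_interval_real[of f a b] by simp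
  then have "continuous_on {a..b} (\<lambda>t. integral {a..t} f)" by (rule indefinite_integral_continuous_1)
  then have c: "continuous_on {a<..<b} (\<lambda>t. integral {a..t} f)" by (rule continuous_on_subset) auto
  have eq: "(LBINT s:{a<..<t}. f s) = integral {a..t} f" if "t \<in> {a<..<b}" for t
  proof -
    have "set_integrable lborel {a<..<t} f" by (rule set_integrable_subset[OF assms]) (use that in auto)
    then have "(LBINT s:{a<..<t}. f s) = integral {a<..<t} f" by (rule set_borel_integral_eq_integral(2))
    then show ?thesis by (simp add: integral_open_interval_real)
  qed
  show ?thesis by (rule continuous_on_eq[OF c]) (simp add: eq)
qed

lemma continuous_AE_eq_imp_eq:
  fixes f g :: "real \<Rightarrow> 'a::real_normed_vector"
  assumes "continuous_on {a<..<b} f" "continuous_on {a<..<b} g"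
    and ae: "AE x\<in>{a<..<b} in lborel. f x = g x" and x: "x \<in> {a<..<b}"
  shows "f x = g x"
proof (rule ccontr)
  assume ne: "f x \<noteq> g x"
  have "continuous_on {a<..<b} (\<lambda>x. norm (f x - g x))" using assms(1,2) by (intro continuous_intros)
  then have "isCont (\<lambda>x. norm (f x - g x)) x" using x by (simp add: continuous_on_eq_continuous_at)
  then have "\<forall>\<^sub>F y in nhds x. norm (f y - g y) > 0"
    using ne tendsto_at_iff_tendsto_nhds[of "\<lambda>x. norm (f x - g x)" x]
    by (intro order_tendstoD(1)[of _ "norm (f x - g x)"]) (auto simp: isCont_def)
  moreover have "\<forall>\<^sub>F y in nhds x. y \<in> {a<..<b}" using x by (intro eventually_nhds_in_open) auto
  ultimately have "\<forall>\<^sub>F y in nhds x. y \<in> {a<..<b} \<and> f y \<noteq> g y" by eventually_elim auto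
  then obtain d where d: "d > 0" "\<And>y. dist y x < d \<Longrightarrow> y \<in> {a<..<b} \<and> f y \<noteq> g y"
    unfolding eventually_nhds_metric by blast
  have "x - d < x + d" using d(1) by simp
  from AE_exists_in_interval[OF ae this] obtain y where "y \<in> {x - d<..<x + d}" "y \<in> {a<..<b} \<longrightarrow> f y = g y"
    by blast
  then show False using d(2)[of y] by (auto simp: dist_real_def abs_less_iff)
qed

text \<open>Two intervals occur because the profile is an indefinite integral for slopes up to 3,
  while its integrand acquires a continuous version for slopes below 2 only.\<close>

lemma has_derivative_if_AE_eq_indefinite:
  fixes f :: "real \<Rightarrow> real"
  assumes f: "continuous_on {a<..<b} f" and q: "continuous_on {l<..<m} q" and sub: "a \<le> l" "m \<le> b"
    and p: "set_integrable lborel {a<..<b} p" and pq: "AE x\<in>{l<..<m} in lborel. p x = q x"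
    and ae: "AE x\<in>{a<..<b} in lborel. f x = c + (LBINT s:{a<..<x}. p s)"
    and x: "x \<in> {l<..<m}"
  shows "(f has_real_derivative q x) (at x)"
proof -
  have eq: "f y = c + (LBINT s:{a<..<y}. p s)" if "y \<in> {a<..<b}" for y
    by (rule continuous_AE_eq_imp_eq[OF f _ ae that]) (intro continuous_intros continuous_on_indefinite_LBINT p)
  define a' b' where "a' = (l + x) / 2" and "b' = (x + m) / 2"
  have lm: "l < a'" "a' < x" "x < b'" "b' < m" using x by (auto simp: a'_def b'_def field_simps)
  then have ab: "a < a'" "a' < x" "x < b'" "b' < b" using sub by auto
  have "continuous_on {a'..b'} q" by (rule continuous_on_subset[OF q]) (use lm in auto)
  then have "((\<lambda>y. integral {a'..y} q) has_real_derivative q x) (at x within {a'..b'})"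
    using ab by (intro integral_has_real_derivative) auto
  then have D: "((\<lambda>y. f a' + integral {a'..y} q) has_real_derivative q x) (at x)"
    using ab by (subst (asm) at_within_Icc_at) (auto intro!: derivative_eq_intros)
  show ?thesis
  proof (rule has_field_derivative_transform_within_open[OF D, of "{a'<..<b'}"])
    fix y assume y: "y \<in> {a'<..<b'}"
    have 1: "set_integrable lborel {a<..<a'} p" "set_integrable lborel {a'<..<y} p" "set_integrable lborel {a'..<y} p"
      by (rule set_integrable_subset[OF p], use ab y in auto)+
    have "(LBINT s:{a<..<y}. p s) = (\<integral>s\<in>{a<..<a'} \<union> {a'..<y}. p s \<partial>lborel)"
      using ab y by (intro arg_cong[where f = "\<lambda>S. set_lebesgue_integral lborel S p"]) auto
    also have "\<dots> = (LBINT s:{a<..<a'}. p s) + (LBINT s:{a'..<y}. p s)"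
      by (rule set_integral_Un) (use 1 in auto)
    also have "(LBINT s:{a'..<y}. p s) = (LBINT s:{a'..y}. q s)"
      unfolding set_lebesgue_integral_def
    proof (rule integral_cong_AE)
      show "(\<lambda>s. indicator {a'..<y} s *\<^sub>R p s) \<in> borel_measurable lborel" using 1(3) by (auto simp: set_integrable_def)
      have "set_integrable lborel {a'..y} q"
        by (rule borel_integrable_atLeastAtMost', rule continuous_on_subset[OF q]) (use lm y in auto)
      then show "(\<lambda>s. indicator {a'..y} s *\<^sub>R q s) \<in> borel_measurable lborel" by (auto simp: set_integrable_def)
      show "AE s in lborel. indicator {a'..<y} s *\<^sub>R p s = indicator {a'..y} s *\<^sub>R q s"
        using pq AE_lborel_singleton[of y] by eventually_elim (use lm y in \<open>auto simp: indicator_def\<close>)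
    qed
    also have "\<dots> = integral {a'..y} q"
      by (rule set_borel_integral_eq_integral(2), rule borel_integrable_atLeastAtMost', rule continuous_on_subset[OF q]) (use lm y in auto)
    finally show "f a' + integral {a'..y} q = f y"
      using eq[of y] eq[of a'] ab y by auto
  qed (use ab in auto)
qed

lemma du_bois_reymond_continuous:
  fixes f q :: "real \<Rightarrow> real"
  assumes f: "continuous_on {a..b} f" and q: "continuous_on {a..b} q"
    and tests: "\<And>\<beta> \<beta>'. test_fun a b \<beta> \<beta>' \<Longrightarrow> (LBINT x. f x * \<beta>' x) = - (LBINT x. q x * \<beta> x)"
    and x: "x \<in> {a<..<b}"
  shows "(f has_real_derivative q x) (at x)"
proof -
  have i: "set_integrable lborel {a<..<b} f" "set_integrable lborel {a<..<b} q"
    by (rule set_integrable_subset[OF borel_integrable_atLeastAtMost'], use f q in auto)+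
  obtain c where c: "AE x\<in>{a<..<b} in lborel. f x = c + (LBINT s:{a<..<x}. q s)"
    using du_bois_reymond[OF _ i tests] x by auto
  show ?thesis
    by (rule has_derivative_if_AE_eq_indefinite[OF _ _ order_refl order_refl i(2) _ c x])
       (use f q in \<open>auto intro: continuous_on_subset\<close>)
qed

text \<open>
  Along a sequence of good points converging to \<open>t\<close>, coercivity keeps \<open>p\<close> bounded, so that the
  equation \<open>H t q = W t\<close> has a solution at every \<open>t\<close>; by monotonicity it is unique and continuous.
\<close>
lemma continuous_solution_of_monotone_equation:
  fixes H :: "real \<Rightarrow> 'a::euclidean_space \<Rightarrow> 'a"
  assumes H: "continuous_on ({a<..<b} \<times> UNIV) (\<lambda>(t, q). H t q)" and W: "continuous_on {a<..<b} W"
    and mono: "\<And>t q q'. t \<in> {a<..<b} \<Longrightarrow> \<kappa> * (norm (q - q'))\<^sup>2 \<le> (H t q - H t q') \<bullet> (q - q')" and "\<kappa> > 0"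
    and ae: "AE t\<in>{a<..<b} in lborel. H t (p t) = W t"
  obtains p' where "continuous_on {a<..<b} p'" "AE t\<in>{a<..<b} in lborel. p t = p' t"
proof -
  \<comment> \<open>By Cauchy-Schwarz each \<open>H t\<close> is injective with a Lipschitz inverse,
    uniformly in \<open>t\<close>. Boundedness along the sequence, uniqueness and continuity of the
    solution all come from this bound.\<close>
  have mono': "\<kappa> * norm (q - q') \<le> norm (H t q - H t q')" if "t \<in> {a<..<b}" for t q q'
  proof (cases "q = q'")
    case False
    have "\<kappa> * norm (q - q') * norm (q - q') \<le> norm (H t q - H t q') * norm (q - q')"
      using mono[OF that, of q q'] norm_cauchy_schwarz[of "H t q - H t q'" "q - q'"] by (simp add: power2_eq_square)
    then show ?thesis using False by simp
  qed simp
  have op: "open ({a<..<b} \<times> (UNIV :: 'a set))" by (intro open_Times) auto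
  have cH: "isCont (\<lambda>(t, q). H t q) (t, q)" if "t \<in> {a<..<b}" for t q
    using H op that by (simp add: continuous_on_eq_continuous_at)
  have cW: "isCont W t" if "t \<in> {a<..<b}" for t
    using W that by (simp add: continuous_on_eq_continuous_at)
  have lim: "(\<lambda>k. H (t k) (q k)) \<longlonglongrightarrow> H t0 q0" if "t \<longlonglongrightarrow> t0" "q \<longlonglongrightarrow> q0" "t0 \<in> {a<..<b}" for t q t0 q0
    using isCont_tendsto_compose[OF cH[OF that(3), of q0] tendsto_Pair[OF that(1,2)]] by simp
  have "\<exists>q. H t q = W t" if t: "t \<in> {a<..<b}" for t
  proof -
    have "\<exists>s. s \<in> {max a (t - 1 / Suc k)<..<min b (t + 1 / Suc k)} \<and> (s \<in> {a<..<b} \<longrightarrow> H s (p s) = W s)" for k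
    proof -
      have m: "max a (t - \<delta>) < min b (t + \<delta>)" if "\<delta> > 0" for \<delta> using t that by auto
      have "max a (t - 1 / Suc k) < min b (t + 1 / Suc k)" by (rule m) simp
      from AE_exists_in_interval[OF ae this] show ?thesis by blast
    qed
    then obtain s where s: "\<And>k. s k \<in> {max a (t - 1 / Suc k)<..<min b (t + 1 / Suc k)}" "\<And>k. s k \<in> {a<..<b} \<longrightarrow> H (s k) (p (s k)) = W (s k)"
      by metis
    then have sab: "s k \<in> {a<..<b}" for k using s(1)[of k] by auto
    have "s \<longlonglongrightarrow> t"
    proof (rule LIMSEQ_I)
      fix r :: real assume "r > 0"
      then obtain K where K: "inverse (real (Suc K)) < r" using reals_Archimedean by blast
      have "norm (s k - t) < r" if "k \<ge> K" for k
      proof -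
        have "1 / real (Suc k) \<le> 1 / real (Suc K)" using that by (simp add: field_simps)
        then show ?thesis using s(1)[of k] K by (auto simp: abs_less_iff inverse_eq_divide)
      qed
      then show "\<exists>no. \<forall>k\<ge>no. norm (s k - t) < r" by blast
    qed
    have "(\<lambda>k. norm (H (s k) 0) + norm (W (s k))) \<longlonglongrightarrow> norm (H t 0) + norm (W t)"
    proof (intro tendsto_add tendsto_norm)
      show "(\<lambda>k. H (s k) 0) \<longlonglongrightarrow> H t 0" using lim[of s t "\<lambda>_. 0" 0] \<open>s \<longlonglongrightarrow> t\<close> t by simp
      show "(\<lambda>k. W (s k)) \<longlonglongrightarrow> W t" by (rule isCont_tendsto_compose[OF cW[OF t] \<open>s \<longlonglongrightarrow> t\<close>])
    qed
    then have "Bseq (\<lambda>k. norm (H (s k) 0) + norm (W (s k)))" by (intro convergent_imp_Bseq convergentI)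
    then obtain M where M: "\<And>k. norm (norm (H (s k) 0) + norm (W (s k))) \<le> M"
      unfolding Bseq_def by blast
    have "norm (p (s k)) \<le> M / \<kappa>" for k
    proof -
      have "\<kappa> * norm (p (s k) - 0) \<le> norm (H (s k) (p (s k)) - H (s k) 0)" by (rule mono'[OF sab])
      also have "\<dots> \<le> norm (W (s k)) + norm (H (s k) 0)" using s(2)[of k] sab norm_triangle_ineq4[of "W (s k)"] by simp
      also have "\<dots> \<le> M" using M[of k] by simp
      finally show ?thesis using \<open>\<kappa> > 0\<close> by (simp add: field_simps)
    qed
    then have "bounded (range (\<lambda>k. p (s k)))" by (auto simp: bounded_iff)
    then obtain q \<sigma> where \<sigma>: "strict_mono \<sigma>" "((\<lambda>k. p (s k)) \<circ> \<sigma>) \<longlonglongrightarrow> q"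
      using bounded_imp_convergent_subsequence by blast
    have s\<sigma>: "(\<lambda>k. s (\<sigma> k)) \<longlonglongrightarrow> t" using LIMSEQ_subseq_LIMSEQ[OF \<open>s \<longlonglongrightarrow> t\<close> \<sigma>(1)] by (simp add: o_def)
    have "(\<lambda>k. W (s (\<sigma> k))) \<longlonglongrightarrow> H t q"
      using lim[OF s\<sigma>, of "\<lambda>k. p (s (\<sigma> k))" q] \<sigma>(2) t s(2) sab by (simp add: o_def)
    moreover have "(\<lambda>k. W (s (\<sigma> k))) \<longlonglongrightarrow> W t" by (rule isCont_tendsto_compose[OF cW[OF t] s\<sigma>])
    ultimately show ?thesis using LIMSEQ_unique by blast
  qed
  then obtain p' where p': "\<And>t. t \<in> {a<..<b} \<Longrightarrow> H t (p' t) = W t" by metis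
  show ?thesis
  proof (rule that[of p'])
    show "AE t\<in>{a<..<b} in lborel. p t = p' t"
      using ae
    proof eventually_elim
      case (elim t)
      show ?case
      proof
        assume t: "t \<in> {a<..<b}"
        then have "\<kappa> * norm (p t - p' t) \<le> 0" using mono'[OF t, of "p t" "p' t"] elim p'[OF t] by simp
        then show "p t = p' t" using \<open>\<kappa> > 0\<close> by (simp add: mult_le_0_iff)
      qed
    qed
    have "isCont p' t" if t: "t \<in> {a<..<b}" for t
    proof -
      have "((\<lambda>s. p' s - p' t) \<longlongrightarrow> 0) (at t)"
      proof (rule Lim_null_comparison)
        show "\<forall>\<^sub>F s in at t. norm (p' s - p' t) \<le> norm (W s - H s (p' t)) / \<kappa>"
        proof -
          have "\<forall>\<^sub>F s in at t. s \<in> {a<..<b}" using t by (intro eventually_at_in_open') auto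
          then show ?thesis
          proof eventually_elim
            case (elim s)
            show ?case using mono'[OF elim, of "p' s" "p' t"] p'[OF elim] \<open>\<kappa> > 0\<close> by (simp add: field_simps)
          qed
        qed
        have "((\<lambda>s. H s (p' t)) \<longlongrightarrow> H t (p' t)) (at t)"
        proof -
          have "((\<lambda>s. (s, p' t)) \<longlongrightarrow> (t, p' t)) (at t)" by (intro tendsto_intros)
          from isCont_tendsto_compose[OF cH[OF t, of "p' t"] this] show ?thesis by simp
        qed
        moreover have "(W \<longlongrightarrow> W t) (at t)" using cW[OF t] by (simp add: isCont_def)
        ultimately have "((\<lambda>s. norm (W s - H s (p' t)) / \<kappa>) \<longlongrightarrow> norm (W t - H t (p' t)) / \<kappa>) (at t)"
          by (intro tendsto_intros) (use \<open>\<kappa> > 0\<close> in auto)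
        then show "((\<lambda>s. norm (W s - H s (p' t)) / \<kappa>) \<longlongrightarrow> 0) (at t)" using p'[OF t] by simp
      qed
      then show ?thesis by (simp add: isCont_def LIM_zero_iff)
    qed
    then show "continuous_on {a<..<b} p'" by (intro continuous_at_imp_continuous_on) blast
  qed
qed

lemma integral_snd_mult:
  fixes k :: "real \<times> real \<Rightarrow> real"
  assumes k: "integrable lborel k" and m [measurable]: "\<beta> \<in> borel_measurable borel" and B: "\<And>t. \<bar>\<beta> t\<bar> \<le> B"
  shows "integrable lborel (\<lambda>z. \<beta> (snd z) * k z)" "integrable lborel (\<lambda>t. \<integral>r. k (r, t) \<partial>lborel)"
    "(LBINT z. \<beta> (snd z) * k z) = (LBINT t. (LBINT r. k (r, t)) * \<beta> t)"
proof -
  have [measurable]: "k \<in> borel_measurable borel" using k by auto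
  show i: "integrable lborel (\<lambda>z. \<beta> (snd z) * k z)"
  proof (rule Bochner_Integration.integrable_bound)
    show "integrable lborel (\<lambda>z. B * k z)" using k by simp
    show "AE z in lborel. norm (\<beta> (snd z) * k z) \<le> norm (B * k z)"
      by (rule AE_I2) (auto simp: abs_mult intro!: mult_right_mono order_trans[OF B])
  qed simp
  have kp: "integrable (lborel \<Otimes>\<^sub>M lborel) (\<lambda>(r, t). k (r, t))" using k by (simp add: lborel_prod)
  from lborel_pair.integrable_snd[OF this] show "integrable lborel (\<lambda>t. \<integral>r. k (r, t) \<partial>lborel)" by simp
  have ip: "integrable (lborel \<Otimes>\<^sub>M lborel) (\<lambda>(r, t). \<beta> t * k (r, t))"
    using i by (simp add: lborel_prod case_prod_unfold)
  have "(LBINT t. (LBINT r. \<beta> t * k (r, t))) = (LBINT z. \<beta> (snd z) * k z)"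
    using lborel_pair.integral_snd[OF ip] by (simp add: lborel_prod case_prod_unfold)
  then show "(LBINT z. \<beta> (snd z) * k z) = (LBINT t. (LBINT r. k (r, t)) * \<beta> t)"
    by (simp add: mult.commute)
qed

lemma matrix_eq_outer_frame:
  assumes "coordinate_frame e n"
  shows "M = outer (M *v e) e + outer (M *v n) n"
proof -
  interpret coordinate_frame e n by fact
  interpret matvec: bounded_bilinear "(*v) :: real^2^'m \<Rightarrow> real^2 \<Rightarrow> real^'m" by (rule bounded_bilinear_matrix_vector)
  have eq: "M *v x = (outer (M *v e) e + outer (M *v n) n) *v x" for x
  proof -
    have "M *v x = M *v ((x \<bullet> e) *\<^sub>R e + (x \<bullet> n) *\<^sub>R n)" using frame_expansion[of x] by simp
    also have "\<dots> = (outer (M *v e) e + outer (M *v n) n) *v x"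
      by (simp add: matvec.add_left matvec.add_right matvec.scaleR_right outer_mult_vec inner_commute)
    finally show ?thesis .
  qed
  show ?thesis by (rule matrix_eq[THEN iffD2]) (intro allI eq)
qed

lemma test_fun_mono:
  assumes "test_fun a b \<beta> \<beta>'" "a' \<le> a" "b \<le> b'"
  shows "test_fun a' b' \<beta> \<beta>'"
  using assms unfolding test_fun_def by (meson order.strict_trans1 order.strict_trans2)

section \<open>The weak system in ray coordinates\<close>

locale cone_problem = coordinate_frame e n + regular_elliptic A
  for e n :: "real^2" and A :: "real^2 \<Rightarrow> real^2^'m \<Rightarrow> real^2^'m" +
  fixes u :: "real^2 \<Rightarrow> real^'m" and Du :: "real^2 \<Rightarrow> real^2^'m"
  assumes gradient: "weak_gradient (ball 0 1) u Du"
    and homogeneous: "one_homogeneous_on (ball 0 1) u"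
    and solution: "distributionally_div_free (ball 0 1) (\<lambda>x. A x (Du x))"
    and partial_limit: "\<And>i. AE x in lebesgue_on (ball 0 1).
              ((\<lambda>R. R *\<^sub>R partial i (\<lambda>y. A y (Du x)) (R *\<^sub>R sgn x)) \<longlongrightarrow> 0) (at_right 0)"
begin

lemma ray_in_punctured_ball: "0 < r \<Longrightarrow> r < 1/4 \<Longrightarrow> \<bar>t\<bar> < 3 \<Longrightarrow> ray r t \<in> ball 0 1 - {0}"
  using ray_in_ball[of r t] ray_nonzero[of r t] by auto

text \<open>Set to zero outside the rectangle, where the ray may leave the punctured ball and
  nothing is known of \<open>A\<close>; this makes it Borel on the whole plane for every Borel
  \<open>F\<close>.\<close>

definition stress :: "(real \<Rightarrow> real^2^'m) \<Rightarrow> real \<times> real \<Rightarrow> real^2^'m" where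
  "stress F z = indicator coord_rect z *\<^sub>R A (ray (fst z) (snd z)) (F (snd z))"

lemma borel_measurable_stress:
  assumes [measurable]: "F \<in> borel_measurable borel"
  shows "stress F \<in> borel_measurable borel"
proof -
  let ?S = "(ball 0 1 - {0}) \<times> (UNIV :: (real^2^'m) set)"
  have "continuous_on ?S (\<lambda>(x, F). A x F)"
    using isCont_A by (intro continuous_at_imp_continuous_on) auto
  moreover have "?S \<in> sets borel" by (intro borel_open open_Times open_delete) auto
  ultimately have mA: "(\<lambda>p. indicator ?S p *\<^sub>R (case p of (x, F) \<Rightarrow> A x F)) \<in> borel_measurable borel"
    by (rule borel_measurable_continuous_on_indicator[rotated])
  have mr: "(\<lambda>z::real\<times>real. ray (fst z) (snd z)) \<in> borel_measurable borel"
    by (intro borel_measurable_continuous_onI continuous_intros)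
  have mF: "(\<lambda>z::real\<times>real. F (snd z)) \<in> borel_measurable borel"
    by measurable
  from measurable_compose[OF borel_measurable_Pair[OF mr mF] mA]
  have mB: "(\<lambda>z. indicator ?S (ray (fst z) (snd z), F (snd z)) *\<^sub>R A (ray (fst z) (snd z)) (F (snd z))) \<in> borel_measurable borel"
    by (simp only: prod.case)
  have mI: "(indicator coord_rect :: _ \<Rightarrow> real) \<in> borel_measurable borel"
    by (intro borel_measurable_indicator borel_open open_Times) auto
  from borel_measurable_scaleR[OF mI mB]
  have "(\<lambda>z. indicator coord_rect z *\<^sub>R (indicator ?S (ray (fst z) (snd z), F (snd z)) *\<^sub>R A (ray (fst z) (snd z)) (F (snd z)))) \<in> borel_measurable borel"
    .
  also have "(\<lambda>z. indicator coord_rect z *\<^sub>R (indicator ?S (ray (fst z) (snd z), F (snd z)) *\<^sub>R A (ray (fst z) (snd z)) (F (snd z)))) = stress F"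
  proof
    fix z
    show "indicator coord_rect z *\<^sub>R (indicator ?S (ray (fst z) (snd z), F (snd z)) *\<^sub>R A (ray (fst z) (snd z)) (F (snd z))) = stress F z"
      using ray_in_punctured_ball[of "fst z" "snd z"]
      by (cases "z \<in> coord_rect") (auto simp: stress_def mem_Times_iff)
  qed
  finally show ?thesis .
qed

lemma bounded_linear_inner_matrix_vector: "bounded_linear (\<lambda>M::real^2^'m. v \<bullet> (M *v h))"
  by (intro bounded_linear_compose[OF bounded_linear_inner_right] bounded_bilinear.bounded_linear_left[OF bounded_bilinear_matrix_vector])

lemma borel_measurable_inner_stress:
  assumes F: "F \<in> borel_measurable borel"
  shows "(\<lambda>z. v \<bullet> (stress F z *v h)) \<in> borel_measurable borel"
  using measurable_compose[OF borel_measurable_stress[OF F], of "\<lambda>M. v \<bullet> (M *v h)" borel]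
    borel_measurable_continuous_onI[OF linear_continuous_on[OF bounded_linear_inner_matrix_vector]] by auto

lemma inner_conormal:
  fixes M :: "real^2^'m"
  shows "v \<bullet> (M *v conormal t) = v \<bullet> (M *v n) - t * (v \<bullet> (M *v e))"
proof -
  interpret matvec: bounded_bilinear "(*v) :: real^2^'m \<Rightarrow> real^2 \<Rightarrow> real^'m" by (rule bounded_bilinear_matrix_vector)
  show ?thesis by (simp add: conormal_def matvec.diff_right matvec.scaleR_right inner_diff_right)
qed

text \<open>The system tested with a separated function times \<open>v\<close>, with the Jacobian
  included. The two terms with \<beta>' combine into a contraction with the conormal, and there the
  \<open>1/r\<close> of the slope derivative cancels the Jacobian.\<close>

lemma stress_identity:
  fixes v :: "real^'m"
  assumes F: "F \<in> borel_measurable borel" and DuF: "AE z\<in>coord_rect in lborel. Du (ray (fst z) (snd z)) = F (snd z)"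
    and \<alpha>: "test_fun 0 (1/4) \<alpha> \<alpha>'" and \<beta>: "test_fun (-3) 3 \<beta> \<beta>'"
  defines "k \<equiv> \<lambda>z. \<beta> (snd z) * (fst z * \<alpha>' (fst z) * (v \<bullet> (stress F z *v e)))
      + \<beta>' (snd z) * (\<alpha> (fst z) * (v \<bullet> (stress F z *v conormal (snd z))))"
  shows "integrable lborel k" "(LBINT z. k z) = 0"
proof -
  have [measurable]: "\<alpha> \<in> borel_measurable borel" "\<beta> \<in> borel_measurable borel" "\<alpha>' \<in> borel_measurable borel" "\<beta>' \<in> borel_measurable borel"
    using test_funD[OF \<alpha>] test_funD[OF \<beta>] by auto
  note [measurable] = borel_measurable_inner_stress[OF F]
  have [measurable]: "k \<in> borel_measurable borel" unfolding k_def inner_conormal by measurable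
  let ?w = "\<lambda>x. A x (Du x) \<bullet> jacobian (\<lambda>x. cone_test \<alpha> \<beta> x *\<^sub>R v) (at x)"
  have w: "integrable (lebesgue_on (ball 0 1)) ?w" "(\<integral>x. ?w x \<partial>(lebesgue_on (ball 0 1))) = 0"
    using solution cone_test_in_C1c[OF \<alpha> \<beta>, of v] by (auto simp: distributionally_div_free_def)
  have ws: "integrable (lebesgue_on sector) ?w"
    by (rule integrable_lebesgue_on_subset_borel[OF w(1) sector_subset_ball]) (use open_sector in auto)
  obtain W where W: "W \<in> borel_measurable borel" "set_integrable lborel coord_rect (\<lambda>z. fst z * W z)"
      "AE z\<in>coord_rect in lborel. ?w (ray (fst z) (snd z)) = W z"
      "\<And>g. g \<in> borel_measurable borel \<Longrightarrow> (\<And>x. x \<notin> sector \<Longrightarrow> g x = 0) \<Longrightarrow>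
       (\<integral>x. ?w x * g x \<partial>(lebesgue_on (ball 0 1))) = (LBINT z:coord_rect. fst z * W z * g (ray (fst z) (snd z)))"
    apply (rule coord_representative[OF ws]) subgoal premises prems by (rule prems(1); fact prems) done
  \<comment> \<open>The integrand vanishes outside the sector anyway, so the indicator of the sector
    may serve as the multiplier in the change of variables.\<close>
  have wz: "?w x * indicator sector x = ?w x" for x
    using inner_jacobian_cone_test[OF \<alpha> \<beta>, of "A x (Du x)" v x] cone_test_outside_sector[OF \<alpha> \<beta>, of x]
    by (cases "x \<in> sector") auto
  have k: "AE z in lborel. indicator coord_rect z *\<^sub>R (fst z * W z) = k z"
    using W(3) DuF
  proof eventually_elim
    case (elim z)
    show ?case
    proof (cases "z \<in> coord_rect")
      case True
      then have r: "fst z > 0" by auto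
      let ?x = "ray (fst z) (snd z)"
      have "W z = ?w ?x" using elim True by simp
      also have "\<dots> = (\<alpha>' (fst z) * \<beta> (snd z) - \<alpha> (fst z) * \<beta>' (snd z) * snd z / fst z) * (v \<bullet> (A ?x (Du ?x) *v e))
          + \<alpha> (fst z) * \<beta>' (snd z) / fst z * (v \<bullet> (A ?x (Du ?x) *v n))"
        by (simp only: inner_jacobian_cone_test[OF \<alpha> \<beta>] cone_test_ray[OF r])
      also have "A ?x (Du ?x) = stress F z" using elim True by (simp add: stress_def)
      finally have "fst z * W z = k z"
        using r by (simp add: k_def inner_conormal field_simps)
      then show ?thesis using True by simp
    qed (simp add: k_def stress_def)
  qed
  have m: "(\<lambda>z. indicator coord_rect z *\<^sub>R (fst z * W z)) \<in> borel_measurable lborel"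
    using W(2) by (auto simp: set_integrable_def)
  show "integrable lborel k"
    using W(2) integrable_cong_AE[OF m _ k] by (simp add: set_integrable_def)
  have "0 = (\<integral>x. ?w x * indicator sector x \<partial>(lebesgue_on (ball 0 1)))" using w(2) by (simp only: wz)
  also have "\<dots> = (LBINT z:coord_rect. fst z * W z * indicator sector (ray (fst z) (snd z)))"
    using open_sector by (intro W(4)) auto
  also have "\<dots> = (LBINT z. indicator coord_rect z *\<^sub>R (fst z * W z))"
    unfolding set_lebesgue_integral_def
    by (intro Bochner_Integration.integral_cong refl) (auto simp: indicator_def sector_ray mem_Times_iff)
  also have "\<dots> = (LBINT z. k z)" using integral_cong_AE[OF m _ k] by simp
  finally show "(LBINT z. k z) = 0" by simp
qed

text \<open>The weak equation grants integrability of whole tested integrands only. A test function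
  equal to 1 for slopes below 2 isolates the radial term; one equal to \<open>t\<close> there gives
  \<open>t\<close> times the radial term plus the normal term, which is then recovered by
  subtraction.\<close>

lemma stress_locally_integrable:
  assumes F: "F \<in> borel_measurable borel" and DuF: "AE z\<in>coord_rect in lborel. Du (ray (fst z) (snd z)) = F (snd z)"
    and \<alpha>: "test_fun 0 (1/4) \<alpha> \<alpha>'"
  shows "integrable lborel (\<lambda>z. indicator {-2<..<2} (snd z) * (fst z * \<alpha>' (fst z) * (v \<bullet> (stress F z *v e))))"
    "integrable lborel (\<lambda>z. indicator {-2<..<2} (snd z) * (\<alpha> (fst z) * (v \<bullet> (stress F z *v conormal (snd z)))))"
proof -
  \<comment> \<open>With parameter 2 the transitions end at distance 1 from the endpoints, that is,
    at slopes of modulus 2.\<close>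
  obtain \<beta>' where \<beta>: "test_fun (-3) 3 (plateau (-3) 3 2) \<beta>'" by (rule test_fun_plateau[of 2 "-3" "-3" 3 3]) auto
  have 1: "plateau (-3) 3 2 t = 1" if "t \<in> {-2<..<2}" for t
    by (rule plateau_eq_1) (use that in auto)
  have 0: "\<beta>' t = 0" if t: "t \<in> {-2<..<2}" for t
  proof -
    have "((\<lambda>_. 1) has_real_derivative \<beta>' t) (at t)"
      by (rule has_field_derivative_transform_within_open[OF test_funD(1)[OF \<beta>], of "{-2<..<2}"]) (use t 1 in auto)
    then show ?thesis using DERIV_unique[OF _ DERIV_const] by blast
  qed
  have \<beta>2: "test_fun (-3) 3 (\<lambda>t. t * plateau (-3) 3 2 t) (\<lambda>t. 1 * plateau (-3) 3 2 t + t * \<beta>' t)"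
    by (rule test_fun_mult[OF \<beta>]) (auto intro!: derivative_eq_intros)
  let ?i = "\<lambda>z::real\<times>real. indicator {-2<..<2} (snd z) :: real"
  have m: "indicator {-2<..<2::real} \<in> borel_measurable borel" by simp
  have b: "\<bar>indicator {-2<..<2} t\<bar> \<le> (1::real)" for t :: real by (simp add: indicator_def)
  from integral_snd_mult(1)[OF stress_identity(1)[OF F DuF \<alpha> \<beta>, of v] m b]
  show i1: "integrable lborel (\<lambda>z. ?i z * (fst z * \<alpha>' (fst z) * (v \<bullet> (stress F z *v e))))"
    by (rule back_subst[where P = "integrable lborel"]) (auto simp: fun_eq_iff indicator_def 0 1)
  from integral_snd_mult(1)[OF stress_identity(1)[OF F DuF \<alpha> \<beta>2, of v] m b]
  have i2: "integrable lborel (\<lambda>z. ?i z * (snd z * (fst z * \<alpha>' (fst z) * (v \<bullet> (stress F z *v e))) + \<alpha> (fst z) * (v \<bullet> (stress F z *v conormal (snd z)))))"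
    by (rule back_subst[where P = "integrable lborel"]) (auto simp: fun_eq_iff indicator_def 0 1)
  have "integrable lborel (\<lambda>z. (indicator {-2<..<2} (snd z) * snd z) * (?i z * (fst z * \<alpha>' (fst z) * (v \<bullet> (stress F z *v e)))))"
    by (rule integral_snd_mult(1)[OF i1, of "\<lambda>t. indicator {-2<..<2} t * t" 2]) (auto simp: indicator_def)
  from Bochner_Integration.integrable_diff[OF i2 this]
  show "integrable lborel (\<lambda>z. ?i z * (\<alpha> (fst z) * (v \<bullet> (stress F z *v conormal (snd z)))))"
    by (rule back_subst[where P = "integrable lborel"]) (auto simp: fun_eq_iff indicator_def)
qed

text \<open>After integration against \<alpha> over the radius, the identity says that the averaged
  normal stress \<open>S\<close> has the integrable weak derivative \<open>V\<close>. No regularity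
  of \<open>F\<close> beyond measurability enters, since the radial derivative has been moved to
  \<alpha>.\<close>

lemma averaged_normal_stress_continuous:
  assumes F: "F \<in> borel_measurable borel" and DuF: "AE z\<in>coord_rect in lborel. Du (ray (fst z) (snd z)) = F (snd z)"
    and \<alpha>: "test_fun 0 (1/4) \<alpha> \<alpha>'"
  obtains W where "continuous_on {-2<..<2} W"
    "AE t\<in>{-2<..<2} in lborel. (LBINT r. \<alpha> r * (v \<bullet> (stress F (r, t) *v conormal t))) = W t"
proof -
  define V where "V t = (LBINT r. r * \<alpha>' r * (v \<bullet> (stress F (r, t) *v e)))" for t
  define S where "S t = (LBINT r. \<alpha> r * (v \<bullet> (stress F (r, t) *v conormal t)))" for t
  note i = stress_locally_integrable[OF F DuF \<alpha>, of v]
  \<comment> \<open>Integrability of the partial integrals does not involve the multiplier, so the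
    zero function is inserted for it.\<close>
  have ii: "set_integrable lborel {-2<..<2} V" "set_integrable lborel {-2<..<2} S"
    using integral_snd_mult(2)[OF i(1), of "\<lambda>_. 0" 0] integral_snd_mult(2)[OF i(2), of "\<lambda>_. 0" 0]
    by (simp_all add: set_integrable_def V_def S_def)
  have tests: "(LBINT t. S t * \<beta>' t) = - (LBINT t. V t * \<beta> t)" if \<beta>: "test_fun (-2) 2 \<beta> \<beta>'" for \<beta> \<beta>'
  proof -
    obtain B where B: "\<And>x. \<bar>\<beta> x\<bar> \<le> B" "\<And>x. \<bar>\<beta>' x\<bar> \<le> B" using test_fun_bounded[OF \<beta>] by metis
    have m: "\<beta> \<in> borel_measurable borel" "\<beta>' \<in> borel_measurable borel" using test_funD[OF \<beta>] by auto
    have \<beta>3: "test_fun (-3) 3 \<beta> \<beta>'" by (rule test_fun_mono[OF \<beta>]) auto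
    have zz: "\<beta> t * (indicator {-2<..<2} t * x) = \<beta> t * x" "\<beta>' t * (indicator {-2<..<2} t * x) = \<beta>' t * x" for t x
      using test_funD(4,5)[OF \<beta>, of t] by (auto simp: indicator_def)
    have zv: "indicator {-2<..<2} t * x * \<beta> t = x * \<beta> t" "indicator {-2<..<2} t * x * \<beta>' t = x * \<beta>' t" for t x
      using test_funD(4,5)[OF \<beta>, of t] by (auto simp: indicator_def)
    have "0 = (LBINT z. \<beta> (snd z) * (indicator {-2<..<2} (snd z) * (fst z * \<alpha>' (fst z) * (v \<bullet> (stress F z *v e))))
      + \<beta>' (snd z) * (indicator {-2<..<2} (snd z) * (\<alpha> (fst z) * (v \<bullet> (stress F z *v conormal (snd z))))))"
      unfolding zz using stress_identity(2)[OF F DuF \<alpha> \<beta>3, of v] by simp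
    also have "\<dots> = (LBINT t. (indicator {-2<..<2} t * V t) * \<beta> t) + (LBINT t. (indicator {-2<..<2} t * S t) * \<beta>' t)"
      using integral_snd_mult[OF i(1) m(1) B(1)] integral_snd_mult[OF i(2) m(2) B(2)]
      by (simp add: V_def S_def)
    also have "\<dots> = (LBINT t. V t * \<beta> t) + (LBINT t. S t * \<beta>' t)"
      unfolding zv ..
    finally show ?thesis by simp
  qed
  obtain c where c: "AE t\<in>{-2<..<2} in lborel. S t = c + (LBINT s:{-2<..<t}. V s)"
    using du_bois_reymond[OF _ ii(2,1) tests] by auto
  show ?thesis
    by (rule that[of "\<lambda>t. c + (LBINT s:{-2<..<t}. V s)"])
       (use c continuous_on_indefinite_LBINT[OF ii(1)] in \<open>auto simp: S_def intro!: continuous_intros\<close>)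
qed

end

lemma borel_measurable_outer [measurable]:
  assumes "a \<in> borel_measurable M" "b \<in> borel_measurable M"
  shows "(\<lambda>x. outer (a x) (b x) :: real^'n^'m) \<in> borel_measurable M"
  by (rule borel_measurable_continuous_Pair[OF assms]) (intro continuous_intros)

lemma has_vector_derivative_vec_componentwise:
  fixes f :: "real \<Rightarrow> real^'n"
  assumes "\<And>k. ((\<lambda>t. f t $ k) has_real_derivative D $ k) (at t)"
  shows "(f has_vector_derivative D) (at t)"
proof -
  have "((\<lambda>t. f t $ k) has_derivative (\<lambda>x. x * D $ k)) (at t)" for k
    using assms[of k] unfolding has_field_derivative_def
    by (rule has_derivative_eq_rhs) (simp add: fun_eq_iff mult.commute)
  then show ?thesis
    unfolding has_vector_derivative_def has_derivative_componentwise_within[of f]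
    by (auto simp: Basis_vec_def inner_axis)
qed

section \<open>The monotone equation for the derivative of the profile\<close>

context cone_problem
begin

text \<open>The gradient of \<open>r f(t)\<close> as a function of \<open>y = f(t)\<close> and
  \<open>q = f'(t)\<close>, which the monotone equation varies independently.\<close>

definition radial_gradient :: "real^'m \<Rightarrow> real^'m \<Rightarrow> real \<Rightarrow> real^2^'m" where
  "radial_gradient y q t = outer y e + outer q (conormal t)"

lemma continuous_on_radial_gradient [continuous_intros]:
  "continuous_on S f \<Longrightarrow> continuous_on S g \<Longrightarrow> continuous_on S h \<Longrightarrow> continuous_on S (\<lambda>x. radial_gradient (f x) (g x) (h x))"
  unfolding radial_gradient_def by (intro continuous_intros)

lemma regular_gradient:
  obtains f p F where "F \<in> borel_measurable borel"
    "AE z\<in>coord_rect in lborel. Du (ray (fst z) (snd z)) = F (snd z)"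
    "continuous_on {-2<..<2} p" "\<And>t. t \<in> {-2<..<2} \<Longrightarrow> (f has_vector_derivative p t) (at t)"
    "AE t\<in>{-2<..<2} in lborel. profile u t = f t"
    "\<And>t. t \<in> {-2<..<2} \<Longrightarrow> F t = radial_gradient (f t) (p t) t"
proof -
  obtain c q where q: "q \<in> borel_measurable borel" "\<And>k. set_integrable lborel {-3<..<3} (\<lambda>t. q t $ k)"
    "\<And>k. AE t\<in>{-3<..<3} in lborel. profile u t $ k = c $ k + (LBINT s:{-3<..<t}. q s $ k)"
    "AE z\<in>coord_rect in lborel. Du (ray (fst z) (snd z)) *v n = q (snd z) \<and>
       Du (ray (fst z) (snd z)) *v e = profile u (snd z) - snd z *\<^sub>R q (snd z)"
    by (rule gradient_structure[OF gradient homogeneous]) blast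
  note [measurable] = q(1)
  define f where "f t = (\<chi> k. c $ k + (LBINT s:{-3<..<t}. q s $ k))" for t
  have fc: "continuous_on {-3<..<3} f"
    unfolding f_def by (intro continuous_on_vec_lambda continuous_intros continuous_on_indefinite_LBINT q(2))
  have pf: "AE t\<in>{-3<..<3} in lborel. profile u t = f t"
  proof -
    have "AE t in lborel. \<forall>k. t \<in> {-3<..<3} \<longrightarrow> profile u t $ k = c $ k + (LBINT s:{-3<..<t}. q s $ k)"
      using q(3) by (subst AE_all_countable) auto
    then show ?thesis by eventually_elim (auto simp: f_def vec_eq_iff)
  qed
  \<comment> \<open>The profile is continuous on the open interval only; cutting it off makes
    \<open>F0\<close> Borel on the line without changing it at the slopes of the rectangle.\<close>
  define F0 where "F0 t = radial_gradient (indicator {-3<..<3} t *\<^sub>R f t) (q t) t" for t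
  have "(\<lambda>t. indicator {-3<..<3} t *\<^sub>R f t) \<in> borel_measurable borel"
    using fc by (intro borel_measurable_continuous_on_indicator) auto
  then have F0 [measurable]: "F0 \<in> borel_measurable borel"
    unfolding F0_def[abs_def] radial_gradient_def by measurable
  interpret outer: bounded_bilinear "outer :: real^'m \<Rightarrow> real^2 \<Rightarrow> real^2^'m" by (rule bounded_bilinear_outer)
  interpret matvec: bounded_bilinear "(*v) :: real^2^'m \<Rightarrow> real^2 \<Rightarrow> real^'m" by (rule bounded_bilinear_matrix_vector)
  have cf: "coordinate_frame e n" by unfold_locales
  have DuF0: "AE z\<in>coord_rect in lborel. Du (ray (fst z) (snd z)) = F0 (snd z)"
    using q(4) AE_snd[OF pf]
  proof eventually_elim
    case (elim z)
    show ?case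
    proof
      assume z: "z \<in> coord_rect"
      have "Du (ray (fst z) (snd z)) = outer (f (snd z) - snd z *\<^sub>R q (snd z)) e + outer (q (snd z)) n"
        using matrix_eq_outer_frame[OF cf, of "Du (ray (fst z) (snd z))"] elim z by auto
      also have "\<dots> = F0 (snd z)"
        using z by (auto simp: F0_def radial_gradient_def conormal_def outer.diff_left outer.diff_right outer.scaleR_left outer.scaleR_right)
      finally show "Du (ray (fst z) (snd z)) = F0 (snd z)" .
    qed
  qed
  \<comment> \<open>Normalised with weight 1, because no Jacobian is left in front of the normal
    stress.\<close>
  obtain \<alpha> \<alpha>' where \<alpha>: "test_fun 0 (1/4) \<alpha> \<alpha>'" "\<And>x. \<alpha> x \<ge> 0" "(LBINT r. 1 * \<alpha> r) = 1"
    by (rule test_fun_normalized[of 0 "1/4" "\<lambda>_. 1"]) auto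
  \<comment> \<open>The support of \<alpha> stays away from radius 0, so \<open>A\<close> is
    continuous along all rays involved and the average over \<open>r\<close> is a parameter integral
    with continuous integrand over a compact interval.\<close>
  obtain l m where lm: "0 < l" "m < 1/4" "\<And>x. x \<notin> {l..m} \<Longrightarrow> \<alpha> x = 0"
    using \<alpha>(1) by (rule test_fun_supportE) blast
  have \<alpha>c [continuous_intros]: "continuous_on S \<alpha>" for S by (rule test_funD(3)[OF \<alpha>(1)])
  define h where "h t y r = \<alpha> r *\<^sub>R (A (ray r t) (radial_gradient (f t) y t) *v conormal t)" for t y r
  define H where "H t y = integral {l..m} (h t y)" for t y
  have hc: "continuous_on (({-2<..<2} \<times> UNIV) \<times> {l..m}) (\<lambda>(x, r). case x of (t, y) \<Rightarrow> h t y r)"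
  proof -
    have "continuous_on (({-2<..<2} \<times> UNIV) \<times> {l..m}) (\<lambda>w. h (fst (fst w)) (snd (fst w)) (snd w))"
      unfolding h_def
      by (intro continuous_intros continuous_A continuous_on_compose2[OF fc] continuous_on_compose2[OF \<alpha>c[of UNIV]] ray_in_punctured_ball)
         (use lm in auto)
    then show ?thesis by (simp add: case_prod_unfold)
  qed
  have hr: "continuous_on {l..m} (h t y)" if "t \<in> {-2<..<2}" for t y
  proof -
    have "continuous_on {l..m} (\<lambda>r. ((t, y), r))" by (intro continuous_intros)
    moreover have "(\<lambda>r. ((t, y), r)) ` {l..m} \<subseteq> ({-2<..<2} \<times> UNIV) \<times> {l..m}" using that by auto
    ultimately show ?thesis using continuous_on_compose2[OF hc] by fastforce
  qed
  then have hi: "h t y integrable_on {l..m}" if "t \<in> {-2<..<2}" for t y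
    using that by (intro integrable_continuous_real) auto
  have int_\<alpha>: "integral {l..m} \<alpha> = 1"
  proof -
    have "(LBINT r:{l..m}. \<alpha> r) = integral {l..m} \<alpha>"
      by (intro set_borel_integral_eq_integral(2) borel_integrable_atLeastAtMost' \<alpha>c)
    moreover have "(LBINT r:{l..m}. \<alpha> r) = (LBINT r. 1 * \<alpha> r)"
      unfolding set_lebesgue_integral_def
      using lm(3) by (intro Bochner_Integration.integral_cong refl) (auto simp: indicator_def)
    ultimately show ?thesis using \<alpha>(3) by simp
  qed
  obtain \<nu> where \<nu>: "\<nu> > 0" "\<And>x F a b. x \<in> ball 0 1 \<Longrightarrow> \<nu> * (norm a)\<^sup>2 * (norm b)\<^sup>2 \<le> ((A x (F + outer a b) - A x F) *v b) \<bullet> a"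
    by (rule strong_monotonicity) blast
  have mono: "\<nu> * (norm (y - y'))\<^sup>2 \<le> (H t y - H t y') \<bullet> (y - y')" if t: "t \<in> {-2<..<2}" for t y y'
  proof -
    have i: "(\<lambda>r. h t y r - h t y' r) integrable_on {l..m}" using hi[OF t] by (intro integrable_diff)
    have "(H t y - H t y') \<bullet> (y - y') = integral {l..m} (\<lambda>r. h t y r - h t y' r) \<bullet> (y - y')"
      unfolding H_def using hi[OF t] by (simp add: integral_diff)
    also have "\<dots> = integral {l..m} (\<lambda>r. (h t y r - h t y' r) \<bullet> (y - y'))"
      using integral_linear[OF i bounded_linear_inner_left[of "y - y'"]] by (simp add: o_def)
    also have "\<dots> \<ge> integral {l..m} (\<lambda>r. \<alpha> r * (\<nu> * (norm (y - y'))\<^sup>2))"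
    proof (rule integral_le)
      show "(\<lambda>r. \<alpha> r * (\<nu> * (norm (y - y'))\<^sup>2)) integrable_on {l..m}"
        by (intro integrable_continuous_real continuous_intros)
      show "(\<lambda>r. (h t y r - h t y' r) \<bullet> (y - y')) integrable_on {l..m}"
        using hr[OF t] by (intro integrable_continuous_real continuous_intros) auto
      fix r assume r: "r \<in> {l..m}"
      have x: "ray r t \<in> ball 0 1" by (rule ray_in_ball) (use r lm t in auto)
      \<comment> \<open>Only the second slot of the gradient varies, by a rank-one matrix built with
        the conormal that also contracts the stress: the situation of
        \<open>strong_monotonicity\<close>. The squared norm of the conormal is
        \<open>1 + t\<^sup>2\<close>, at least 1, so the constant \<nu> survives the
        average.\<close>
      have eq: "radial_gradient (f t) y t = radial_gradient (f t) y' t + outer (y - y') (conormal t)"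
        by (simp add: radial_gradient_def outer.diff_left)
      have "\<nu> * (norm (y - y'))\<^sup>2 * 1 \<le> \<nu> * (norm (y - y'))\<^sup>2 * (norm (conormal t))\<^sup>2"
        using \<nu>(1) by (intro mult_left_mono) (auto simp: norm_conormal)
      also have "\<dots> \<le> ((A (ray r t) (radial_gradient (f t) y t) - A (ray r t) (radial_gradient (f t) y' t)) *v conormal t) \<bullet> (y - y')"
        unfolding eq by (rule \<nu>(2)[OF x])
      finally have "\<alpha> r * (\<nu> * (norm (y - y'))\<^sup>2) \<le> \<alpha> r * (((A (ray r t) (radial_gradient (f t) y t) - A (ray r t) (radial_gradient (f t) y' t)) *v conormal t) \<bullet> (y - y'))"
        using \<alpha>(2)[of r] by (intro mult_left_mono) auto
      also have "\<dots> = (h t y r - h t y' r) \<bullet> (y - y')"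
        by (simp add: h_def matvec.diff_left inner_diff_left right_diff_distrib)
      finally show "\<alpha> r * (\<nu> * (norm (y - y'))\<^sup>2) \<le> (h t y r - h t y' r) \<bullet> (y - y')" .
    qed
    also have "integral {l..m} (\<lambda>r. \<alpha> r * (\<nu> * (norm (y - y'))\<^sup>2)) = \<nu> * (norm (y - y'))\<^sup>2"
      using int_\<alpha> by simp
    finally show ?thesis by simp
  qed
  define Q where "Q k W \<longleftrightarrow> continuous_on {-2<..<2} W \<and>
    (AE t\<in>{-2<..<2} in lborel. (LBINT r. \<alpha> r * (axis k 1 \<bullet> (stress F0 (r, t) *v conormal t))) = W t)" for k W
  have "\<exists>W. Q k W" for k
    unfolding Q_def by (rule averaged_normal_stress_continuous[OF F0 DuF0 \<alpha>(1), of "axis k 1"]) blast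
  then obtain W where "\<And>k. Q k (W k)" by metis
  then have W: "\<And>k. continuous_on {-2<..<2} (W k)"
     "\<And>k. AE t\<in>{-2<..<2} in lborel. (LBINT r. \<alpha> r * (axis k 1 \<bullet> (stress F0 (r, t) *v conormal t))) = W k t"
    unfolding Q_def by blast+
  have HW: "AE t\<in>{-2<..<2} in lborel. H t (q t) = (\<chi> k. W k t)"
  proof -
    have "AE t in lborel. \<forall>k. t \<in> {-2<..<2} \<longrightarrow> (LBINT r. \<alpha> r * (axis k 1 \<bullet> (stress F0 (r, t) *v conormal t))) = W k t"
      using W(2) by (subst AE_all_countable) auto
    then show ?thesis
    proof eventually_elim
      case (elim t)
      have "H t (q t) $ k = W k t" if t: "t \<in> {-2<..<2}" for k
      proof -
        have "H t (q t) $ k = integral {l..m} (\<lambda>r. h t (q t) r $ k)"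
          unfolding H_def using integral_linear[OF hi[OF t] bounded_linear_vec_nth] by (simp add: o_def)
        also have "\<dots> = (LBINT r:{l..m}. h t (q t) r $ k)"
          using hr[OF t] by (intro set_borel_integral_eq_integral(2)[symmetric] borel_integrable_atLeastAtMost' continuous_intros) auto
        also have "\<dots> = (LBINT r. \<alpha> r * (axis k 1 \<bullet> (stress F0 (r, t) *v conormal t)))"
          unfolding set_lebesgue_integral_def
        proof (rule Bochner_Integration.integral_cong[OF refl])
          fix r :: real
          show "indicator {l..m} r *\<^sub>R h t (q t) r $ k = \<alpha> r * (axis k 1 \<bullet> (stress F0 (r, t) *v conormal t))"
          proof (cases "r \<in> {l..m}")
            case True
            then have "(r, t) \<in> coord_rect" using lm t by auto
            then show ?thesis using True t by (simp add: h_def stress_def F0_def inner_axis')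
          qed (use lm(3) in simp)
        qed
        finally show ?thesis using elim t by simp
      qed
      then show ?case by (simp add: vec_eq_iff)
    qed
  qed
  obtain p where p: "continuous_on {-2<..<2} p" "AE t\<in>{-2<..<2} in lborel. q t = p t"
  proof (rule continuous_solution_of_monotone_equation[OF _ _ mono \<nu>(1) HW])
    have "continuous_on ({-2<..<2} \<times> UNIV) (\<lambda>x. integral (cbox l m) (\<lambda>r. case x of (t, y) \<Rightarrow> h t y r))"
      by (rule integral_continuous_on_param) (use hc in \<open>simp add: cbox_interval\<close>)
    then show "continuous_on ({-2<..<2} \<times> UNIV) (\<lambda>(t, y). H t y)"
      by (simp add: H_def case_prod_unfold cbox_interval)
    show "continuous_on {-2<..<2} (\<lambda>t. \<chi> k. W k t)" by (intro continuous_on_vec_lambda W)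
  qed auto
  \<comment> \<open>At slopes below 2 the continuous version is taken at every point, since
    pointwise derivatives follow. Elsewhere \<open>F0\<close> is kept, because \<open>Du\<close> has
    to be matched on the whole rectangle.\<close>
  define F where "F t = (if t \<in> {-2<..<2} then radial_gradient (f t) (p t) t else F0 t)" for t
  show ?thesis
  proof (rule that[of F p f])
    have c: "continuous_on {-2<..<2} (\<lambda>t. radial_gradient (f t) (p t) t)"
      by (intro continuous_intros p continuous_on_subset[OF fc]) auto
    have "(\<lambda>t. indicator {-2<..<2} t *\<^sub>R radial_gradient (f t) (p t) t) \<in> borel_measurable borel"
      using c by (intro borel_measurable_continuous_on_indicator) auto
    then have "(\<lambda>t. indicator {-2<..<2} t *\<^sub>R radial_gradient (f t) (p t) t + indicator (- {-2<..<2}) t *\<^sub>R F0 t) \<in> borel_measurable borel"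
      by measurable
    also have "(\<lambda>t. indicator {-2<..<2} t *\<^sub>R radial_gradient (f t) (p t) t + indicator (- {-2<..<2}) t *\<^sub>R F0 t) = F"
      by (auto simp: F_def indicator_def fun_eq_iff)
    finally show "F \<in> borel_measurable borel" .
    show "AE z\<in>coord_rect in lborel. Du (ray (fst z) (snd z)) = F (snd z)"
      using DuF0 AE_snd[OF p(2)] by eventually_elim (auto simp: F_def F0_def)
    show "AE t\<in>{-2<..<2} in lborel. profile u t = f t" using pf by eventually_elim auto
    fix t :: real assume t: "t \<in> {-2<..<2}"
    have "((\<lambda>t. f t $ k) has_real_derivative p t $ k) (at t)" for k
    proof (rule has_derivative_if_AE_eq_indefinite[OF _ _ _ _ q(2)[of k] _ _ t])
      show "continuous_on {-3<..<3} (\<lambda>t. f t $ k)" using fc by (intro continuous_intros)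
      show "continuous_on {-2<..<2} (\<lambda>t. p t $ k)" using p by (intro continuous_intros)
      show "AE t\<in>{-2<..<2} in lborel. q t $ k = p t $ k" using p(2) by eventually_elim auto
      show "AE t\<in>{-3<..<3} in lborel. f t $ k = c $ k + (LBINT s:{-3<..<t}. q s $ k)" by (simp add: f_def)
    qed auto
    then show "(f has_vector_derivative p t) (at t)"
      by (rule has_vector_derivative_vec_componentwise)
  qed (use p(1) in \<open>auto simp: F_def\<close>)
qed

end

section \<open>The equation at a fixed radius\<close>

lemma LBINT_test_fun_eq_integral:
  assumes t: "test_fun a b \<beta> \<beta>'" and g: "continuous_on {a..b} g"
  shows "(LBINT x. g x * \<beta> x) = integral {a..b} (\<lambda>x. g x * \<beta> x)"
    "(LBINT x. g x * \<beta>' x) = integral {a..b} (\<lambda>x. g x * \<beta>' x)"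
proof -
  have *: "(LBINT x. g x * \<gamma> x) = integral {a..b} (\<lambda>x. g x * \<gamma> x)"
    if c: "continuous_on {a..b} \<gamma>" and z: "\<And>x. x \<notin> {a<..<b} \<Longrightarrow> \<gamma> x = 0" for \<gamma>
  proof -
    have "(LBINT x. g x * \<gamma> x) = (LBINT x:{a..b}. g x * \<gamma> x)"
      unfolding set_lebesgue_integral_def
    proof (rule Bochner_Integration.integral_cong[OF refl])
      show "g x * \<gamma> x = indicator {a..b} x *\<^sub>R (g x * \<gamma> x)" for x
        using z[of x] by (cases "x \<in> {a..b}") auto
    qed
    also have "\<dots> = integral {a..b} (\<lambda>x. g x * \<gamma> x)"
      by (intro set_borel_integral_eq_integral(2) borel_integrable_atLeastAtMost' continuous_intros g c)
    finally show ?thesis .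
  qed
  show "(LBINT x. g x * \<beta> x) = integral {a..b} (\<lambda>x. g x * \<beta> x)"
    "(LBINT x. g x * \<beta>' x) = integral {a..b} (\<lambda>x. g x * \<beta>' x)"
    using test_funD[OF t] by (auto intro!: *)
qed

context cone_problem
begin

text \<open>The du Bois-Reymond lemma is used twice. For a fixed test function in the slope it is
  first applied in the radius, where the other side can be differentiated under the integral:
  \<open>F\<close> does not depend on the radius, so only the \<open>x\<close>-argument of
  \<open>A\<close> is hit. This gives the weak equation at every single radius, and the second use,
  in the slope, makes it pointwise.\<close>

lemma normal_stress_derivative:
  fixes v :: "real^'m"
  assumes F: "F \<in> borel_measurable borel" and DuF: "AE z\<in>coord_rect in lborel. Du (ray (fst z) (snd z)) = F (snd z)"
    and Fc: "continuous_on {-2<..<2} F" and r: "r \<in> {0<..<1/4}" and t: "t \<in> {-2<..<2}"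
  shows "((\<lambda>\<tau>. v \<bullet> (A (ray r \<tau>) (F \<tau>) *v conormal \<tau>)) has_real_derivative
    - (v \<bullet> (A (ray r t) (F t) *v e) + r * (v \<bullet> (dA (ray r t) (F t) (e + t *\<^sub>R n) *v e)))) (at t)"
proof -
  \<comment> \<open>Midpoints towards the boundary, here and for \<open>l\<close> and
    \<open>m\<close>: all functions are continuous on a compact rectangle around the given radius
    and slope.\<close>
  define a b where "a = (t - 2) / 2" and "b = (t + 2) / 2"
  have ab: "-2 < a" "a < t" "t < b" "b < 2" using t by (auto simp: a_def b_def)
  define l m where "l = r / 2" and "m = (r + 1/4) / 2"
  have lm: "0 < l" "l < r" "r < m" "m < 1/4" using r by (auto simp: l_def m_def)
  define se where "se \<rho> \<tau> = v \<bullet> (A (ray \<rho> \<tau>) (F \<tau>) *v e)" for \<rho> \<tau>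
  define sb where "sb \<rho> \<tau> = v \<bullet> (A (ray \<rho> \<tau>) (F \<tau>) *v conormal \<tau>)" for \<rho> \<tau>
  define de where "de \<rho> \<tau> = v \<bullet> (dA (ray \<rho> \<tau>) (F \<tau>) (e + \<tau> *\<^sub>R n) *v e)" for \<rho> \<tau>
  have c2: "continuous_on S (\<lambda>z. se (fst z) (snd z))" "continuous_on S (\<lambda>z. sb (fst z) (snd z))" "continuous_on S (\<lambda>z. de (fst z) (snd z))"
    if "S \<subseteq> {l..m} \<times> {a..b}" for S
    unfolding se_def sb_def de_def
    by (intro continuous_intros continuous_A continuous_dA continuous_on_compose2[OF Fc] ray_in_punctured_ball; use that lm ab in force)+
  have ct: "continuous_on {a..b} (se \<rho>)" "continuous_on {a..b} (sb \<rho>)" "continuous_on {a..b} (de \<rho>)" if "\<rho> \<in> {l..m}" for \<rho>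
    using that by (intro continuous_on_compose2[OF c2(1)[OF order_refl], of "{a..b}" "\<lambda>\<tau>. (\<rho>, \<tau>)", simplified]
        continuous_on_compose2[OF c2(2)[OF order_refl], of "{a..b}" "\<lambda>\<tau>. (\<rho>, \<tau>)", simplified]
        continuous_on_compose2[OF c2(3)[OF order_refl], of "{a..b}" "\<lambda>\<tau>. (\<rho>, \<tau>)", simplified]; auto intro!: continuous_intros)+
  have main: "(LBINT \<tau>. sb r \<tau> * \<beta>' \<tau>) = - (LBINT \<tau>. - (se r \<tau> + r * de r \<tau>) * \<beta> \<tau>)" if \<beta>: "test_fun a b \<beta> \<beta>'" for \<beta> \<beta>'
  proof -
    define X where "X \<rho> = integral {a..b} (\<lambda>\<tau>. se \<rho> \<tau> * \<beta> \<tau>)" for \<rho>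
    define Y where "Y \<rho> = integral {a..b} (\<lambda>\<tau>. sb \<rho> \<tau> * \<beta>' \<tau>)" for \<rho>
    have \<beta>c [continuous_intros]: "continuous_on UNIV \<beta>" "continuous_on UNIV \<beta>'" using test_funD[OF \<beta>] by auto
    have cp: "continuous_on ({l..m} \<times> cbox a b) (\<lambda>(\<rho>, \<tau>). se \<rho> \<tau> * \<beta> \<tau>)" "continuous_on ({l..m} \<times> cbox a b) (\<lambda>(\<rho>, \<tau>). sb \<rho> \<tau> * \<beta>' \<tau>)"
      "continuous_on ({l..m} \<times> cbox a b) (\<lambda>(\<rho>, \<tau>). de \<rho> \<tau> * \<beta> \<tau>)"
      unfolding case_prod_unfold cbox_interval
      by (intro continuous_intros c2 order_refl continuous_on_compose2[OF \<beta>c(1)] continuous_on_compose2[OF \<beta>c(2)]; simp)+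
    have XY: "continuous_on {l..m} X" "continuous_on {l..m} Y"
      using integral_continuous_on_param[OF cp(1)] integral_continuous_on_param[OF cp(2)] by (simp_all add: X_def Y_def cbox_interval)
    \<comment> \<open>Here the radial test function varies while \<beta> is fixed. Both sides are
      continuous in the radius, so the weak derivative is a classical one.\<close>
    have rXY: "((\<lambda>\<rho>. \<rho> * X \<rho>) has_real_derivative Y r) (at r)"
    proof (rule du_bois_reymond_continuous)
      show "continuous_on {l..m} (\<lambda>\<rho>. \<rho> * X \<rho>)" "continuous_on {l..m} Y" using XY by (auto intro: continuous_intros)
      show "r \<in> {l<..<m}" using lm by simp
      fix \<alpha> \<alpha>' assume \<alpha>: "test_fun l m \<alpha> \<alpha>'"
      have \<alpha>4: "test_fun 0 (1/4) \<alpha> \<alpha>'" by (rule test_fun_mono[OF \<alpha>]) (use lm in auto)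
      have \<beta>3: "test_fun (-3) 3 \<beta> \<beta>'" by (rule test_fun_mono[OF \<beta>]) (use ab in auto)
      define k where "k z = \<beta> (snd z) * (fst z * \<alpha>' (fst z) * (v \<bullet> (stress F z *v e)))
         + \<beta>' (snd z) * (\<alpha> (fst z) * (v \<bullet> (stress F z *v conormal (snd z))))" for z
      have k: "integrable lborel k" "(LBINT z. k z) = 0"
        using stress_identity[OF F DuF \<alpha>4 \<beta>3, of v] by (simp_all add: k_def[abs_def])
      have "integrable (lborel \<Otimes>\<^sub>M lborel) k" using k(1) by (simp only: lborel_prod)
      from lborel_pair.integral_fst'[OF this] k(2)
      have "0 = (LBINT \<rho>. (LBINT \<tau>. k (\<rho>, \<tau>)))" by (simp only: lborel_prod)
      also have "\<dots> = (LBINT \<rho>. \<rho> * X \<rho> * \<alpha>' \<rho> + Y \<rho> * \<alpha> \<rho>)"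
      proof (rule Bochner_Integration.integral_cong[OF refl])
        fix \<rho> :: real
        show "(LBINT \<tau>. k (\<rho>, \<tau>)) = \<rho> * X \<rho> * \<alpha>' \<rho> + Y \<rho> * \<alpha> \<rho>"
        proof (cases "\<rho> \<in> {l<..<m}")
          case False
          then have "\<alpha> \<rho> = 0" "\<alpha>' \<rho> = 0" using test_funD(4,5)[OF \<alpha>] by auto
          then show ?thesis by (simp add: k_def)
        next
          case True
          then have \<rho>: "\<rho> \<in> {l..m}" by auto
          have ke: "k (\<rho>, \<tau>) = \<rho> * \<alpha>' \<rho> * (se \<rho> \<tau> * \<beta> \<tau>) + \<alpha> \<rho> * (sb \<rho> \<tau> * \<beta>' \<tau>)" for \<tau>
          proof (cases "\<tau> \<in> {a<..<b}")
            case False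
            then show ?thesis using test_funD(4,5)[OF \<beta>, of \<tau>] by (simp add: k_def)
          next
            case True
            then have "(\<rho>, \<tau>) \<in> coord_rect" using \<rho> lm ab by auto
            then show ?thesis by (simp add: k_def stress_def se_def sb_def)
          qed
          have "set_integrable lborel {a<..<b} (se \<rho>)" "set_integrable lborel {a<..<b} (sb \<rho>)"
            by (rule set_integrable_subset[OF borel_integrable_atLeastAtMost'], use ct \<rho> in auto)+
          then have "integrable lborel (\<lambda>\<tau>. se \<rho> \<tau> * \<beta> \<tau>)" "integrable lborel (\<lambda>\<tau>. sb \<rho> \<tau> * \<beta>' \<tau>)"
            using test_fun_integrable[OF \<beta>] by auto
          moreover have "(LBINT \<tau>. se \<rho> \<tau> * \<beta> \<tau>) = X \<rho>" "(LBINT \<tau>. sb \<rho> \<tau> * \<beta>' \<tau>) = Y \<rho>"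
            using LBINT_test_fun_eq_integral[OF \<beta>] ct[OF \<rho>] by (simp_all add: X_def Y_def)
          ultimately show ?thesis unfolding ke by simp
        qed
      qed
      also have "\<dots> = (LBINT \<rho>. \<rho> * X \<rho> * \<alpha>' \<rho>) + (LBINT \<rho>. Y \<rho> * \<alpha> \<rho>)"
      proof (rule Bochner_Integration.integral_add)
        have "set_integrable lborel {l<..<m} (\<lambda>\<rho>. \<rho> * X \<rho>)" "set_integrable lborel {l<..<m} Y"
          by (rule set_integrable_subset[OF borel_integrable_atLeastAtMost'], use XY in \<open>auto intro: continuous_intros\<close>)+
        then show "integrable lborel (\<lambda>\<rho>. \<rho> * X \<rho> * \<alpha>' \<rho>)" "integrable lborel (\<lambda>\<rho>. Y \<rho> * \<alpha> \<rho>)"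
          using test_fun_integrable[OF \<alpha>] by auto
      qed
      finally show "(LBINT \<rho>. \<rho> * X \<rho> * \<alpha>' \<rho>) = - (LBINT \<rho>. Y \<rho> * \<alpha> \<rho>)" by simp
    qed
    have D: "((\<lambda>\<rho>. se \<rho> \<tau>) has_real_derivative de \<rho> \<tau>) (at \<rho>)" if "\<rho> \<in> {l<..<m}" "\<tau> \<in> {a..b}" for \<rho> \<tau>
    proof -
      have x: "ray \<rho> \<tau> \<in> ball 0 1 - {0}" by (rule ray_in_punctured_ball) (use that lm ab in auto)
      have "((\<lambda>\<rho>. ray \<rho> \<tau>) has_derivative (\<lambda>h. h *\<^sub>R (e + \<tau> *\<^sub>R n))) (at \<rho>)"
        unfolding ray_def by (auto intro!: derivative_eq_intros)
      from has_derivative_compose[OF this has_derivative_in_x[OF x]]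
      have "((\<lambda>\<rho>. A (ray \<rho> \<tau>) (F \<tau>)) has_derivative (\<lambda>h. dA (ray \<rho> \<tau>) (F \<tau>) (h *\<^sub>R (e + \<tau> *\<^sub>R n)))) (at \<rho>)" .
      from bounded_linear.has_derivative[OF bounded_linear_inner_matrix_vector this, of v e]
      show ?thesis unfolding se_def de_def has_field_derivative_def
        by (rule has_derivative_eq_rhs)
           (simp add: fun_eq_iff linear_cmul[OF linear_dA] scaleR_matrix_vector_assoc[symmetric])
    qed
    have DX: "(X has_real_derivative integral {a..b} (\<lambda>\<tau>. de r \<tau> * \<beta> \<tau>)) (at r)"
    proof -
      have "((\<lambda>\<rho>. integral (cbox a b) (\<lambda>\<tau>. se \<rho> \<tau> * \<beta> \<tau>)) has_field_derivative integral (cbox a b) (\<lambda>\<tau>. de r \<tau> * \<beta> \<tau>)) (at r within {l<..<m})"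
      proof (rule leibniz_rule_field_derivative)
        show "((\<lambda>\<rho>. se \<rho> \<tau> * \<beta> \<tau>) has_real_derivative de \<rho> \<tau> * \<beta> \<tau>) (at \<rho> within {l<..<m})"
          if "\<rho> \<in> {l<..<m}" "\<tau> \<in> cbox a b" for \<rho> \<tau>
          using D[of \<rho> \<tau>] that by (auto intro!: DERIV_cmult_right intro: has_field_derivative_at_within simp: cbox_interval)
        show "(\<lambda>\<tau>. se \<rho> \<tau> * \<beta> \<tau>) integrable_on cbox a b" if "\<rho> \<in> {l<..<m}" for \<rho>
          unfolding cbox_interval using ct(1)[of \<rho>] that
          by (intro integrable_continuous_real continuous_intros continuous_on_subset[OF \<beta>c(1)]) auto
        show "continuous_on ({l<..<m} \<times> cbox a b) (\<lambda>(\<rho>, \<tau>). de \<rho> \<tau> * \<beta> \<tau>)"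
          by (rule continuous_on_subset[OF cp(3)]) auto
      qed (use lm in auto)
      then show ?thesis using lm at_within_open[of r "{l<..<m}"] by (simp add: X_def[abs_def] cbox_interval)
    qed
    have "((\<lambda>\<rho>. \<rho> * X \<rho>) has_real_derivative (X r + r * integral {a..b} (\<lambda>\<tau>. de r \<tau> * \<beta> \<tau>))) (at r)"
      using DX by (auto intro!: derivative_eq_intros)
    \<comment> \<open>Comparing the derivative from the equation with the one from the product rule:
      the equation in the slope variable, weak in \<open>t\<close> but at the exact radius
      \<open>r\<close>.\<close>
    from DERIV_unique[OF rXY this] have Y: "Y r = X r + r * integral {a..b} (\<lambda>\<tau>. de r \<tau> * \<beta> \<tau>)" .
    have rr: "r \<in> {l..m}" using lm by auto
    have i: "(\<lambda>\<tau>. se r \<tau> * \<beta> \<tau>) integrable_on {a..b}" "(\<lambda>\<tau>. de r \<tau> * \<beta> \<tau>) integrable_on {a..b}"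
      using ct[OF rr] by (intro integrable_continuous_real continuous_intros continuous_on_subset[OF \<beta>c(1)]; simp)+
    have "(LBINT \<tau>. sb r \<tau> * \<beta>' \<tau>) = Y r"
      using LBINT_test_fun_eq_integral(2)[OF \<beta> ct(2)[OF rr]] by (simp add: Y_def)
    also have "\<dots> = integral {a..b} (\<lambda>\<tau>. (se r \<tau> + r * de r \<tau>) * \<beta> \<tau>)"
      using i integral_add[OF i(1) integrable_on_cmult_left[OF i(2), of r]] unfolding Y X_def by (simp add: distrib_right mult.assoc)
    also have "\<dots> = (LBINT \<tau>. (se r \<tau> + r * de r \<tau>) * \<beta> \<tau>)"
      by (rule LBINT_test_fun_eq_integral(1)[OF \<beta>, symmetric]) (intro continuous_intros ct rr)
    also have "\<dots> = - (LBINT \<tau>. - (se r \<tau> + r * de r \<tau>) * \<beta> \<tau>)"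
      by (simp add: algebra_simps flip: Bochner_Integration.integral_minus)
    finally show ?thesis .
  qed
  have rr: "r \<in> {l..m}" using lm by auto
  have "(sb r has_real_derivative - (se r t + r * de r t)) (at t)"
    by (rule du_bois_reymond_continuous[OF ct(2)[OF rr] _ main]) (intro continuous_intros ct rr, use ab in auto)
  then show ?thesis by (simp add: sb_def[abs_def] se_def de_def)
qed

end

section \<open>Increments of the slope\<close>

definition little_o_at :: "real \<Rightarrow> (real \<Rightarrow> 'a::real_normed_vector) \<Rightarrow> bool" where
  "little_o_at t0 g \<longleftrightarrow> (\<forall>\<epsilon>>0. \<forall>\<^sub>F t in at t0. norm (g t) \<le> \<epsilon> * \<bar>t - t0\<bar>)"

lemma little_o_at_dominated:
  assumes g: "little_o_at t0 g" and h: "\<forall>\<^sub>F t in at t0. norm (h t) \<le> K * norm (g t)"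
  shows "little_o_at t0 h"
  unfolding little_o_at_def
proof (intro allI impI)
  fix \<epsilon> :: real assume "\<epsilon> > 0"
  define \<delta> where "\<delta> = \<epsilon> / (\<bar>K\<bar> + 1)"
  have "\<delta> > 0" using \<open>\<epsilon> > 0\<close> by (simp add: \<delta>_def)
  then have "\<forall>\<^sub>F t in at t0. norm (g t) \<le> \<delta> * \<bar>t - t0\<bar>" using g by (simp add: little_o_at_def)
  then show "\<forall>\<^sub>F t in at t0. norm (h t) \<le> \<epsilon> * \<bar>t - t0\<bar>"
    using h
  proof eventually_elim
    case (elim t)
    have "norm (h t) \<le> (\<bar>K\<bar> + 1) * norm (g t)"
      using elim(2) by (rule order_trans) (intro mult_right_mono, auto)
    also have "\<dots> \<le> (\<bar>K\<bar> + 1) * (\<delta> * \<bar>t - t0\<bar>)" by (intro mult_left_mono elim) auto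
    also have "\<dots> = \<epsilon> * \<bar>t - t0\<bar>" by (simp add: \<delta>_def)
    finally show ?case .
  qed
qed

lemma little_o_at_add:
  assumes g: "little_o_at t0 g" and h: "little_o_at t0 h"
  shows "little_o_at t0 (\<lambda>t. g t + h t)"
  unfolding little_o_at_def
proof (intro allI impI)
  fix \<epsilon> :: real assume "\<epsilon> > 0"
  then have "\<forall>\<^sub>F t in at t0. norm (g t) \<le> \<epsilon> / 2 * \<bar>t - t0\<bar>" "\<forall>\<^sub>F t in at t0. norm (h t) \<le> \<epsilon> / 2 * \<bar>t - t0\<bar>"
    using g h by (simp_all only: little_o_at_def half_gt_zero)
  then show "\<forall>\<^sub>F t in at t0. norm (g t + h t) \<le> \<epsilon> * \<bar>t - t0\<bar>"
    by eventually_elim (rule order_trans[OF norm_triangle_ineq], simp)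
qed

lemma little_o_at_minus: "little_o_at t0 g \<Longrightarrow> little_o_at t0 (\<lambda>t. - g t)"
  by (simp add: little_o_at_def)

lemma little_o_at_bounded_linear:
  assumes "bounded_linear L" "little_o_at t0 g"
  shows "little_o_at t0 (\<lambda>t. L (g t))"
proof -
  obtain K where "\<And>x. norm (L x) \<le> norm x * K" using bounded_linear.bounded[OF assms(1)] by blast
  then show ?thesis
    by (intro little_o_at_dominated[OF assms(2), of _ K] always_eventually) (simp add: mult.commute)
qed

lemma little_o_at_scaleR:
  assumes "(g \<longlongrightarrow> 0) (at t0)"
  shows "little_o_at t0 (\<lambda>t. (t - t0) *\<^sub>R g t)"
  unfolding little_o_at_def
proof (intro allI impI)
  fix \<epsilon> :: real assume "\<epsilon> > 0"
  from tendstoD[OF assms this] show "\<forall>\<^sub>F t in at t0. norm ((t - t0) *\<^sub>R g t) \<le> \<epsilon> * \<bar>t - t0\<bar>"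
    by eventually_elim (auto simp: mult.commute[of \<epsilon>] intro!: mult_left_mono)
qed

lemma little_o_at_has_vector_derivative:
  assumes "(g has_vector_derivative D) (at t0)"
  shows "little_o_at t0 (\<lambda>t. g t - g t0 - (t - t0) *\<^sub>R D)"
  unfolding little_o_at_def
proof (intro allI impI)
  fix \<epsilon> :: real assume "\<epsilon> > 0"
  then obtain d where "d > 0" "\<And>t. norm (t - t0) < d \<Longrightarrow> norm (g t - g t0 - (t - t0) *\<^sub>R D) \<le> \<epsilon> * norm (t - t0)"
    using assms unfolding has_vector_derivative_def has_derivative_at_alt by blast
  then show "\<forall>\<^sub>F t in at t0. norm (g t - g t0 - (t - t0) *\<^sub>R D) \<le> \<epsilon> * \<bar>t - t0\<bar>"
    unfolding eventually_at by (auto simp: dist_real_def intro!: exI[of _ d])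
qed

text \<open>Continuity of the derivative bounds it near \<open>x0\<close>. No bound uniform in the
  space variable of \<open>A\<close> is assumed; the increments of the slope use this one at a
  single point in space.\<close>

lemma C1_on_imp_locally_Lipschitz:
  fixes g :: "'a::real_normed_vector \<Rightarrow> 'b::real_normed_vector"
  assumes "C1_on UNIV g"
  obtains \<delta> L where "\<delta> > 0" "\<And>x y. x \<in> ball x0 \<delta> \<Longrightarrow> y \<in> ball x0 \<delta> \<Longrightarrow> norm (g x - g y) \<le> L * norm (x - y)"
proof -
  obtain g' :: "'a \<Rightarrow> 'a \<Rightarrow>\<^sub>L 'b" where g': "continuous_on UNIV g'" "\<And>x. (g has_derivative blinfun_apply (g' x)) (at x)"
    using assms unfolding C1_on_def by blast
  have "isCont g' x0" using g'(1) by (simp add: continuous_on_eq_continuous_at)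
  then obtain \<delta> where \<delta>: "\<delta> > 0" "\<And>x. dist x x0 < \<delta> \<Longrightarrow> dist (g' x) (g' x0) < 1"
    unfolding continuous_at_eps_delta using zero_less_one by blast
  have "norm (g x - g y) \<le> (norm (g' x0) + 1) * norm (x - y)" if "x \<in> ball x0 \<delta>" "y \<in> ball x0 \<delta>" for x y
  proof (rule differentiable_bound[of "ball x0 \<delta>" g "\<lambda>x. blinfun_apply (g' x)"])
    show "(g has_derivative blinfun_apply (g' x)) (at x within ball x0 \<delta>)" for x
      using g'(2) has_derivative_at_withinI by blast
    fix x assume "x \<in> ball x0 \<delta>"
    then have "norm (g' x - g' x0) < 1" using \<delta>(2)[of x] by (simp add: dist_norm norm_minus_commute)
    then have "norm (g' x) \<le> norm (g' x0) + 1" using norm_triangle_ineq2[of "g' x" "g' x0"] by linarith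
    then show "onorm (blinfun_apply (g' x)) \<le> norm (g' x0) + 1" by (simp add: norm_blinfun.rep_eq)
  qed (use that in auto)
  with \<delta>(1) show ?thesis by (rule that)
qed

context cone_problem
begin

text \<open>
  Comparing the difference quotients of the normal stress with its derivative, the terms
  \<open>A (\<nabla>u) e\<close> cancel and only the \<open>x\<close>-derivatives of \<open>A\<close> at the scale \<open>r\<close> control the
  increment of the slope \<open>p\<close>.
\<close>
lemma slope_increment:
  assumes F: "F \<in> borel_measurable borel" and DuF: "AE z\<in>coord_rect in lborel. Du (ray (fst z) (snd z)) = F (snd z)"
    and p: "continuous_on {-2<..<2} p" and f: "\<And>t. t \<in> {-2<..<2} \<Longrightarrow> (f has_vector_derivative p t) (at t)"
    and Feq: "\<And>t. t \<in> {-2<..<2} \<Longrightarrow> F t = radial_gradient (f t) (p t) t"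
    and \<nu>: "\<nu> > 0" "\<And>x F a b. x \<in> ball 0 1 \<Longrightarrow> \<nu> * (norm a)\<^sup>2 * (norm b)\<^sup>2 \<le> ((A x (F + outer a b) - A x F) *v b) \<bullet> a"
    and r: "r \<in> {0<..<1/4}" and t0: "t0 \<in> {-2<..<2}" and "\<epsilon> > 0"
  shows "\<forall>\<^sub>F t in at t0. \<nu> * norm (p t - p t0) \<le>
    (r * norm (dA (ray r t0) (F t0) (e + t0 *\<^sub>R n) *v e + dA (ray r t0) (F t0) n *v conormal t0) + \<epsilon>) * \<bar>t - t0\<bar>"
proof -
  interpret outer: bounded_bilinear "outer :: real^'m \<Rightarrow> real^2 \<Rightarrow> real^2^'m" by (rule bounded_bilinear_outer)
  interpret matvec: bounded_bilinear "(*v) :: real^2^'m \<Rightarrow> real^2 \<Rightarrow> real^'m" by (rule bounded_bilinear_matrix_vector)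
  define x0 F0 b0 where "x0 = ray r t0" and "F0 = F t0" and "b0 = conormal t0"
  have x0: "x0 \<in> ball 0 1 - {0}" unfolding x0_def by (rule ray_in_punctured_ball) (use r t0 in auto)
  have fc: "continuous_on {-2<..<2} f"
    using f by (intro continuous_at_imp_continuous_on ballI has_vector_derivative_continuous) auto
  have Fc: "continuous_on {-2<..<2} F"
  proof (rule continuous_on_eq)
    show "continuous_on {-2<..<2} (\<lambda>t. radial_gradient (f t) (p t) t)" by (intro continuous_intros fc p)
  qed (simp add: Feq)
  have near: "\<forall>\<^sub>F t in at t0. t \<in> {-2<..<2}" using t0 by (intro eventually_at_in_open') auto
  have pc: "(p \<longlongrightarrow> p t0) (at t0)" using p t0 by (simp add: continuous_on_eq_continuous_at isCont_def)
  have Fl: "(F \<longlongrightarrow> F0) (at t0)" using Fc t0 by (simp add: continuous_on_eq_continuous_at isCont_def F0_def)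
  define N where "N t = A (ray r t) (F t) *v conormal t" for t
  define D1 where "D1 = dA x0 F0 (e + t0 *\<^sub>R n) *v e"
  define D2 where "D2 = dA x0 F0 n"
  have DN: "(N has_vector_derivative - (A x0 F0 *v e + r *\<^sub>R D1)) (at t0)"
  proof -
    have "((\<lambda>\<tau>. N \<tau> $ k) has_real_derivative (- (A x0 F0 *v e + r *\<^sub>R D1)) $ k) (at t0)" for k
      using normal_stress_derivative[OF F DuF Fc r t0, of "axis k 1"]
      by (simp add: N_def x0_def F0_def D1_def inner_axis')
    then show ?thesis by (rule has_vector_derivative_vec_componentwise)
  qed
  define R1 where "R1 t = N t - N t0 - (t - t0) *\<^sub>R - (A x0 F0 *v e + r *\<^sub>R D1)" for t
  have R1: "little_o_at t0 R1" unfolding R1_def[abs_def] by (rule little_o_at_has_vector_derivative[OF DN])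
  \<comment> \<open>Writing \<open>conormal t\<close> as \<open>b0 - (t - t0) *\<^sub>R e\<close>,
    the gradient at \<open>t\<close> has first factor \<open>f t - (t - t0) *\<^sub>R p t\<close>
    along \<open>e\<close> and \<open>p t\<close> along \<open>b0\<close>. So \<open>g\<close> is
    all that changes along \<open>e\<close>; it is of smaller order because \<open>p\<close> is
    continuous.\<close>
  define g where "g t = f t - f t0 - (t - t0) *\<^sub>R p t" for t
  have "little_o_at t0 (\<lambda>t. (f t - f t0 - (t - t0) *\<^sub>R p t0) + - ((t - t0) *\<^sub>R (p t - p t0)))"
    using pc by (intro little_o_at_add little_o_at_minus little_o_at_scaleR little_o_at_has_vector_derivative f[OF t0])
      (simp add: LIM_zero)
  then have g: "little_o_at t0 g" by (rule back_subst[where P = "little_o_at t0"]) (auto simp: g_def fun_eq_iff algebra_simps)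
  \<comment> \<open>The comparison gradient that differs from \<open>F0\<close> by an exact rank-one
    matrix with \<open>b0\<close>, so that ellipticity applies to it.\<close>
  define F1 where "F1 t = F0 + outer (p t - p t0) b0" for t
  have FF1: "F t - F1 t = outer (g t) e" if "t \<in> {-2<..<2}" for t
    unfolding F1_def F0_def Feq[OF that] Feq[OF t0]
    by (simp add: b0_def g_def radial_gradient_def conormal_def outer.diff_left outer.diff_right outer.add_left
        outer.scaleR_left outer.scaleR_right algebra_simps)
  have F1l: "(F1 \<longlongrightarrow> F0) (at t0)"
  proof -
    have "((\<lambda>t. F0 + outer (p t - p t0) b0) \<longlongrightarrow> F0 + outer (p t0 - p t0) b0) (at t0)"
      by (intro tendsto_intros outer.tendsto pc)
    then show ?thesis by (simp add: F1_def[abs_def] outer.zero_left)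
  qed
  \<comment> \<open>The increment in \<open>x\<close> is taken at the moving gradient
    \<open>F t\<close>, but its linear part at \<open>F0\<close>; the uniform remainder of
    \<open>increment_in_x\<close> allows this.\<close>
  define R2 where "R2 t = A (ray r t) (F t) - A x0 (F t) - ((t - t0) * r) *\<^sub>R D2" for t
  have R2: "little_o_at t0 R2"
    unfolding little_o_at_def
  proof (intro allI impI)
    fix \<eta> :: real assume \<eta>: "\<eta> > 0"
    obtain \<delta> where \<delta>: "\<delta> > 0" "\<And>x F. norm (x - x0) < \<delta> \<Longrightarrow> norm (F - F0) < \<delta> \<Longrightarrow> norm (A x F - A x0 F - dA x0 F0 (x - x0)) \<le> \<eta> * norm (x - x0)"
      using increment_in_x[OF x0 \<eta>, of F0] by metis
    have xs: "ray r t - x0 = ((t - t0) * r) *\<^sub>R n" for t by (simp add: ray_def x0_def algebra_simps)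
    have nn: "norm (ray r t - x0) \<le> \<bar>t - t0\<bar>" for t
      unfolding xs using r inner_frame(2) by (auto simp: abs_mult norm_eq_sqrt_inner intro!: mult_left_le)
    have "\<forall>\<^sub>F t in at t0. norm (F t - F0) < \<delta>" using tendstoD[OF Fl \<delta>(1)] by (simp add: dist_norm)
    moreover have "\<forall>\<^sub>F t in at t0. \<bar>t - t0\<bar> < \<delta>"
      using \<delta>(1) unfolding eventually_at by (auto simp: dist_real_def)
    ultimately show "\<forall>\<^sub>F t in at t0. norm (R2 t) \<le> \<eta> * \<bar>t - t0\<bar>"
    proof eventually_elim
      case (elim t)
      have "norm (R2 t) \<le> \<eta> * norm (ray r t - x0)"
        using \<delta>(2)[of "ray r t" "F t"] elim nn[of t] by (simp add: R2_def xs linear_cmul[OF linear_dA] D2_def)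
      also have "\<dots> \<le> \<eta> * \<bar>t - t0\<bar>" using \<eta> nn[of t] by (intro mult_left_mono) auto
      finally show ?case .
    qed
  qed
  define R3 where "R3 t = A x0 (F t) - A x0 (F1 t)" for t
  have R3: "little_o_at t0 R3"
  proof -
    obtain \<delta> L where \<delta>: "\<delta> > 0" "\<And>G G'. G \<in> ball F0 \<delta> \<Longrightarrow> G' \<in> ball F0 \<delta> \<Longrightarrow> norm (A x0 G - A x0 G') \<le> L * norm (G - G')"
      using C1_on_imp_locally_Lipschitz[OF C1_in_F, of x0 F0] x0 by auto
    have "little_o_at t0 (\<lambda>t. outer (g t) e)"
      by (rule little_o_at_bounded_linear[OF outer.bounded_linear_left g])
    then show ?thesis
    proof (rule little_o_at_dominated)
      show "\<forall>\<^sub>F t in at t0. norm (R3 t) \<le> L * norm (outer (g t) e)"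
        using near tendstoD[OF Fl \<delta>(1)] tendstoD[OF F1l \<delta>(1)]
      proof eventually_elim
        case (elim t)
        have "norm (R3 t) \<le> L * norm (F t - F1 t)" unfolding R3_def by (rule \<delta>(2)) (use elim in \<open>auto simp: dist_commute\<close>)
        then show ?case using FF1 elim by simp
      qed
    qed
  qed
  define R4 where "R4 t = (t - t0) *\<^sub>R ((A (ray r t) (F t) - A x0 F0) *v e)" for t
  have R4: "little_o_at t0 R4"
    unfolding R4_def[abs_def]
  proof (rule little_o_at_scaleR)
    have "((\<lambda>t. (ray r t, F t)) \<longlongrightarrow> (x0, F0)) (at t0)"
      unfolding ray_def x0_def by (intro tendsto_intros Fl)
    from isCont_tendsto_compose[OF isCont_A[OF x0] this]
    have "((\<lambda>t. A (ray r t) (F t)) \<longlongrightarrow> A x0 F0) (at t0)" by simp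
    then have "((\<lambda>t. (A (ray r t) (F t) - A x0 F0) *v e) \<longlongrightarrow> (A x0 F0 - A x0 F0) *v e) (at t0)"
      by (intro matvec.tendsto tendsto_intros)
    then show "((\<lambda>t. (A (ray r t) (F t) - A x0 F0) *v e) \<longlongrightarrow> 0) (at t0)" by (simp add: matvec.zero_left)
  qed
  define E where "E t = R1 t + R4 t + - (R2 t *v b0) + - (R3 t *v b0)" for t
  have E: "little_o_at t0 E"
    unfolding E_def[abs_def]
    by (intro little_o_at_add little_o_at_minus R1 R4 little_o_at_bounded_linear[OF matvec.bounded_linear_left] R2 R3)
  \<comment> \<open>The cancellation: changing \<open>conormal t\<close> to \<open>b0\<close> and
    the derivative of \<open>N\<close> both contribute the stress along \<open>e\<close>, once at
    \<open>t\<close> and once at \<open>t0\<close>, and only the small difference \<open>R4\<close>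
    is left. What remains at first order are the two \<open>x\<close>-derivatives \<open>D1\<close>
    and \<open>D2\<close>.\<close>
  have id: "(A x0 (F1 t) - A x0 F0) *v b0 = - (((t - t0) * r) *\<^sub>R (D1 + D2 *v b0)) + E t" for t
  proof -
    have "conormal t = b0 - (t - t0) *\<^sub>R e" by (simp add: conormal_def b0_def algebra_simps)
    then have N: "N t = A (ray r t) (F t) *v b0 - (t - t0) *\<^sub>R (A (ray r t) (F t) *v e)"
      by (simp add: N_def matvec.diff_right matvec.scaleR_right)
    have N0: "N t0 = A x0 F0 *v b0" by (simp add: N_def x0_def F0_def b0_def)
    show ?thesis
      by (simp add: E_def R1_def R2_def R3_def R4_def N N0 matvec.diff_left matvec.scaleR_left matvec.add_left
          scaleR_diff_right scaleR_add_right algebra_simps)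
  qed
  have "\<forall>\<^sub>F t in at t0. norm (E t) \<le> \<epsilon> * \<bar>t - t0\<bar>" using E \<open>\<epsilon> > 0\<close> by (simp add: little_o_at_def)
  then have "\<forall>\<^sub>F t in at t0. \<nu> * norm (p t - p t0) \<le> (r * norm (D1 + D2 *v b0) + \<epsilon>) * \<bar>t - t0\<bar>"
  proof eventually_elim
    case (elim t)
    let ?q = "p t - p t0"
    let ?Z = "(A x0 (F1 t) - A x0 F0) *v b0"
    have "\<nu> * (norm ?q)\<^sup>2 * 1 \<le> \<nu> * (norm ?q)\<^sup>2 * (norm b0)\<^sup>2"
      using \<nu>(1) by (intro mult_left_mono) (auto simp: b0_def norm_conormal)
    also have "\<dots> \<le> ?Z \<bullet> ?q" unfolding F1_def using \<nu>(2)[of x0 ?q b0 F0] x0 by simp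
    also have "\<dots> \<le> norm ?Z * norm ?q" by (rule norm_cauchy_schwarz)
    finally have "(\<nu> * norm ?q) * norm ?q \<le> norm ?Z * norm ?q" by (simp add: power2_eq_square mult.assoc)
    then have "\<nu> * norm ?q \<le> norm ?Z"
      by (cases "norm ?q = 0") auto
    also have "\<dots> \<le> norm (((t - t0) * r) *\<^sub>R (D1 + D2 *v b0)) + norm (E t)"
      unfolding id using norm_triangle_ineq[of "- (((t - t0) * r) *\<^sub>R (D1 + D2 *v b0))" "E t"] by simp
    also have "\<dots> \<le> (r * norm (D1 + D2 *v b0) + \<epsilon>) * \<bar>t - t0\<bar>"
      using elim r by (simp add: abs_mult distrib_left distrib_right mult_ac)
    finally show ?case .
  qed
  then show ?thesis by (simp add: D1_def D2_def x0_def F0_def b0_def)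
qed

end

lemma has_derivative_0_if_little_o_at:
  fixes g :: "real \<Rightarrow> real"
  assumes "little_o_at t (\<lambda>s. g s - g t)"
  shows "(g has_real_derivative 0) (at t)"
  unfolding has_field_derivative_def has_derivative_at_alt
proof (intro conjI allI impI)
  show "bounded_linear ((*) (0::real))" by (rule bounded_linear_mult_right)
  fix \<epsilon> :: real assume "\<epsilon> > 0"
  then have "\<forall>\<^sub>F s in at t. norm (g s - g t) \<le> \<epsilon> * \<bar>s - t\<bar>" using assms by (simp only: little_o_at_def)
  then obtain d where "d > 0" "\<And>s. s \<noteq> t \<Longrightarrow> \<bar>s - t\<bar> < d \<Longrightarrow> norm (g s - g t) \<le> \<epsilon> * \<bar>s - t\<bar>"
    unfolding eventually_at dist_real_def by blast
  then have "norm (g y - g t - 0 * (y - t)) \<le> \<epsilon> * norm (y - t)" if "norm (y - t) < d" for y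
    using that by (cases "y = t") auto
  then show "\<exists>d>0. \<forall>y. norm (y - t) < d \<longrightarrow> norm (g y - g t - 0 * (y - t)) \<le> \<epsilon> * norm (y - t)"
    using \<open>d > 0\<close> by blast
qed

section \<open>Vanishing derivative of the slope and linearity on one cone\<close>

context cone_problem
begin

text \<open>The hypothesis at \<open>x\<close> depends on its direction and on \<open>Du x\<close>,
  both functions of the slope almost everywhere, so it becomes a statement for almost every
  \<open>t\<close>.\<close>

lemma scaled_derivative_limit:
  assumes F: "F \<in> borel_measurable borel" and DuF: "AE z\<in>coord_rect in lborel. Du (ray (fst z) (snd z)) = F (snd z)"
  shows "AE t\<in>{-3<..<3} in lborel. (\<forall>h. ((\<lambda>r. r *\<^sub>R dA (ray r t) (F t) h) \<longlongrightarrow> 0) (at_right 0))"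
proof -
  define Q where "Q t \<longleftrightarrow> (\<forall>i. ((\<lambda>R. R *\<^sub>R partial i (\<lambda>y. A y (F t)) (R *\<^sub>R sgn (e + t *\<^sub>R n))) \<longlongrightarrow> 0) (at_right 0))" for t
  have "AE x\<in>sector in lborel. (\<forall>i. ((\<lambda>R. R *\<^sub>R partial i (\<lambda>y. A y (Du x)) (R *\<^sub>R sgn x)) \<longlongrightarrow> 0) (at_right 0))"
  proof -
    have "AE x in lebesgue. x \<in> ball 0 1 \<longrightarrow> ((\<lambda>R. R *\<^sub>R partial i (\<lambda>y. A y (Du x)) (R *\<^sub>R sgn x)) \<longlongrightarrow> 0) (at_right 0)" for i
      using partial_limit[of i] by (subst (asm) AE_restrict_space_iff) auto
    then have "AE x\<in>ball 0 1 in lborel. ((\<lambda>R. R *\<^sub>R partial i (\<lambda>y. A y (Du x)) (R *\<^sub>R sgn x)) \<longlongrightarrow> 0) (at_right 0)" for i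
      by (simp only: AE_completion_iff)
    then have "AE x in lborel. \<forall>i. x \<in> ball 0 1 \<longrightarrow> ((\<lambda>R. R *\<^sub>R partial i (\<lambda>y. A y (Du x)) (R *\<^sub>R sgn x)) \<longlongrightarrow> 0) (at_right 0)"
      by (subst AE_all_countable) auto
    then show ?thesis by eventually_elim (use sector_subset_ball in blast)
  qed
  from AE_coord_rect_if_AE_sector[OF this] DuF
  have "AE z in lborel. fst z \<in> {0<..<1/4::real} \<longrightarrow> (snd z \<in> {-3<..<3} \<longrightarrow> Q (snd z))"
  proof eventually_elim
    case (elim z)
    have "sgn (ray (fst z) (snd z)) = sgn (e + snd z *\<^sub>R n)" if "fst z > 0"
      using that by (simp add: ray_def sgn_scaleR)
    then show ?case using elim by (auto simp: Q_def mem_Times_iff)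
  qed
  then have "AE t\<in>{-3<..<3} in lborel. Q t" by (rule AE_snd_D) simp
  then show ?thesis
  proof eventually_elim
    case (elim t)
    show ?case
    proof (intro impI allI)
      fix h assume t: "t \<in> {-3<..<3}"
      define N where "N = norm (e + t *\<^sub>R n)"
      have "N > 0" using ray_nonzero[of 1 t] by (simp add: N_def ray_def)
      \<comment> \<open>The hypothesis is parametrised by the distance from the origin, which is
        \<open>N\<close> times the coordinate \<open>r\<close>.\<close>
      have lim: "filterlim (\<lambda>r. r * N) (at_right 0) (at_right 0)"
      proof -
        have "((\<lambda>r. r * N) \<longlongrightarrow> 0 * N) (at_right 0)" by (intro tendsto_intros)
        moreover have "\<forall>\<^sub>F r in at_right 0. r * N > 0"
          using eventually_at_right_less[of "0::real"] by eventually_elim (use \<open>N > 0\<close> in simp)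
        ultimately show ?thesis by (auto simp: filterlim_at elim: eventually_mono)
      qed
      have P: "((\<lambda>r. r *\<^sub>R partial i (\<lambda>y. A y (F t)) (ray r t)) \<longlongrightarrow> 0) (at_right 0)" for i
      proof -
        have "((\<lambda>R. R *\<^sub>R partial i (\<lambda>y. A y (F t)) (R *\<^sub>R sgn (e + t *\<^sub>R n))) \<longlongrightarrow> 0) (at_right 0)"
          using elim t by (simp add: Q_def)
        from filterlim_compose[OF this lim]
        have "((\<lambda>r. (1 / N) *\<^sub>R ((r * N) *\<^sub>R partial i (\<lambda>y. A y (F t)) ((r * N) *\<^sub>R sgn (e + t *\<^sub>R n)))) \<longlongrightarrow> (1 / N) *\<^sub>R 0) (at_right 0)"
          by (intro tendsto_intros)
        moreover have "(r * N) *\<^sub>R sgn (e + t *\<^sub>R n) = ray r t" for r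
          using \<open>N > 0\<close> by (simp add: sgn_div_norm N_def[symmetric] ray_def)
        ultimately show ?thesis using \<open>N > 0\<close> by simp
      qed
      have "((\<lambda>r. \<Sum>i\<in>UNIV. h $ i *\<^sub>R (r *\<^sub>R partial i (\<lambda>y. A y (F t)) (ray r t))) \<longlongrightarrow> (\<Sum>i\<in>UNIV. h $ i *\<^sub>R 0)) (at_right 0)"
        by (intro tendsto_sum tendsto_scaleR tendsto_const P)
      then show "((\<lambda>r. r *\<^sub>R dA (ray r t) (F t) h) \<longlongrightarrow> 0) (at_right 0)"
        by (simp add: dA_def scaleR_sum_right mult.commute)
    qed
  qed
qed

lemma linear_on_cone:
  "\<exists>L. linear L \<and> (AE x in lborel. x \<in> ball 0 1 \<and> 0 < x \<bullet> e \<and> \<bar>x \<bullet> n\<bar> < 2 * (x \<bullet> e) \<longrightarrow> u x = L x)"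
proof -
  obtain f p F where F: "F \<in> borel_measurable borel"
    and DuF: "AE z\<in>coord_rect in lborel. Du (ray (fst z) (snd z)) = F (snd z)"
    and p: "continuous_on {-2<..<2} p" and f: "\<And>t. t \<in> {-2<..<2} \<Longrightarrow> (f has_vector_derivative p t) (at t)"
    and uf: "AE t\<in>{-2<..<2} in lborel. profile u t = f t"
    and Feq: "\<And>t. t \<in> {-2<..<2} \<Longrightarrow> F t = radial_gradient (f t) (p t) t"
    by (rule regular_gradient) blast
  obtain \<nu> where \<nu>: "\<nu> > 0" "\<And>x F a b. x \<in> ball 0 1 \<Longrightarrow> \<nu> * (norm a)\<^sup>2 * (norm b)\<^sup>2 \<le> ((A x (F + outer a b) - A x F) *v b) \<bullet> a"
    by (rule strong_monotonicity) blast
  interpret matvec: bounded_bilinear "(*v) :: real^2^'m \<Rightarrow> real^2 \<Rightarrow> real^'m" by (rule bounded_bilinear_matrix_vector)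
  define C where "C r t = r * norm (dA (ray r t) (F t) (e + t *\<^sub>R n) *v e + dA (ray r t) (F t) n *v conormal t)" for r t
  have incr: "\<forall>\<^sub>F s in at t. \<nu> * norm (p s - p t) \<le> (C r t + \<epsilon>) * \<bar>s - t\<bar>"
    if "r \<in> {0<..<1/4}" "t \<in> {-2<..<2}" "\<epsilon> > 0" for r t \<epsilon>
    using slope_increment[OF F DuF p f Feq \<nu> that] by (simp add: C_def)
  have p_const: "p s $ k = p t $ k" if st: "s \<in> {-2<..<2}" "t \<in> {-2<..<2}" for s t k
  proof (rule constant_if_locally_Lipschitz_AE_deriv_zero[OF _ _ st])
    \<comment> \<open>A single radius is enough for the Lipschitz bound; it need not be small, and
      \<open>1/8\<close> is the middle of the range.\<close>
    fix t assume t: "t \<in> {-2<..<2::real}"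
    have "\<forall>\<^sub>F s in at t. \<nu> * norm (p s - p t) \<le> (C (1/8) t + 1) * \<bar>s - t\<bar>"
      by (rule incr) (use t in auto)
    then obtain d where d: "d > 0" "\<And>s. s \<noteq> t \<Longrightarrow> \<bar>s - t\<bar> < d \<Longrightarrow> \<nu> * norm (p s - p t) \<le> (C (1/8) t + 1) * \<bar>s - t\<bar>"
      unfolding eventually_at dist_real_def by blast
    have "\<bar>p s $ k - p t $ k\<bar> \<le> (C (1/8) t + 1) / \<nu> * \<bar>s - t\<bar>" if "\<bar>s - t\<bar> < d" for s
    proof (cases "s = t")
      case False
      have "\<bar>p s $ k - p t $ k\<bar> \<le> norm (p s - p t)" using component_le_norm_cart[of "p s - p t" k] by simp
      also have "\<dots> \<le> (C (1/8) t + 1) / \<nu> * \<bar>s - t\<bar>" using d(2)[OF False that] \<nu>(1) by (simp add: field_simps)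
      finally show ?thesis .
    qed simp
    then show "\<exists>B d. d > 0 \<and> (\<forall>s. \<bar>s - t\<bar> < d \<longrightarrow> \<bar>p s $ k - p t $ k\<bar> \<le> B * \<bar>s - t\<bar>)" using d(1) by blast
  next
    show "AE t\<in>{-2<..<2} in lborel. ((\<lambda>t. p t $ k) has_real_derivative 0) (at t)"
      using scaled_derivative_limit[OF F DuF]
    proof eventually_elim
      case (elim t)
      show ?case
      proof
        assume t: "t \<in> {-2<..<2}"
        have "((\<lambda>r. norm ((r *\<^sub>R dA (ray r t) (F t) (e + t *\<^sub>R n)) *v e + (r *\<^sub>R dA (ray r t) (F t) n) *v conormal t))
            \<longlongrightarrow> norm ((0::real^2^'m) *v e + (0::real^2^'m) *v conormal t)) (at_right 0)"
          using elim t by (intro tendsto_norm tendsto_add matvec.tendsto tendsto_const) auto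
        then have l0: "((\<lambda>r. norm ((r *\<^sub>R dA (ray r t) (F t) (e + t *\<^sub>R n)) *v e + (r *\<^sub>R dA (ray r t) (F t) n) *v conormal t)) \<longlongrightarrow> 0) (at_right 0)"
          by (simp add: matvec.zero_left)
        have Ceq: "C r t = norm ((r *\<^sub>R dA (ray r t) (F t) (e + t *\<^sub>R n)) *v e + (r *\<^sub>R dA (ray r t) (F t) n) *v conormal t)" if "r > 0" for r
          using that by (simp add: C_def matvec.scaleR_left flip: scaleR_add_right)
        have o: "little_o_at t (\<lambda>s. p s - p t)"
          unfolding little_o_at_def
        proof (intro allI impI)
          fix \<epsilon> :: real assume "\<epsilon> > 0"
          \<comment> \<open>One \<eta> for the coefficient \<open>C r t\<close> at a small radius,
            one for the error of the increment estimate.\<close>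
          define \<eta> where "\<eta> = \<nu> * \<epsilon> / 2"
          have \<eta>: "\<eta> > 0" using \<open>\<epsilon> > 0\<close> \<nu>(1) by (simp add: \<eta>_def)
          have "\<forall>\<^sub>F r in at_right 0. r \<in> {0<..<1/4::real}" by (intro eventually_at_right_real) auto
          with tendstoD[OF l0 \<eta>] have "\<forall>\<^sub>F r in at_right 0. r \<in> {0<..<1/4} \<and> C r t < \<eta>"
            by eventually_elim (auto simp: Ceq)
          then obtain r where r: "r \<in> {0<..<1/4}" "C r t < \<eta>"
            using eventually_happens[of _ "at_right (0::real)"] by (auto simp: trivial_limit_at_right_real)
          have "\<forall>\<^sub>F s in at t. \<nu> * norm (p s - p t) \<le> (C r t + \<eta>) * \<bar>s - t\<bar>" by (rule incr[OF r(1) t \<eta>])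
          then show "\<forall>\<^sub>F s in at t. norm (p s - p t) \<le> \<epsilon> * \<bar>s - t\<bar>"
          proof eventually_elim
            case (elim s)
            have "\<nu> * norm (p s - p t) \<le> (\<eta> + \<eta>) * \<bar>s - t\<bar>"
              using elim by (rule order_trans) (use r(2) in \<open>intro mult_right_mono, auto\<close>)
            also have "\<dots> = \<nu> * (\<epsilon> * \<bar>s - t\<bar>)" by (simp add: \<eta>_def)
            finally show ?case using \<nu>(1) by simp
          qed
        qed
        have "little_o_at t (\<lambda>s. p s $ k - p t $ k)"
          using little_o_at_bounded_linear[OF bounded_linear_vec_nth o, of k] by simp
        then show "((\<lambda>t. p t $ k) has_real_derivative 0) (at t)"
          by (rule has_derivative_0_if_little_o_at)
      qed
    qed
  qed
  have f_aff: "f t = f 0 + t *\<^sub>R p 0" if t: "t \<in> {-2<..<2}" for t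
  proof -
    have "((\<lambda>t. f t - t *\<^sub>R p 0) has_vector_derivative 0) (at s within {-2<..<2})" if "s \<in> {-2<..<2}" for s
    proof -
      have "p s = p 0" using p_const[OF that, of 0] by (simp add: vec_eq_iff)
      then have "((\<lambda>t. f t - t *\<^sub>R p 0) has_vector_derivative 0) (at s)"
        using f[OF that] by (auto intro!: derivative_eq_intros)
      then show ?thesis by (rule has_vector_derivative_at_within)
    qed
    then obtain c where "\<And>s. s \<in> {-2<..<2} \<Longrightarrow> f s - s *\<^sub>R p 0 = c"
      by (rule has_vector_derivative_zero_constant[rotated]) auto
    from this[of t] this[of 0] t show ?thesis by (simp add: algebra_simps)
  qed
  define L where "L x = (x \<bullet> e) *\<^sub>R f 0 + (x \<bullet> n) *\<^sub>R p 0" for x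
  have "linear L" unfolding L_def by (auto simp: linear_iff inner_add_left scaleR_add_left scaleR_add_right)
  moreover have "AE x in lborel. x \<in> ball 0 1 \<and> 0 < x \<bullet> e \<and> \<bar>x \<bullet> n\<bar> < 2 * (x \<bullet> e) \<longrightarrow> u x = L x"
    using AE_slope[OF uf]
  proof eventually_elim
    case (elim x)
    show ?case
    proof
      assume x: "x \<in> ball 0 1 \<and> 0 < x \<bullet> e \<and> \<bar>x \<bullet> n\<bar> < 2 * (x \<bullet> e)"
      define t where "t = (x \<bullet> n) / (x \<bullet> e)"
      have t: "t \<in> {-2<..<2}" using x by (auto simp: t_def field_simps abs_less_iff)
      have xr: "ray (x \<bullet> e) t = x" unfolding t_def by (rule ray_coords) (use x in auto)
      have "u x = (x \<bullet> e) *\<^sub>R profile u t"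
        using one_homogeneous_profile[OF homogeneous, of t "x \<bullet> e"] t x xr by auto
      also have "\<dots> = (x \<bullet> e) *\<^sub>R (f 0 + t *\<^sub>R p 0)" using elim x t f_aff[OF t] by (simp add: t_def)
      also have "\<dots> = L x" using x by (simp add: L_def t_def scaleR_add_right)
      finally show "u x = L x" .
    qed
  qed
  ultimately show ?thesis by blast
qed

end

section \<open>Gluing the four cones\<close>

text \<open>By continuity the maps agree everywhere on the open set, and a linear map is determined
  by its increments from one of these points in small multiples of every direction.\<close>

lemma linear_eq_if_AE_eq_on_open:
  fixes L L' :: "'a::euclidean_space \<Rightarrow> 'b::euclidean_space"
  assumes lin: "linear L" "linear L'" and U: "open U" "U \<noteq> {}" and ae: "AE x in lborel. x \<in> U \<longrightarrow> L x = L' x"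
  shows "L = L'"
proof -
  have cont: "continuous_on UNIV L" "continuous_on UNIV L'"
    using lin by (auto intro: linear_continuous_on simp: linear_conv_bounded_linear)
  define V where "V = U \<inter> {x. L x \<noteq> L' x}"
  have "open V" unfolding V_def
    using U(1) cont by (intro open_Int open_Collect_neq) auto
  have "AE x in lebesgue. x \<notin> V" using AE_completion[OF ae] by eventually_elim (auto simp: V_def)
  then have "negligible V"
    by (simp add: eventually_ae_filter_negligible) (metis mem_Collect_eq negligible_subset subsetI)
  then have "V = {}" using open_not_negligible[OF \<open>open V\<close>] by blast
  then have eq: "L x = L' x" if "x \<in> U" for x using that by (auto simp: V_def)
  obtain x where x: "x \<in> U" using U(2) by blast
  then obtain d where d: "d > 0" "ball x d \<subseteq> U" using U(1) open_contains_ball by blast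
  show ?thesis
  proof (rule ext)
    fix h :: 'a
    \<comment> \<open>Small enough to stay in the ball of radius \<open>d\<close>; the added 1
      covers \<open>h = 0\<close>.\<close>
    define c where "c = d / (2 * (norm h + 1))"
    have "c > 0" using d(1) by (simp add: c_def add_nonneg_pos)
    have "norm (c *\<^sub>R h) < d"
    proof -
      have "0 < 2 * (norm h + 1)" "norm h < 2 * (norm h + 1)" by (simp_all add: add_nonneg_pos add_strict_increasing)
      then have "norm h / (2 * (norm h + 1)) < 1" by (simp only: divide_less_eq_1_pos)
      then have "d * (norm h / (2 * (norm h + 1))) < d * 1" using d(1) by (intro mult_strict_left_mono) auto
      then show ?thesis using \<open>c > 0\<close> d(1) by (simp add: c_def)
    qed
    then have "x + c *\<^sub>R h \<in> U" using d(2) by (auto simp: dist_norm)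
    then have "L (x + c *\<^sub>R h) = L' (x + c *\<^sub>R h)" by (rule eq)
    then show "L h = L' h"
      using eq[OF x] \<open>c > 0\<close> lin by (simp add: linear_add linear_cmul)
  qed
qed

theorem theorem2p1:
  fixes A :: "real^2 \<Rightarrow> real^2^'m \<Rightarrow> real^2^'m"
    and u :: "real^2 \<Rightarrow> real^'m"
    and Du :: "real^2 \<Rightarrow> real^2^'m"
  assumes sobolev: "u \<in> W12 (ball 0 1)"
    and gradient: "weak_gradient (ball 0 1) u Du"
    and homogeneous: "one_homogeneous_on (ball 0 1) u"
    and solution: "distributionally_div_free (ball 0 1) (\<lambda>x. A x (Du x))"
    and C1_in_F: "\<And>x. x \<in> ball 0 1 \<Longrightarrow> C1_on UNIV (A x)"
    and elliptic: "uniformly_elliptic_on (ball 0 1) A"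
    and partial_exists:
      "\<And>i x F. x \<in> ball 0 1 - {0} \<Longrightarrow> has_partial_at i (\<lambda>y. A y F) x"
    and partial_continuous:
      "\<And>i. continuous_on ((ball 0 1 - {0}) \<times> UNIV)
              (\<lambda>(x, F). norm x *\<^sub>R partial i (\<lambda>y. A y F) x)"
    \<comment> \<open>Along the ray through \<open>x\<close> the gradient keeps the value \<open>Du x\<close>, as \<open>u\<close> is one-homogeneous;
        \<open>sgn x = x / |x|\<close>.\<close>
    and partial_limit:
      "\<And>i. AE x in lebesgue_on (ball 0 1).
              ((\<lambda>R. R *\<^sub>R partial i (\<lambda>y. A y (Du x)) (R *\<^sub>R sgn x)) \<longlongrightarrow> 0) (at_right 0)"
  shows "\<exists>L. linear L \<and> (AE x in lebesgue_on (ball 0 1). u x = L x)"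
proof -
  \<comment> \<open>\<open>i\<close> is the axis of the cone, \<open>s\<close> its half and
    \<open>j\<close> the transverse coordinate.\<close>
  define cone :: "real \<Rightarrow> 2 \<Rightarrow> 2 \<Rightarrow> (real^2) set" where
    "cone s i j = {x \<in> ball 0 1. 0 < s * x $ i \<and> \<bar>x $ j\<bar> < 2 * (s * x $ i)}" for s i j
  have cone_linear: "\<exists>L. linear L \<and> (AE x\<in>cone s i j in lborel. u x = L x)"
    if ij: "i \<noteq> j" and s: "s = 1 \<or> s = -1" for i j s
  proof -
    let ?e = "s *\<^sub>R axis i 1 :: real^2"
    interpret cone_problem ?e "axis j 1" A u Du
    proof
      show "\<exists>k l. k \<noteq> l \<and> (?e = axis k 1 \<or> ?e = - axis k 1) \<and> (axis j 1 :: real^2) = axis l 1"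
        using ij s by (intro exI[of _ i] exI[of _ j]) auto
    qed fact+
    show ?thesis using linear_on_cone by (simp add: cone_def inner_axis)
  qed
  have open_cone: "open (cone s i j)" for s i j
  proof -
    have "cone s i j = ball 0 1 \<inter> {x. 0 < s * x $ i} \<inter> {x. \<bar>x $ j\<bar> < 2 * (s * x $ i)}"
      by (auto simp: cone_def)
    then show ?thesis by (auto intro!: open_Int open_Collect_less continuous_intros)
  qed
  have glue: "L = L'" if L: "linear L" "AE x\<in>cone s 1 2 in lborel. u x = L x"
      and L': "linear L'" "AE x\<in>cone s' 2 1 in lborel. u x = L' x"
      and s: "s = 1 \<or> s = -1" and s': "s' = 1 \<or> s' = -1" for L L' s s'
  proof (rule linear_eq_if_AE_eq_on_open[OF L(1) L'(1)])
    show "open (cone s 1 2 \<inter> cone s' 2 1)" by (intro open_Int open_cone)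
    \<comment> \<open>Cones around different axes meet along the diagonal between them, where the
      slope has modulus 1.\<close>
    let ?x = "vector [s / 2, s' / 2] :: real^2"
    have "(norm ?x)\<^sup>2 = 1 / 2"
      using s s' by (auto simp: power2_norm_eq_inner inner_vec_def sum_2)
    then have "(norm ?x)\<^sup>2 < 1\<^sup>2" by simp
    then have "norm ?x < 1" by (rule power_less_imp_less_base) simp
    then have "?x \<in> cone s 1 2 \<inter> cone s' 2 1" using s s' by (auto simp: cone_def)
    then show "cone s 1 2 \<inter> cone s' 2 1 \<noteq> {}" by blast
    show "AE x in lborel. x \<in> cone s 1 2 \<inter> cone s' 2 1 \<longrightarrow> L x = L' x"
      using L(2) L'(2) by eventually_elim auto
  qed
  obtain L where L: "linear L" "AE x\<in>cone 1 1 2 in lborel. u x = L x"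
    using cone_linear[of 1 2 1] by auto
  have L2: "AE x\<in>cone s 2 1 in lborel. u x = L x" if s: "s = 1 \<or> s = -1" for s
  proof -
    obtain L' where L': "linear L'" "AE x\<in>cone s 2 1 in lborel. u x = L' x"
      using cone_linear[of 2 1 s] s by auto
    have "L = L'" by (rule glue[OF L L' _ s]) simp
    then show ?thesis using L'(2) by simp
  qed
  have L1: "AE x\<in>cone s 1 2 in lborel. u x = L x" if s: "s = 1 \<or> s = -1" for s
  proof -
    obtain L' where L': "linear L'" "AE x\<in>cone s 1 2 in lborel. u x = L' x"
      using cone_linear[of 1 2 s] s by auto
    \<comment> \<open>Opposite cones are disjoint, so the comparison passes through the cone around
      the positive second axis.\<close>
    have "L' = L" by (rule glue[OF L' L(1) L2[of 1] s]) simp_all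
    then show ?thesis using L'(2) by simp
  qed
  have "AE x\<in>ball 0 1 in lborel. u x = L x"
    using L1[OF disjI1[OF refl]] L1[OF disjI2[OF refl]] L2[OF disjI1[OF refl]] L2[OF disjI2[OF refl]] AE_lborel_singleton[of "0::real^2"]
  proof eventually_elim
    case (elim x)
    show ?case
    proof
      assume x: "x \<in> ball 0 1"
      have "x $ 1 \<noteq> 0 \<or> x $ 2 \<noteq> 0" using elim by (auto simp: vec_eq_iff forall_2)
      \<comment> \<open>The coordinate of larger modulus and its sign determine a cone that contains
        \<open>x\<close>.\<close>
      then have "x \<in> cone 1 1 2 \<or> x \<in> cone (-1) 1 2 \<or> x \<in> cone 1 2 1 \<or> x \<in> cone (-1) 2 1"
        using x by (auto simp: cone_def abs_if)
      then show "u x = L x" using elim by auto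
    qed
  qed
  then have "AE x in lebesgue. x \<in> ball 0 1 \<longrightarrow> u x = L x" by (rule AE_completion)
  then have "AE x in lebesgue_on (ball 0 1). u x = L x"
    by (subst AE_restrict_space_iff) auto
  with L(1) show ?thesis by blast
qed

end
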